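(* Let $G$ be a discrete group with no non-trivial finite normal subgroups and no amenable normalish subgroups. Then $G$ is C*-simple.
   Context: A discrete group $G$ is C*-simple if its reduced group C*-algebra $\mathrm{C}^*_r(G)$ is simple. A subgroup $H<G$ is normalish if for every $n\ge1$ and every $t_1,\dots,t_n\in G$ the intersection $\bigcap_{i=1}^n t_iHt_i^{-1}$ is infinite. *)

theory Defs
  imports "HOL-Analysis.Analysis" "HOL-Algebra.Coset"
begin

definition l2 :: "('a, 'b) monoid_scheme \<Rightarrow> ('a \<Rightarrow> complex) set" where
  "l2 G = {f. (\<forall>x. x \<notin> carrier G \<longrightarrow> f x = 0) \<and>
              (\<lambda>x. (cmod (f x))\<^sup>2) summable_on carrier G}"

definition l2norm :: "('a, 'b) monoid_scheme \<Rightarrow> ('a \<Rightarrow> complex) \<Rightarrow> real" where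
  "l2norm G f = sqrt (infsum (\<lambda>x. (cmod (f x))\<^sup>2) (carrier G))"

text \<open>Bounded linear operators on l2(G); an operator is represented by a function
  that maps l2(G) to l2(G) and is extended by 0 outside l2(G) (so operators are
  identified with their action on l2(G)).\<close>

definition bdd_op :: "('a, 'b) monoid_scheme \<Rightarrow> (('a \<Rightarrow> complex) \<Rightarrow> ('a \<Rightarrow> complex)) \<Rightarrow> bool" where
  "bdd_op G T \<longleftrightarrow>
     (\<forall>f. f \<notin> l2 G \<longrightarrow> T f = (\<lambda>_. 0)) \<and>
     (\<forall>f\<in>l2 G. T f \<in> l2 G) \<and>
     (\<forall>f\<in>l2 G. \<forall>g\<in>l2 G. T (\<lambda>x. f x + g x) = (\<lambda>x. T f x + T g x)) \<and>
     (\<forall>f\<in>l2 G. \<forall>c::complex. T (\<lambda>x. c * f x) = (\<lambda>x. c * T f x)) \<and>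
     (\<exists>C. \<forall>f\<in>l2 G. l2norm G (T f) \<le> C * l2norm G f)"

definition opnorm :: "('a, 'b) monoid_scheme \<Rightarrow> (('a \<Rightarrow> complex) \<Rightarrow> ('a \<Rightarrow> complex)) \<Rightarrow> real" where
  "opnorm G T = Sup {l2norm G (T f) | f. f \<in> l2 G \<and> l2norm G f \<le> 1}"

definition op_zero :: "('a \<Rightarrow> complex) \<Rightarrow> ('a \<Rightarrow> complex)" where
  "op_zero = (\<lambda>f x. 0)"

definition op_add :: "(('a \<Rightarrow> complex) \<Rightarrow> ('a \<Rightarrow> complex)) \<Rightarrow> (('a \<Rightarrow> complex) \<Rightarrow> ('a \<Rightarrow> complex))
    \<Rightarrow> (('a \<Rightarrow> complex) \<Rightarrow> ('a \<Rightarrow> complex))" where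
  "op_add S T = (\<lambda>f x. S f x + T f x)"

definition op_diff :: "(('a \<Rightarrow> complex) \<Rightarrow> ('a \<Rightarrow> complex)) \<Rightarrow> (('a \<Rightarrow> complex) \<Rightarrow> ('a \<Rightarrow> complex))
    \<Rightarrow> (('a \<Rightarrow> complex) \<Rightarrow> ('a \<Rightarrow> complex))" where
  "op_diff S T = (\<lambda>f x. S f x - T f x)"

definition op_scale :: "complex \<Rightarrow> (('a \<Rightarrow> complex) \<Rightarrow> ('a \<Rightarrow> complex))
    \<Rightarrow> (('a \<Rightarrow> complex) \<Rightarrow> ('a \<Rightarrow> complex))" where
  "op_scale c T = (\<lambda>f x. c * T f x)"

definition left_reg :: "('a, 'b) monoid_scheme \<Rightarrow> 'a \<Rightarrow> (('a \<Rightarrow> complex) \<Rightarrow> ('a \<Rightarrow> complex))" where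
  "left_reg G g = (\<lambda>f. if f \<in> l2 G
      then (\<lambda>x. if x \<in> carrier G then f (inv\<^bsub>G\<^esub> g \<otimes>\<^bsub>G\<^esub> x) else 0)
      else (\<lambda>_. 0))"

definition group_algebra_ops :: "('a, 'b) monoid_scheme \<Rightarrow> (('a \<Rightarrow> complex) \<Rightarrow> ('a \<Rightarrow> complex)) set" where
  "group_algebra_ops G =
     {(\<lambda>f x. \<Sum>g\<in>S. c g * left_reg G g f x) | S c. finite S \<and> S \<subseteq> carrier G}"

definition reduced_Cstar :: "('a, 'b) monoid_scheme \<Rightarrow> (('a \<Rightarrow> complex) \<Rightarrow> ('a \<Rightarrow> complex)) set" where
  "reduced_Cstar G = {T. bdd_op G T \<and>
      (\<forall>\<epsilon>>0. \<exists>S\<in>group_algebra_ops G. opnorm G (op_diff T S) < \<epsilon>)}"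

definition closed_ideal_Cr :: "('a, 'b) monoid_scheme \<Rightarrow> (('a \<Rightarrow> complex) \<Rightarrow> ('a \<Rightarrow> complex)) set \<Rightarrow> bool" where
  "closed_ideal_Cr G I \<longleftrightarrow>
     I \<subseteq> reduced_Cstar G \<and> op_zero \<in> I \<and>
     (\<forall>S\<in>I. \<forall>T\<in>I. op_add S T \<in> I) \<and>
     (\<forall>c. \<forall>T\<in>I. op_scale c T \<in> I) \<and>
     (\<forall>A\<in>reduced_Cstar G. \<forall>T\<in>I. A \<circ> T \<in> I \<and> T \<circ> A \<in> I) \<and>
     (\<forall>T\<in>reduced_Cstar G. (\<forall>\<epsilon>>0. \<exists>S\<in>I. opnorm G (op_diff T S) < \<epsilon>) \<longrightarrow> T \<in> I)"

definition C_star_simple :: "('a, 'b) monoid_scheme \<Rightarrow> bool" where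
  "C_star_simple G \<longleftrightarrow>
     (\<forall>I. closed_ideal_Cr G I \<longrightarrow> I = {op_zero} \<or> I = reduced_Cstar G)"

definition amenable_subgroup :: "('a, 'b) monoid_scheme \<Rightarrow> 'a set \<Rightarrow> bool" where
  "amenable_subgroup G H \<longleftrightarrow>
     (\<exists>m :: ('a \<Rightarrow> real) \<Rightarrow> real.
        (\<forall>f g. bounded (f ` H) \<longrightarrow> bounded (g ` H) \<longrightarrow> m (\<lambda>x. f x + g x) = m f + m g) \<and>
        (\<forall>f c. bounded (f ` H) \<longrightarrow> m (\<lambda>x. c * f x) = c * m f) \<and>
        (\<forall>f. bounded (f ` H) \<longrightarrow> (\<forall>x\<in>H. f x \<ge> 0) \<longrightarrow> m f \<ge> 0) \<and>
        m (\<lambda>_. 1) = 1 \<and>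
        (\<forall>f. \<forall>h\<in>H. bounded (f ` H) \<longrightarrow> m (\<lambda>x. f (inv\<^bsub>G\<^esub> h \<otimes>\<^bsub>G\<^esub> x)) = m f))"

definition conjugate :: "('a, 'b) monoid_scheme \<Rightarrow> 'a \<Rightarrow> 'a set \<Rightarrow> 'a set" where
  "conjugate G t H = {t \<otimes>\<^bsub>G\<^esub> h \<otimes>\<^bsub>G\<^esub> inv\<^bsub>G\<^esub> t | h. h \<in> H}"

definition normalish :: "('a, 'b) monoid_scheme \<Rightarrow> 'a set \<Rightarrow> bool" where
  "normalish G H \<longleftrightarrow> subgroup H G \<and>
     (\<forall>n::nat. \<forall>t::nat \<Rightarrow> 'a. n \<ge> 1 \<longrightarrow> t ` {..<n} \<subseteq> carrier G \<longrightarrow>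
        infinite (\<Inter>i<n. conjugate G (t i) H))"

end

theory Submission
  imports Defs
begin

text \<open>Fix a minimal translation-invariant sublinear functional \<open>q\<close> on the bounded functions on \<open>G\<close>
  and an extreme point \<open>m\<close> of the set of means dominated by \<open>q\<close>; it plays the role of a point of
  the Furstenberg boundary. Its stabiliser \<open>H\<close> is amenable because \<open>m\<close> itself is an \<open>H\<close>-invariant
  mean. Hence \<open>H\<close> is not normalish, and a finite intersection of conjugates of \<open>H\<close> of minimal
  cardinality is a finite normal subgroup, so it is trivial.

  Minimality of \<open>q\<close> and extremality of \<open>m\<close> let one push any invariant family of states towards
  \<open>m\<close>. Applied to translates \<open>g t\<^sub>i m\<close> with \<open>\<Inter> t\<^sub>i H t\<^sub>i\<^sup>-\<^sup>1\<close> trivial, this shows that every finite set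
  of non-identity elements has a conjugate disjoint from \<open>H\<close>. Applied to the states vanishing on a
  proper closed ideal \<open>I\<close> it gives one which also vanishes at \<open>\<lambda>\<^sub>s\<close> for \<open>s\<close> outside \<open>H\<close>. Conjugating, for
  any finite set of non-identity \<open>s\<close> some state vanishes on \<open>I\<close> and at all these \<open>\<lambda>\<^sub>s\<close>. So
  the canonical trace vanishes on \<open>I\<close> in the limit, and \<open>I\<close> is zero since the trace is faithful.

  States are represented by means on the unit sphere of \<open>l\<^sup>2(G)\<close>, an operator \<open>T\<close> being identified with
  the function \<open>\<xi> \<mapsto> Re \<langle>T \<xi>, \<xi>\<rangle>\<close>.\<close>

section \<open>Sublinear functionals and means\<close>

text \<open>A sublinear functional stands for the weak-star compact convex set of means below it,
  whose support function it is; infima of chains then replace intersections of compact sets. Pushing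
  towards \<open>m\<close> works as follows. Given an invariant cone \<open>W\<close> of functions
  on \<open>Y\<close> and an equivariant kernel from \<open>Y\<close> to means on \<open>G\<close>,
  compose the kernel with the orbit map of \<open>m\<close> and take the largest value over the
  means on \<open>Y\<close> that are nonnegative on \<open>W\<close>. This is an invariant
  functional below \<open>q\<close>, so minimality makes it equal to \<open>q\<close> on bounded
  functions. Hence \<open>m\<close> is a barycentre of its own orbit for some such mean, and
  extremality concentrates that mean at \<open>m\<close>.

  Working on the unit sphere lets a single mean see operators, through their quadratic forms, and
  bounded functions on \<open>G\<close>, through the densities |xi|^2. A state on the algebra thus
  comes already extended to the multiplication operators on which concentration is tested. The trace
  enters as the squared norm of S applied to the point mass at 1, for S in the group algebra; a
  state vanishing at finitely many translations reproduces this number exactly.\<close>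

definition bfun :: "'i set \<Rightarrow> ('i \<Rightarrow> real) set" where
  "bfun X = {f. bounded (f ` X)}"

lemma bfunI: "(\<And>x. x \<in> X \<Longrightarrow> \<bar>f x\<bar> \<le> B) \<Longrightarrow> f \<in> bfun X"
  by (auto simp: bfun_def bounded_iff)

lemma bfunE:
  assumes "f \<in> bfun X"
  obtains B where "B > 0" "\<And>x. x \<in> X \<Longrightarrow> \<bar>f x\<bar> \<le> B"
proof -
  obtain B where "\<forall>x\<in>X. \<bar>f x\<bar> \<le> B"
    using assms by (auto simp: bfun_def bounded_iff)
  then have "\<And>x. x \<in> X \<Longrightarrow> \<bar>f x\<bar> \<le> max B 1" by force
  then show ?thesis using that[of "max B 1"] by simp
qed

lemma bfun_const [simp, intro]: "(\<lambda>_. c) \<in> bfun X"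
  by (rule bfunI) (rule order_refl)

lemma bfun_add [simp, intro]: "f \<in> bfun X \<Longrightarrow> g \<in> bfun X \<Longrightarrow> (\<lambda>x. f x + g x) \<in> bfun X"
  using bounded_plus_comp[of f X g] by (simp add: bfun_def)

lemma bfun_mult [simp, intro]:
  assumes "f \<in> bfun X" "g \<in> bfun X"
  shows "(\<lambda>x. f x * g x) \<in> bfun X"
proof -
  obtain A where "A > 0" "\<And>x. x \<in> X \<Longrightarrow> \<bar>f x\<bar> \<le> A" using bfunE[OF assms(1)] by blast
  moreover obtain B where "B > 0" "\<And>x. x \<in> X \<Longrightarrow> \<bar>g x\<bar> \<le> B" using bfunE[OF assms(2)] by blast
  ultimately show ?thesis by (intro bfunI[of _ _ "A * B"]) (simp add: abs_mult mult_mono')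
qed

lemma bfun_uminus [simp, intro]: "f \<in> bfun X \<Longrightarrow> (\<lambda>x. - f x) \<in> bfun X"
  using bfun_mult[of "\<lambda>_. -1" X f] by simp

lemma bfun_diff [simp, intro]: "f \<in> bfun X \<Longrightarrow> g \<in> bfun X \<Longrightarrow> (\<lambda>x. f x - g x) \<in> bfun X"
  using bfun_add[of f X "\<lambda>x. - g x"] by simp

lemma bfun_power2 [simp, intro]: "f \<in> bfun X \<Longrightarrow> (\<lambda>x. (f x)\<^sup>2) \<in> bfun X"
  using bfun_mult[of f X f] by (simp add: power2_eq_square)

lemma bfun_sum [simp, intro]: "(\<And>i. i \<in> A \<Longrightarrow> f i \<in> bfun X) \<Longrightarrow> (\<lambda>x. \<Sum>i\<in>A. f i x) \<in> bfun X"
  by (induction A rule: infinite_finite_induct) auto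

section \<open>Sublinear functionals, means and kernels\<close>

text \<open>The bound by any upper bound of \<open>f\<close> carries both monotonicity and
  normalisation: with subadditivity it forces constants to be fixed. It also excludes the empty set,
  where every \<open>B\<close> would be an upper bound.\<close>

definition sublin :: "'i set \<Rightarrow> (('i \<Rightarrow> real) \<Rightarrow> real) \<Rightarrow> bool" where
  "sublin X q \<longleftrightarrow>
     (\<forall>f\<in>bfun X. \<forall>g\<in>bfun X. q (\<lambda>x. f x + g x) \<le> q f + q g) \<and>
     (\<forall>f\<in>bfun X. \<forall>c\<ge>0. q (\<lambda>x. c * f x) = c * q f) \<and>
     (\<forall>f\<in>bfun X. \<forall>B. (\<forall>x\<in>X. f x \<le> B) \<longrightarrow> q f \<le> B)"

definition mean :: "'i set \<Rightarrow> (('i \<Rightarrow> real) \<Rightarrow> real) \<Rightarrow> bool" where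
  "mean X m \<longleftrightarrow> sublin X m \<and> (\<forall>f\<in>bfun X. \<forall>g\<in>bfun X. m (\<lambda>x. f x + g x) = m f + m g)"

text \<open>The comparison is confined to bounded functions because the values of a functional
  elsewhere are arbitrary.\<close>

definition le_on :: "'i set \<Rightarrow> (('i \<Rightarrow> real) \<Rightarrow> real) \<Rightarrow> (('i \<Rightarrow> real) \<Rightarrow> real) \<Rightarrow> bool" where
  "le_on X p q \<longleftrightarrow> (\<forall>f\<in>bfun X. p f \<le> q f)"

lemma sublin_add: "sublin X q \<Longrightarrow> f \<in> bfun X \<Longrightarrow> g \<in> bfun X \<Longrightarrow> q (\<lambda>x. f x + g x) \<le> q f + q g"
  and sublin_scale: "sublin X q \<Longrightarrow> f \<in> bfun X \<Longrightarrow> c \<ge> 0 \<Longrightarrow> q (\<lambda>x. c * f x) = c * q f"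
  and sublin_le: "sublin X q \<Longrightarrow> f \<in> bfun X \<Longrightarrow> (\<And>x. x \<in> X \<Longrightarrow> f x \<le> B) \<Longrightarrow> q f \<le> B"
  by (auto simp: sublin_def)

lemma sublin_zero: "sublin X q \<Longrightarrow> q (\<lambda>_. 0) = 0"
  using sublin_scale[of X q "\<lambda>_. 0" 0] by simp

lemma sublin_mono:
  assumes "sublin X q" "f \<in> bfun X" "g \<in> bfun X" "\<And>x. x \<in> X \<Longrightarrow> f x \<le> g x"
  shows "q f \<le> q g"
proof -
  have "q (\<lambda>x. (f x - g x) + g x) \<le> q (\<lambda>x. f x - g x) + q g"
    by (rule sublin_add[OF assms(1)]) (use assms in auto)
  moreover have "q (\<lambda>x. f x - g x) \<le> 0"
    by (rule sublin_le[OF assms(1)]) (use assms in auto)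
  ultimately show ?thesis by simp
qed

lemma sublin_cong:
  assumes "sublin X q" "f \<in> bfun X" "\<And>x. x \<in> X \<Longrightarrow> f x = g x"
  shows "q f = q g"
proof -
  have "g \<in> bfun X" using assms by (auto simp: bfun_def cong: image_cong)
  then show ?thesis
    using sublin_mono[OF assms(1,2), of g] sublin_mono[OF assms(1) _ assms(2), of g] assms(3) by simp
qed

lemma sublin_uminus: "sublin X q \<Longrightarrow> f \<in> bfun X \<Longrightarrow> - q (\<lambda>x. - f x) \<le> q f"
  using sublin_add[of X q f "\<lambda>x. - f x"] sublin_zero[of X q] by simp

lemma sublin_ge:
  assumes "sublin X q" "f \<in> bfun X" "\<And>x. x \<in> X \<Longrightarrow> B \<le> f x"
  shows "B \<le> q f"
proof -
  have "q (\<lambda>x. - f x) \<le> - B" by (rule sublin_le[OF assms(1)]) (use assms in auto)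
  then show ?thesis using sublin_uminus[OF assms(1,2)] by simp
qed

lemma mean_sublin: "mean X m \<Longrightarrow> sublin X m"
  and mean_add: "mean X m \<Longrightarrow> f \<in> bfun X \<Longrightarrow> g \<in> bfun X \<Longrightarrow> m (\<lambda>x. f x + g x) = m f + m g"
  by (auto simp: mean_def)

lemma mean_uminus: "mean X m \<Longrightarrow> f \<in> bfun X \<Longrightarrow> m (\<lambda>x. - f x) = - m f"
  using mean_add[of X m f "\<lambda>x. - f x"] sublin_zero[of X m] by (simp add: mean_sublin)

lemma mean_diff: "mean X m \<Longrightarrow> f \<in> bfun X \<Longrightarrow> g \<in> bfun X \<Longrightarrow> m (\<lambda>x. f x - g x) = m f - m g"
  using mean_add[of X m f "\<lambda>x. - g x"] by (simp add: mean_uminus)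

lemma mean_scale:
  assumes "mean X m" "f \<in> bfun X"
  shows "m (\<lambda>x. c * f x) = c * m f"
proof (cases "c \<ge> 0")
  case True
  then show ?thesis using assms sublin_scale[OF mean_sublin[OF assms(1)]] by blast
next
  case False
  then have "m (\<lambda>x. - ((-c) * f x)) = - m (\<lambda>x. (-c) * f x)"
    using assms by (intro mean_uminus[OF assms(1)] bfun_mult) auto
  also have "m (\<lambda>x. (-c) * f x) = (-c) * m f"
    using assms False by (intro sublin_scale[OF mean_sublin[OF assms(1)]]) auto
  finally show ?thesis by simp
qed

lemma mean_const:
  assumes "mean X m"
  shows "m (\<lambda>_. c) = c"
  using sublin_le[OF mean_sublin[OF assms], of "\<lambda>_. c" c] sublin_ge[OF mean_sublin[OF assms], of "\<lambda>_. c" c] by simp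

lemma mean_sum:
  assumes "mean X m"
  shows "(\<And>i. i \<in> A \<Longrightarrow> f i \<in> bfun X) \<Longrightarrow> m (\<lambda>x. \<Sum>i\<in>A. f i x) = (\<Sum>i\<in>A. m (f i))"
  by (induction A rule: infinite_finite_induct) (auto simp: mean_const[OF assms] mean_add[OF assms])

lemma meanI:
  assumes "\<And>f g. f \<in> bfun X \<Longrightarrow> g \<in> bfun X \<Longrightarrow> m (\<lambda>x. f x + g x) = m f + m g"
    and "\<And>f c. f \<in> bfun X \<Longrightarrow> m (\<lambda>x. c * f x) = c * m f"
    and "\<And>f B. f \<in> bfun X \<Longrightarrow> (\<And>x. x \<in> X \<Longrightarrow> f x \<le> B) \<Longrightarrow> m f \<le> B"
  shows "mean X m"
  unfolding mean_def sublin_def using assms by auto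

lemma mean_le_eq:
  assumes "mean X m" "mean X n" "le_on X m n" "f \<in> bfun X"
  shows "m f = n f"
proof (rule antisym)
  show "m f \<le> n f" using assms by (auto simp: le_on_def)
  have "m (\<lambda>x. - f x) \<le> n (\<lambda>x. - f x)" using assms by (auto simp: le_on_def)
  then show "n f \<le> m f" using assms by (simp add: mean_uminus)
qed

text \<open>Here \<open>E\<close> is a kernel: each point of \<open>Y\<close> gives a functional on
  \<open>X\<close>, so functions on \<open>X\<close> turn into functions on \<open>Y\<close>.
  Functionals on \<open>Y\<close> are then pulled back to \<open>X\<close> by composition, which is
  how all later functionals arise.\<close>

lemma bfun_compose:
  assumes "\<And>y. y \<in> Y \<Longrightarrow> sublin X (\<lambda>f. E f y)" "f \<in> bfun X"
  shows "E f \<in> bfun Y"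
proof -
  obtain B where "\<And>x. x \<in> X \<Longrightarrow> \<bar>f x\<bar> \<le> B" using bfunE[OF assms(2)] by blast
  then have B: "f x \<le> B" "- B \<le> f x" if "x \<in> X" for x
    using that by (force simp: abs_le_iff)+
  have "\<bar>E f y\<bar> \<le> B" if "y \<in> Y" for y
    using sublin_le[OF assms(1)[OF that] assms(2) B(1)] sublin_ge[OF assms(1)[OF that] assms(2) B(2)]
    by (simp add: abs_le_iff)
  then show ?thesis by (rule bfunI)
qed

lemma sublin_compose:
  assumes "sublin Y p" "\<And>y. y \<in> Y \<Longrightarrow> mean X (\<lambda>f. E f y)"
  shows "sublin X (\<lambda>f. p (E f))"
proof -
  have E: "E f \<in> bfun Y" if "f \<in> bfun X" for f
    using bfun_compose[of Y X E f] assms(2) that mean_sublin by blast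
  show ?thesis unfolding sublin_def
  proof (intro conjI ballI allI impI)
    fix f g assume fg: "f \<in> bfun X" "g \<in> bfun X"
    have "p (E (\<lambda>x. f x + g x)) = p (\<lambda>y. E f y + E g y)"
      by (rule sublin_cong[OF assms(1)]) (use fg E mean_add[OF assms(2)] in auto)
    also have "\<dots> \<le> p (E f) + p (E g)" by (rule sublin_add[OF assms(1) E E]) (rule fg)+
    finally show "p (E (\<lambda>x. f x + g x)) \<le> p (E f) + p (E g)" .
  next
    fix f and c :: real assume f: "f \<in> bfun X" "0 \<le> c"
    have "p (E (\<lambda>x. c * f x)) = p (\<lambda>y. c * E f y)"
      by (rule sublin_cong[OF assms(1)]) (use f E mean_scale[OF assms(2)] in auto)
    also have "\<dots> = c * p (E f)" by (rule sublin_scale[OF assms(1) E]) (use f in auto)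
    finally show "p (E (\<lambda>x. c * f x)) = c * p (E f)" .
  next
    fix f B assume f: "f \<in> bfun X" "\<forall>x\<in>X. f x \<le> B"
    have "E f y \<le> B" if "y \<in> Y" for y
      using sublin_le[OF mean_sublin[OF assms(2)[OF that]]] f by blast
    then show "p (E f) \<le> B" using sublin_le[OF assms(1) E[OF f(1)]] by blast
  qed
qed

lemma mean_compose:
  assumes "mean Y p" "\<And>y. y \<in> Y \<Longrightarrow> mean X (\<lambda>f. E f y)"
  shows "mean X (\<lambda>f. p (E f))"
  unfolding mean_def
proof (intro conjI ballI)
  show "sublin X (\<lambda>f. p (E f))" using sublin_compose[OF mean_sublin[OF assms(1)] assms(2)] .
  have E: "E f \<in> bfun Y" if "f \<in> bfun X" for f
    using bfun_compose[of Y X E f] assms(2) that mean_sublin by blast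
  fix f g assume fg: "f \<in> bfun X" "g \<in> bfun X"
  have "p (E (\<lambda>x. f x + g x)) = p (\<lambda>y. E f y + E g y)"
    by (rule sublin_cong[OF mean_sublin[OF assms(1)]]) (use fg E mean_add[OF assms(2)] in auto)
  also have "\<dots> = p (E f) + p (E g)" by (rule mean_add[OF assms(1) E E]) (rule fg)+
  finally show "p (E (\<lambda>x. f x + g x)) = p (E f) + p (E g)" .
qed

lemma mean_eval: "x \<in> X \<Longrightarrow> mean X (\<lambda>f. f x)"
  by (rule meanI) auto

section \<open>Infima of chains and minimal functionals\<close>

text \<open>Infima of sublinear functionals need not be subadditive. In a chain they are: of two
  members nearly optimal for \<open>f\<close> and for \<open>g\<close>, the smaller one serves
  both.\<close>

lemma sublin_INF:
  assumes C: "C \<noteq> {}" "\<And>q. q \<in> C \<Longrightarrow> sublin X q"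
    and chain: "\<And>p q. p \<in> C \<Longrightarrow> q \<in> C \<Longrightarrow> le_on X p q \<or> le_on X q p"
    and u: "\<And>f. f \<in> bfun X \<Longrightarrow> u f = (INF q\<in>C. q f)"
  shows "sublin X u" and "\<And>q. q \<in> C \<Longrightarrow> le_on X u q"
proof -
  have bdd: "bdd_below ((\<lambda>q. q f) ` C)" if "f \<in> bfun X" for f
  proof -
    obtain B where "\<And>x. x \<in> X \<Longrightarrow> \<bar>f x\<bar> \<le> B" using bfunE[OF \<open>f \<in> bfun X\<close>] by blast
    then have B: "- B \<le> f x" if "x \<in> X" for x using that by (force simp: abs_le_iff)
    have "- B \<le> q f" if "q \<in> C" for q
      by (rule sublin_ge[OF C(2)[OF that] \<open>f \<in> bfun X\<close> B])
    then show ?thesis by (intro bdd_belowI[of _ "- B"]) auto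
  qed
  have ule: "u f \<le> q f" if "q \<in> C" "f \<in> bfun X" for f q
    using u[OF that(2)] cINF_lower[OF bdd[OF that(2)] that(1)] by simp
  then show "\<And>q. q \<in> C \<Longrightarrow> le_on X u q" by (simp add: le_on_def)
  have uge: "B \<le> u f" if "f \<in> bfun X" "\<And>q. q \<in> C \<Longrightarrow> B \<le> q f" for f B
    using u[OF that(1)] cINF_greatest[OF C(1), of B "\<lambda>q. q f"] that(2) by simp
  show "sublin X u" unfolding sublin_def
  proof (intro conjI ballI allI impI)
    fix f g assume fg: "f \<in> bfun X" "g \<in> bfun X"
    have "u (\<lambda>x. f x + g x) \<le> q1 f + q2 g" if q: "q1 \<in> C" "q2 \<in> C" for q1 q2
    proof -
      obtain r where r: "r \<in> C" "r f \<le> q1 f" "r g \<le> q2 g"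
        using chain[OF q] q fg by (auto simp: le_on_def)
      then show ?thesis using ule[OF r(1), of "\<lambda>x. f x + g x"] sublin_add[OF C(2)[OF r(1)] fg] fg by simp
    qed
    then have "u (\<lambda>x. f x + g x) - q2 g \<le> u f" if "q2 \<in> C" for q2
      by (intro uge fg) (simp add: diff_le_eq that)
    then have "u (\<lambda>x. f x + g x) - u f \<le> u g"
      by (intro uge fg) (simp add: diff_le_eq algebra_simps)
    then show "u (\<lambda>x. f x + g x) \<le> u f + u g" by simp
  next
    fix f and c :: real assume f: "f \<in> bfun X" "0 \<le> c"
    have *: "c * u f \<le> u (\<lambda>x. c * f x)" if "f \<in> bfun X" "0 \<le> c" for f c
    proof (rule uge)
      fix q assume "q \<in> C"
      then show "c * u f \<le> q (\<lambda>x. c * f x)"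
        using sublin_scale[OF C(2)[OF \<open>q \<in> C\<close>] that] mult_left_mono[OF ule[OF \<open>q \<in> C\<close> that(1)] that(2)]
        by simp
    qed (use that in auto)
    show "u (\<lambda>x. c * f x) = c * u f"
    proof (cases "c = 0")
      case True
      obtain q where "q \<in> C" using C(1) by auto
      then have "u (\<lambda>_. 0) \<le> 0" using ule[of q "\<lambda>_. 0"] sublin_zero[OF C(2)[of q]] by simp
      moreover have "0 \<le> u (\<lambda>_. 0)"
      proof (rule uge)
        show "0 \<le> q (\<lambda>_. 0)" if "q \<in> C" for q using sublin_zero[OF C(2)[OF that]] by simp
      qed simp
      ultimately show ?thesis using True by simp
    next
      case False
      \<comment> \<open>The infimum directly yields only one inequality; the converse is the same
        inequality for the factor \<open>1/c\<close> and the function \<open>c * f\<close>.\<close>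
      have "(1/c) * u (\<lambda>x. c * f x) \<le> u (\<lambda>x. (1/c) * (c * f x))" by (rule *) (use f in auto)
      then have "u (\<lambda>x. c * f x) \<le> c * u f" using False f by (simp add: field_simps)
      then show ?thesis using *[OF f] by simp
    qed
  next
    fix f B assume f: "f \<in> bfun X" "\<forall>x\<in>X. f x \<le> B"
    obtain q where "q \<in> C" using C(1) by auto
    then show "u f \<le> B" using ule[of q f] sublin_le[OF C(2)[of q] f(1), of B] f by force
  qed
qed

text \<open>Zorn's lemma for an arbitrary property \<open>Q\<close> stable under infima of chains.
  It is applied to invariant functionals, to find \<open>q\<close>, and to faces, to find
  \<open>m\<close>.\<close>

lemma minimal_sublin:
  assumes q0: "Q q0"
    and closed: "\<And>C u. C \<noteq> {} \<Longrightarrow> (\<And>q. q \<in> C \<Longrightarrow> Q q) \<Longrightarrow>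
        (\<And>p q. p \<in> C \<Longrightarrow> q \<in> C \<Longrightarrow> le_on X p q \<or> le_on X q p) \<Longrightarrow>
        (\<And>f. f \<in> bfun X \<Longrightarrow> u f = (INF q\<in>C. q f)) \<Longrightarrow> Q u"
    and sub: "\<And>q. Q q \<Longrightarrow> sublin X q"
  obtains q where "Q q" "\<And>r. Q r \<Longrightarrow> le_on X r q \<Longrightarrow> le_on X q r"
proof -
  \<comment> \<open>Antisymmetry would fail for functionals that differ only on unbounded functions,
    so each is normalised to 0 there. \<open>Q\<close> survives this because \<open>ext p\<close> is
    an infimum of the one-element chain \<open>{p}\<close>.\<close>
  define ext where "ext p = (\<lambda>f. if f \<in> bfun X then p f else 0)" for p :: "('a \<Rightarrow> real) \<Rightarrow> real"
  have Qext: "Q (ext p)" if "Q p" for p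
    by (rule closed[of "{p}"]) (use that in \<open>auto simp: ext_def le_on_def\<close>)
  define A where "A = {q. Q q \<and> ext q = q}"
  have po: "partial_order_on A (relation_of (\<lambda>p q. le_on X q p) A)"
  proof (rule partial_order_on_relation_ofI)
    fix a b assume "a \<in> A" "b \<in> A" "le_on X b a" "le_on X a b"
    then have "ext a = ext b" by (auto simp: le_on_def ext_def fun_eq_iff intro: antisym)
    then show "a = b" using \<open>a \<in> A\<close> \<open>b \<in> A\<close> by (simp add: A_def)
  qed (auto simp: le_on_def intro: order_trans)
  have "\<exists>u\<in>A. \<forall>a\<in>C. le_on X u a" if "C \<in> Chains (relation_of (\<lambda>p q. le_on X q p) A)" for C
  proof (cases "C = {}")
    case True
    have "ext q0 \<in> A" using Qext[OF q0] by (auto simp: A_def ext_def)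
    then show ?thesis using True by blast
  next
    case False
    have C: "\<And>q. q \<in> C \<Longrightarrow> Q q" "\<And>p q. p \<in> C \<Longrightarrow> q \<in> C \<Longrightarrow> le_on X p q \<or> le_on X q p"
      using that by (auto simp: Chains_def relation_of_def A_def)
    let ?u = "ext (\<lambda>f. INF q\<in>C. q f)"
    have u: "\<And>f. f \<in> bfun X \<Longrightarrow> ?u f = (INF q\<in>C. q f)" by (simp add: ext_def)
    have "Q ?u" by (rule closed[OF False C u])
    then have "?u \<in> A" by (auto simp: A_def ext_def)
    moreover have "le_on X ?u q" if "q \<in> C" for q
      by (rule sublin_INF(2)[OF False sub[OF C(1)] C(2) u that])
    ultimately show ?thesis by blast
  qed
  from predicate_Zorn[OF po this] obtain q where q: "q \<in> A" "\<And>a. a \<in> A \<Longrightarrow> le_on X a q \<Longrightarrow> a = q"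
    by blast
  show ?thesis
  proof (rule that)
    show "Q q" using q by (simp add: A_def)
    fix r assume r: "Q r" "le_on X r q"
    have "ext r = q"
    proof (rule q(2))
      show "ext r \<in> A" using Qext[OF r(1)] by (auto simp: A_def ext_def)
      show "le_on X (ext r) q" using r(2) by (simp add: le_on_def ext_def)
    qed
    then show "le_on X q r" by (auto simp: le_on_def ext_def)
  qed
qed

section \<open>Faces and extreme means\<close>

text \<open>\<open>p\<close> is the support function of a face of the convex set of means below
  \<open>q\<close>. A conclusion about \<open>n1\<close> alone suffices, since \<open>c\<close> and
  \<open>1 - c\<close> may be exchanged. When \<open>p\<close> is itself a mean, it is an extreme
  point of that set.\<close>

definition face :: "'i set \<Rightarrow> (('i \<Rightarrow> real) \<Rightarrow> real) \<Rightarrow> (('i \<Rightarrow> real) \<Rightarrow> real) \<Rightarrow> bool" where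
  "face X q p \<longleftrightarrow> sublin X p \<and> le_on X p q \<and>
     (\<forall>n1 n2 c. mean X n1 \<longrightarrow> mean X n2 \<longrightarrow> le_on X n1 q \<longrightarrow> le_on X n2 q \<longrightarrow> 0 < c \<longrightarrow> c < 1 \<longrightarrow>
        le_on X (\<lambda>f. c * n1 f + (1 - c) * n2 f) p \<longrightarrow> le_on X n1 p)"

lemma face_refl: "sublin X q \<Longrightarrow> face X q q"
  by (auto simp: face_def le_on_def)

lemma face_INF:
  assumes "C \<noteq> {}" "\<And>p. p \<in> C \<Longrightarrow> face X q p"
    and "\<And>p r. p \<in> C \<Longrightarrow> r \<in> C \<Longrightarrow> le_on X p r \<or> le_on X r p"
    and u: "\<And>f. f \<in> bfun X \<Longrightarrow> u f = (INF p\<in>C. p f)"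
  shows "face X q u"
proof -
  have sub: "\<And>p. p \<in> C \<Longrightarrow> sublin X p" using assms(2) by (simp add: face_def)
  have S: "sublin X u" and L: "\<And>p. p \<in> C \<Longrightarrow> le_on X u p"
    using sublin_INF[OF assms(1) sub assms(3) u] by auto
  show ?thesis unfolding face_def
  proof (intro conjI allI impI S)
    obtain p where "p \<in> C" using assms(1) by auto
    then show "le_on X u q" using L assms(2) unfolding face_def le_on_def by (meson order_trans)
  next
    fix n1 n2 and c :: real
    assume *: "mean X n1" "mean X n2" "le_on X n1 q" "le_on X n2 q" "0 < c" "c < 1"
      "le_on X (\<lambda>f. c * n1 f + (1 - c) * n2 f) u"
    have "le_on X n1 p" if "p \<in> C" for p
    proof -
      have "le_on X (\<lambda>f. c * n1 f + (1 - c) * n2 f) p"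
        using *(7) L[OF that] unfolding le_on_def by (meson order_trans)
      then show ?thesis using * assms(2)[OF that] unfolding face_def by blast
    qed
    then show "le_on X n1 u" using u assms(1) by (auto simp: le_on_def intro!: cINF_greatest)
  qed
qed

text \<open>The one-sided derivative of \<open>q\<close> at \<open>f0\<close> in direction
  \<open>f\<close>. It is the support function of an exposed face: a mean \<open>n\<close> lies
  below it exactly when \<open>n\<close> lies below \<open>q\<close> and
  \<open>n f0 = q f0\<close>.\<close>

definition tilt :: "(('i \<Rightarrow> real) \<Rightarrow> real) \<Rightarrow> ('i \<Rightarrow> real) \<Rightarrow> ('i \<Rightarrow> real) \<Rightarrow> real" where
  "tilt q f0 f = (INF t\<in>{0..}. q (\<lambda>x. f x + t * f0 x) - t * q f0)"

lemma
  assumes q: "sublin X q" and f0: "f0 \<in> bfun X"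
  shows tilt_sublin: "sublin X (tilt q f0)"
    and tilt_le: "\<And>t f. t \<ge> 0 \<Longrightarrow> f \<in> bfun X \<Longrightarrow> tilt q f0 f \<le> q (\<lambda>x. f x + t * f0 x) - t * q f0"
    and tilt_ge: "\<And>f B. f \<in> bfun X \<Longrightarrow>
      (\<And>t. t \<ge> 0 \<Longrightarrow> B \<le> q (\<lambda>x. f x + t * f0 x) - t * q f0) \<Longrightarrow> B \<le> tilt q f0 f"
proof -
  have tf: "(\<lambda>x. f x + t * f0 x) \<in> bfun X" if "f \<in> bfun X" for f t
    using that f0 by auto
  have bdd: "bdd_below ((\<lambda>t. q (\<lambda>x. f x + t * f0 x) - t * q f0) ` {0..})" if f: "f \<in> bfun X" for f
  proof -
    have "- q (\<lambda>x. - f x) \<le> q (\<lambda>x. f x + t * f0 x) - t * q f0" if "0 \<le> t" for t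
      using sublin_add[OF q tf[OF f, of t], of "\<lambda>x. - f x"] f sublin_scale[OF q f0 that] by simp
    then show ?thesis by (intro bdd_belowI[of _ "- q (\<lambda>x. - f x)"]) auto
  qed
  show le: "tilt q f0 f \<le> q (\<lambda>x. f x + t * f0 x) - t * q f0" if "t \<ge> 0" "f \<in> bfun X" for t f
    unfolding tilt_def using cINF_lower[OF bdd[OF that(2)], of t] that(1) by simp
  show ge: "B \<le> tilt q f0 f" if "f \<in> bfun X" "\<And>t. t \<ge> 0 \<Longrightarrow> B \<le> q (\<lambda>x. f x + t * f0 x) - t * q f0" for f B
    unfolding tilt_def by (rule cINF_greatest) (use that in auto)
  show "sublin X (tilt q f0)" unfolding sublin_def
  proof (intro conjI ballI allI impI)
    fix f g assume fg: "f \<in> bfun X" "g \<in> bfun X"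
    have *: "tilt q f0 (\<lambda>x. f x + g x) \<le> (q (\<lambda>x. f x + s * f0 x) - s * q f0) + (q (\<lambda>x. g x + t * f0 x) - t * q f0)"
      if "s \<ge> 0" "t \<ge> 0" for s t
    proof -
      have "q (\<lambda>x. (f x + s * f0 x) + (g x + t * f0 x)) \<le> q (\<lambda>x. f x + s * f0 x) + q (\<lambda>x. g x + t * f0 x)"
        using sublin_add[OF q tf[OF fg(1), of s] tf[OF fg(2), of t]] .
      moreover have "(\<lambda>x. (f x + s * f0 x) + (g x + t * f0 x)) = (\<lambda>x. (f x + g x) + (s + t) * f0 x)"
        by (simp add: algebra_simps)
      ultimately show ?thesis using le[of "s + t" "\<lambda>x. f x + g x"] that fg by (simp add: algebra_simps)
    qed
    have "tilt q f0 (\<lambda>x. f x + g x) - (q (\<lambda>x. g x + t * f0 x) - t * q f0) \<le> tilt q f0 f" if "t \<ge> 0" for t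
      by (rule ge[OF fg(1)]) (use *[of _ t] that in \<open>simp add: algebra_simps\<close>)
    then have "tilt q f0 (\<lambda>x. f x + g x) - tilt q f0 f \<le> tilt q f0 g"
      by (intro ge[OF fg(2)]) (simp add: algebra_simps)
    then show "tilt q f0 (\<lambda>x. f x + g x) \<le> tilt q f0 f + tilt q f0 g" by simp
  next
    fix f and c :: real assume f: "f \<in> bfun X" "0 \<le> c"
    have pos: "tilt q f0 (\<lambda>x. c * f x) \<le> c * tilt q f0 f" if "c > 0" "f \<in> bfun X" for c f
    proof -
      have "tilt q f0 (\<lambda>x. c * f x) / c \<le> tilt q f0 f"
      proof (rule ge[OF that(2)])
        fix t :: real assume "t \<ge> 0"
        have "tilt q f0 (\<lambda>x. c * f x) \<le> q (\<lambda>x. c * f x + (c * t) * f0 x) - (c * t) * q f0"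
          by (rule le) (use that \<open>t \<ge> 0\<close> in auto)
        also have "(\<lambda>x. c * f x + (c * t) * f0 x) = (\<lambda>x. c * (f x + t * f0 x))"
          by (simp add: algebra_simps)
        also have "q \<dots> = c * q (\<lambda>x. f x + t * f0 x)"
          by (rule sublin_scale[OF q tf[OF that(2)]]) (use that in simp)
        finally show "tilt q f0 (\<lambda>x. c * f x) / c \<le> q (\<lambda>x. f x + t * f0 x) - t * q f0"
          using that by (simp add: field_simps)
      qed
      then show ?thesis using that by (simp add: field_simps)
    qed
    show "tilt q f0 (\<lambda>x. c * f x) = c * tilt q f0 f"
    proof (cases "c = 0")
      case True
      have "tilt q f0 (\<lambda>_. 0) \<le> 0" using le[of 0 "\<lambda>_. 0"] sublin_zero[OF q] by simp
      moreover have "0 \<le> tilt q f0 (\<lambda>_. 0)"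
        by (rule ge) (use sublin_scale[OF q f0] in auto)
      ultimately show ?thesis using True by simp
    next
      case False
      have "tilt q f0 (\<lambda>x. (1/c) * (c * f x)) \<le> (1/c) * tilt q f0 (\<lambda>x. c * f x)" by (rule pos) (use f False in auto)
      then have "c * tilt q f0 f \<le> tilt q f0 (\<lambda>x. c * f x)" using False f by (simp add: field_simps)
      then show ?thesis using pos[of c f] f False by simp
    qed
  next
    fix f B assume f: "f \<in> bfun X" "\<forall>x\<in>X. f x \<le> B"
    then have "q f \<le> B" using sublin_le[OF q f(1)] by blast
    then show "tilt q f0 f \<le> B" using le[of 0 f] f(1) by simp
  qed
qed

text \<open>One Zorn argument gives both Hahn-Banach and Krein-Milman: a minimal face is a single
  linear functional, because tilting a face in any direction cuts out an exposed subface.\<close>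

lemma extreme_mean_below:
  assumes q: "sublin X q"
  obtains m where "mean X m" "face X q m"
proof -
  obtain m where m: "face X q m" and min: "\<And>r. face X q r \<Longrightarrow> le_on X r m \<Longrightarrow> le_on X m r"
  proof (rule minimal_sublin[of "face X q" q X])
    show "face X q q" by (rule face_refl[OF q])
    show "face X q u" if "C \<noteq> {}" "\<And>p. p \<in> C \<Longrightarrow> face X q p"
      "\<And>p r. p \<in> C \<Longrightarrow> r \<in> C \<Longrightarrow> le_on X p r \<or> le_on X r p"
      "\<And>f. f \<in> bfun X \<Longrightarrow> u f = (INF p\<in>C. p f)" for C u
      using that by (rule face_INF)
    show "sublin X p" if "face X q p" for p using that by (simp add: face_def)
  qed blast
  have ms: "sublin X m" and mq: "le_on X m q" using m by (auto simp: face_def)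
  have "m f + m f0 \<le> m (\<lambda>x. f x + f0 x)" if f: "f \<in> bfun X" and f0: "f0 \<in> bfun X" for f f0
  proof -
    define p where "p = tilt m f0"
    note p_le = tilt_le[OF ms f0, folded p_def] and p_ge = tilt_ge[OF ms f0, folded p_def]
    have pm: "le_on X p m" unfolding le_on_def using p_le[of 0] by simp
    have "face X q p" unfolding face_def
    proof (intro conjI allI impI)
      show "sublin X p" using tilt_sublin[OF ms f0, folded p_def] .
      show "le_on X p q" using pm mq unfolding le_on_def by (meson order_trans)
      fix n1 n2 and c :: real
      assume n: "mean X n1" "mean X n2" "le_on X n1 q" "le_on X n2 q" and c: "0 < c" "c < 1"
        and le: "le_on X (\<lambda>f. c * n1 f + (1 - c) * n2 f) p"
      have le': "le_on X (\<lambda>f. c * n1 f + (1 - c) * n2 f) m"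
        using le pm unfolding le_on_def by (meson order_trans)
      then have 1: "le_on X n1 m" using m n c unfolding face_def by blast
      have 2: "le_on X n2 m"
      proof -
        have "le_on X (\<lambda>f. (1 - c) * n2 f + (1 - (1 - c)) * n1 f) m"
          using le' by (simp add: add.commute)
        moreover have "0 < 1 - c" "1 - c < 1" using c by auto
        ultimately show ?thesis using m n unfolding face_def by blast
      qed
      \<comment> \<open>Testing at \<open>- f0\<close> shows that the convex combination attains at
        least \<open>m f0\<close> at \<open>f0\<close>. As \<open>n2\<close> cannot exceed that
        value, \<open>n1\<close> must reach it, which places \<open>n1\<close> in the exposed
        face.\<close>
      have "c * n1 (\<lambda>x. - f0 x) + (1 - c) * n2 (\<lambda>x. - f0 x) \<le> p (\<lambda>x. - f0 x)"
        using le f0 by (simp add: le_on_def)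
      also have "\<dots> \<le> - m f0" using p_le[of 1 "\<lambda>x. - f0 x"] f0 sublin_zero[OF ms] by simp
      finally have "m f0 \<le> c * n1 f0 + (1 - c) * n2 f0" using n f0 by (simp add: mean_uminus)
      moreover have "(1 - c) * n2 f0 \<le> (1 - c) * m f0" using 2 c f0 by (simp add: le_on_def)
      ultimately have "c * m f0 \<le> c * n1 f0" by (simp add: algebra_simps)
      then have n1f0: "m f0 \<le> n1 f0" using c by simp
      show "le_on X n1 p" unfolding le_on_def
      proof
        fix h assume h: "h \<in> bfun X"
        show "n1 h \<le> p h"
        proof (rule p_ge[OF h])
          fix t :: real assume t: "t \<ge> 0"
          have "n1 (\<lambda>x. h x + t * f0 x) = n1 h + t * n1 f0"
            using mean_add[OF n(1) h, of "\<lambda>x. t * f0 x"] mean_scale[OF n(1) f0, of t] f0 by simp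
          moreover have "n1 (\<lambda>x. h x + t * f0 x) \<le> m (\<lambda>x. h x + t * f0 x)"
            using 1 h f0 by (simp add: le_on_def)
          moreover have "t * m f0 \<le> t * n1 f0" using n1f0 t by (rule mult_left_mono)
          ultimately show "n1 h \<le> m (\<lambda>x. h x + t * f0 x) - t * m f0" by simp
        qed
      qed
    qed
    \<comment> \<open>Minimality says that tilting changes nothing; the parameter
      \<open>t = 1\<close> turns this into superadditivity.\<close>
    then have "m f \<le> p f" using min[OF _ pm] f by (simp add: le_on_def)
    also have "\<dots> \<le> m (\<lambda>x. f x + f0 x) - m f0" using p_le[of 1 f] f by simp
    finally show ?thesis by simp
  qed
  then have "mean X m" unfolding mean_def using ms sublin_add[OF ms] by (auto intro: antisym)
  then show ?thesis using that m by blast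
qed

section \<open>Means that are nonnegative on a cone\<close>

text \<open>The last condition says that no member is bounded above by a negative constant. This is
  the obstruction to a mean that is nonnegative on \<open>W\<close>, and \<open>cone_mean\<close>
  shows it is the only one.\<close>

definition cone_on :: "'i set \<Rightarrow> ('i \<Rightarrow> real) set \<Rightarrow> bool" where
  "cone_on Y W \<longleftrightarrow> W \<subseteq> bfun Y \<and> (\<lambda>_. 0) \<in> W \<and>
     (\<forall>v\<in>W. \<forall>w\<in>W. (\<lambda>y. v y + w y) \<in> W) \<and> (\<forall>c>0. \<forall>w\<in>W. (\<lambda>y. c * w y) \<in> W) \<and>
     (\<forall>w\<in>W. \<forall>B. (\<forall>y\<in>Y. w y \<le> B) \<longrightarrow> 0 \<le> B)"

text \<open>By Hahn-Banach duality this is the largest value at \<open>h\<close> of a mean that is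
  nonnegative on \<open>W\<close>.\<close>

definition cone_sup :: "'i set \<Rightarrow> ('i \<Rightarrow> real) set \<Rightarrow> ('i \<Rightarrow> real) \<Rightarrow> real" where
  "cone_sup Y W h = Inf {B. \<exists>w\<in>W. \<forall>y\<in>Y. h y + w y \<le> B}"

lemma
  assumes "cone_on Y W"
  shows cone_sup_sublin: "sublin Y (cone_sup Y W)"
    and cone_sup_le: "\<And>h w B. h \<in> bfun Y \<Longrightarrow> w \<in> W \<Longrightarrow> (\<And>y. y \<in> Y \<Longrightarrow> h y + w y \<le> B) \<Longrightarrow> cone_sup Y W h \<le> B"
    and cone_sup_ge: "\<And>h A. h \<in> bfun Y \<Longrightarrow>
       (\<And>w B. w \<in> W \<Longrightarrow> (\<And>y. y \<in> Y \<Longrightarrow> h y + w y \<le> B) \<Longrightarrow> A \<le> B) \<Longrightarrow> A \<le> cone_sup Y W h"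
proof -
  note W = assms[unfolded cone_on_def]
  then have zero: "(\<lambda>_. 0) \<in> W" by blast
  have bdd: "bdd_below {B. \<exists>w\<in>W. \<forall>y\<in>Y. h y + w y \<le> B}" if "h \<in> bfun Y" for h
  proof -
    obtain A where A: "\<And>x. x \<in> Y \<Longrightarrow> \<bar>h x\<bar> \<le> A" using bfunE[OF \<open>h \<in> bfun Y\<close>] by blast
    \<comment> \<open>The infimum is finite because of the last cone condition: an upper bound of
      \<open>h + w\<close> below \<open>-A\<close> would bound \<open>w\<close> above by a negative
      constant.\<close>
    have "- A \<le> B" if "w \<in> W" "\<forall>y\<in>Y. h y + w y \<le> B" for w B
    proof -
      have "\<forall>y\<in>Y. w y \<le> A + B" using that A by (smt (verit))
      then have "0 \<le> A + B" using W that(1) by blast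
      then show ?thesis by simp
    qed
    then show ?thesis by (intro bdd_belowI[of _ "-A"]) blast
  qed
  have ne: "{B. \<exists>w\<in>W. \<forall>y\<in>Y. h y + w y \<le> B} \<noteq> {}" if "h \<in> bfun Y" for h
  proof -
    obtain A where A: "\<And>x. x \<in> Y \<Longrightarrow> \<bar>h x\<bar> \<le> A" using bfunE[OF \<open>h \<in> bfun Y\<close>] by blast
    then have "\<forall>y\<in>Y. h y + (\<lambda>_. 0) y \<le> A" by (auto simp: abs_le_iff)
    moreover have "(\<lambda>_. 0) \<in> W" using W by blast
    ultimately have "A \<in> {B. \<exists>w\<in>W. \<forall>y\<in>Y. h y + w y \<le> B}" by (intro CollectI bexI)
    then show ?thesis by (rule ex_in_conv[THEN iffD1, OF exI])
  qed
  show le: "cone_sup Y W h \<le> B" if "h \<in> bfun Y" "w \<in> W" "\<And>y. y \<in> Y \<Longrightarrow> h y + w y \<le> B" for h w B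
    unfolding cone_sup_def by (rule cInf_lower[OF _ bdd]) (use that in auto)
  show ge: "A \<le> cone_sup Y W h" if "h \<in> bfun Y"
     "\<And>w B. w \<in> W \<Longrightarrow> (\<And>y. y \<in> Y \<Longrightarrow> h y + w y \<le> B) \<Longrightarrow> A \<le> B" for h A
    unfolding cone_sup_def by (rule cInf_greatest[OF ne]) (use that in auto)
  show "sublin Y (cone_sup Y W)" unfolding sublin_def
  proof (intro conjI ballI allI impI)
    fix f g assume fg: "f \<in> bfun Y" "g \<in> bfun Y"
    have *: "cone_sup Y W (\<lambda>x. f x + g x) \<le> A + B"
      if "v \<in> W" "\<And>y. y \<in> Y \<Longrightarrow> f y + v y \<le> A" "w \<in> W" "\<And>y. y \<in> Y \<Longrightarrow> g y + w y \<le> B" for v w A B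
    proof (rule le[of _ "\<lambda>y. v y + w y"])
      show "(\<lambda>y. v y + w y) \<in> W" using W that by blast
      show "f y + g y + (v y + w y) \<le> A + B" if "y \<in> Y" for y
        using \<open>\<And>y. y \<in> Y \<Longrightarrow> f y + v y \<le> A\<close>[OF that] \<open>\<And>y. y \<in> Y \<Longrightarrow> g y + w y \<le> B\<close>[OF that] by simp
    qed (use fg in auto)
    have "cone_sup Y W (\<lambda>x. f x + g x) - B \<le> cone_sup Y W f"
      if "w \<in> W" "\<And>y. y \<in> Y \<Longrightarrow> g y + w y \<le> B" for w B
      by (rule ge[OF fg(1)]) (use * that in \<open>force simp: diff_le_eq\<close>)
    then have "cone_sup Y W (\<lambda>x. f x + g x) - cone_sup Y W f \<le> cone_sup Y W g"
      by (intro ge[OF fg(2)]) (force simp: algebra_simps)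
    then show "cone_sup Y W (\<lambda>x. f x + g x) \<le> cone_sup Y W f + cone_sup Y W g" by simp
  next
    fix f and c :: real assume f: "f \<in> bfun Y" "0 \<le> c"
    have pos: "cone_sup Y W (\<lambda>x. c * f x) \<le> c * cone_sup Y W f" if c: "c > 0" and f: "f \<in> bfun Y" for c f
    proof -
      have "cone_sup Y W (\<lambda>x. c * f x) / c \<le> cone_sup Y W f"
      proof (rule ge[OF f])
        fix w B assume w: "w \<in> W" "\<And>y. y \<in> Y \<Longrightarrow> f y + w y \<le> B"
        have "cone_sup Y W (\<lambda>x. c * f x) \<le> c * B"
        proof (rule le[of _ "\<lambda>y. c * w y"])
          show "c * f y + c * w y \<le> c * B" if "y \<in> Y" for y
            using mult_left_mono[OF w(2)[OF that], of c] c by (simp add: algebra_simps)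
        qed (use f w c W in auto)
        then show "cone_sup Y W (\<lambda>x. c * f x) / c \<le> B" using c by (simp add: field_simps)
      qed
      then show ?thesis using c by (simp add: field_simps)
    qed
    show "cone_sup Y W (\<lambda>x. c * f x) = c * cone_sup Y W f"
    proof (cases "c = 0")
      case True
      have "cone_sup Y W (\<lambda>_. 0) \<le> 0" by (rule le[OF bfun_const zero]) simp
      moreover have "0 \<le> cone_sup Y W (\<lambda>_. 0)"
        using W by (intro ge[OF bfun_const]) fastforce
      ultimately show ?thesis using True by simp
    next
      case False
      have "cone_sup Y W (\<lambda>x. (1/c) * (c * f x)) \<le> (1/c) * cone_sup Y W (\<lambda>x. c * f x)"
        by (rule pos) (use f False in auto)
      then have "c * cone_sup Y W f \<le> cone_sup Y W (\<lambda>x. c * f x)" using False f by (simp add: field_simps)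
      then show ?thesis using pos[of c f] f False by simp
    qed
  next
    fix f B assume f: "f \<in> bfun Y" "\<forall>x\<in>Y. f x \<le> B"
    then show "cone_sup Y W f \<le> B" using le[OF f(1) zero, of B] by simp
  qed
qed

text \<open>Every mean below \<open>cone_sup Y W\<close> works: for \<open>- w\<close> the choice of
  \<open>w\<close> itself in the infimum gives the upper bound 0.\<close>

lemma cone_mean:
  assumes "cone_on Y W"
  obtains \<psi> where "mean Y \<psi>" "\<And>w. w \<in> W \<Longrightarrow> 0 \<le> \<psi> w"
proof -
  obtain \<psi> where \<psi>: "mean Y \<psi>" "face Y (cone_sup Y W) \<psi>"
    using extreme_mean_below[OF cone_sup_sublin[OF assms]] by blast
  have "0 \<le> \<psi> w" if w: "w \<in> W" for w
  proof -
    have wY: "w \<in> bfun Y" using w assms by (auto simp: cone_on_def)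
    have "\<psi> (\<lambda>y. - w y) \<le> cone_sup Y W (\<lambda>y. - w y)"
      using \<psi>(2) wY by (auto simp: face_def le_on_def)
    also have "\<dots> \<le> 0" by (rule cone_sup_le[OF assms _ w]) (use wY in auto)
    finally show ?thesis using \<psi>(1) wY by (simp add: mean_uminus)
  qed
  then show ?thesis using that \<psi> by blast
qed

section \<open>Minimal invariant functionals on a group\<close>

context group
begin

section \<open>Orbits of means and minimal invariant functionals\<close>

text \<open>The Poisson transform: its value at \<open>g\<close> is the translated mean
  \<open>g m\<close> evaluated at \<open>f\<close>.\<close>

definition orbit_fun :: "(('a \<Rightarrow> real) \<Rightarrow> real) \<Rightarrow> ('a \<Rightarrow> real) \<Rightarrow> 'a \<Rightarrow> real" where
  "orbit_fun m f = (\<lambda>g. m (\<lambda>x. f (g \<otimes> x)))"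

lemma bfun_shift: "f \<in> bfun (carrier G) \<Longrightarrow> s \<in> carrier G \<Longrightarrow> (\<lambda>x. f (s \<otimes> x)) \<in> bfun (carrier G)"
  by (erule bfunE) (auto intro: bfunI)

lemma mean_orbit_fun:
  assumes "mean (carrier G) m" "g \<in> carrier G"
  shows "mean (carrier G) (\<lambda>f. orbit_fun m f g)"
  unfolding orbit_fun_def
  by (rule mean_compose[OF assms(1), of "carrier G" "\<lambda>f x. f (g \<otimes> x)"]) (auto intro: mean_eval assms(2))

lemma bfun_orbit_fun:
  "mean (carrier G) m \<Longrightarrow> f \<in> bfun (carrier G) \<Longrightarrow> orbit_fun m f \<in> bfun (carrier G)"
  by (rule bfun_compose[OF mean_sublin[OF mean_orbit_fun]])

lemma orbit_fun_shift:
  assumes "mean (carrier G) m" "f \<in> bfun (carrier G)" "s \<in> carrier G" "g \<in> carrier G"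
  shows "orbit_fun m (\<lambda>x. f (s \<otimes> x)) g = orbit_fun m f (s \<otimes> g)"
  unfolding orbit_fun_def
  by (rule sublin_cong[OF mean_sublin[OF assms(1)]])
    (use assms in \<open>auto simp: m_assoc intro: bfun_shift[of "\<lambda>x. f (s \<otimes> x)" g] bfun_shift\<close>)

text \<open>One inequality is enough, as the same condition for \<open>inv s\<close> gives the
  other. The means below such a functional form an invariant set.\<close>

definition inv_sublin :: "(('a \<Rightarrow> real) \<Rightarrow> real) \<Rightarrow> bool" where
  "inv_sublin q \<longleftrightarrow> sublin (carrier G) q \<and>
     (\<forall>s\<in>carrier G. \<forall>f\<in>bfun (carrier G). q (\<lambda>x. f (s \<otimes> x)) \<le> q f)"

text \<open>\<open>q\<close> describes a minimal invariant compact convex set of means, and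
  \<open>m\<close> is an extreme point of it.\<close>

definition boundary_point :: "(('a \<Rightarrow> real) \<Rightarrow> real) \<Rightarrow> (('a \<Rightarrow> real) \<Rightarrow> real) \<Rightarrow> bool" where
  "boundary_point q m \<longleftrightarrow> inv_sublin q \<and>
     (\<forall>r. inv_sublin r \<longrightarrow> le_on (carrier G) r q \<longrightarrow> le_on (carrier G) q r) \<and>
     mean (carrier G) m \<and> face (carrier G) q m"

text \<open>For the zero cone, \<open>cone_sup\<close> is the supremum over the group. This is the
  starting point of the Zorn argument, and the zero cone is also the unconstrained case of
  \<open>orbit_concentration\<close>.\<close>

lemma cone_on_zero: "cone_on (carrier G) {\<lambda>_. 0}"
  by (auto simp: cone_on_def intro: one_closed)

lemma inv_sublin_sup: "inv_sublin (cone_sup (carrier G) {\<lambda>_. 0})"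
  unfolding inv_sublin_def
proof (intro conjI ballI)
  fix s f assume s: "s \<in> carrier G" and f: "f \<in> bfun (carrier G)"
  show "cone_sup (carrier G) {\<lambda>_. 0} (\<lambda>x. f (s \<otimes> x)) \<le> cone_sup (carrier G) {\<lambda>_. 0} f"
  proof (rule cone_sup_ge[OF cone_on_zero f])
    fix w B assume "w \<in> {\<lambda>_::'a. 0::real}" "\<And>y. y \<in> carrier G \<Longrightarrow> f y + w y \<le> B"
    then show "cone_sup (carrier G) {\<lambda>_. 0} (\<lambda>x. f (s \<otimes> x)) \<le> B"
      by (intro cone_sup_le[OF cone_on_zero bfun_shift[OF f s], of "\<lambda>_. 0"]) (use s in auto)
  qed
qed (rule cone_sup_sublin[OF cone_on_zero])

lemma inv_sublin_INF:
  assumes "C \<noteq> {}" "\<And>p. p \<in> C \<Longrightarrow> inv_sublin p"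
    and "\<And>p r. p \<in> C \<Longrightarrow> r \<in> C \<Longrightarrow> le_on (carrier G) p r \<or> le_on (carrier G) r p"
    and u: "\<And>f. f \<in> bfun (carrier G) \<Longrightarrow> u f = (INF p\<in>C. p f)"
  shows "inv_sublin u"
proof -
  have sub: "\<And>p. p \<in> C \<Longrightarrow> sublin (carrier G) p" using assms(2) by (simp add: inv_sublin_def)
  have S: "sublin (carrier G) u" and L: "\<And>p. p \<in> C \<Longrightarrow> le_on (carrier G) u p"
    using sublin_INF[OF assms(1) sub assms(3) u] by auto
  show ?thesis unfolding inv_sublin_def
  proof (intro conjI ballI S)
    fix s f assume s: "s \<in> carrier G" and f: "f \<in> bfun (carrier G)"
    have "u (\<lambda>x. f (s \<otimes> x)) \<le> p f" if "p \<in> C" for p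
    proof -
      have "u (\<lambda>x. f (s \<otimes> x)) \<le> p (\<lambda>x. f (s \<otimes> x))"
        using L[OF that] bfun_shift[OF f s] by (auto simp: le_on_def)
      also have "\<dots> \<le> p f" using assms(2)[OF that] s f by (auto simp: inv_sublin_def)
      finally show ?thesis .
    qed
    then show "u (\<lambda>x. f (s \<otimes> x)) \<le> u f" unfolding u[OF f] by (intro cINF_greatest assms(1))
  qed
qed

lemma boundary_point_exists:
  obtains q m where "boundary_point q m"
proof -
  obtain q where q: "inv_sublin q"
    and min: "\<And>r. inv_sublin r \<Longrightarrow> le_on (carrier G) r q \<Longrightarrow> le_on (carrier G) q r"
  proof (rule minimal_sublin[of inv_sublin "cone_sup (carrier G) {\<lambda>_. 0}" "carrier G"])
    show "inv_sublin (cone_sup (carrier G) {\<lambda>_. 0})" by (rule inv_sublin_sup)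
    show "inv_sublin u" if "C \<noteq> {}" "\<And>p. p \<in> C \<Longrightarrow> inv_sublin p"
      "\<And>p r. p \<in> C \<Longrightarrow> r \<in> C \<Longrightarrow> le_on (carrier G) p r \<or> le_on (carrier G) r p"
      "\<And>f. f \<in> bfun (carrier G) \<Longrightarrow> u f = (INF p\<in>C. p f)" for C u
      using that by (rule inv_sublin_INF)
    show "sublin (carrier G) p" if "inv_sublin p" for p using that by (simp add: inv_sublin_def)
  qed blast
  obtain m where "mean (carrier G) m" "face (carrier G) q m"
    using extreme_mean_below[of "carrier G" q] q by (auto simp: inv_sublin_def)
  then show ?thesis using that[of q m] q min by (auto simp: boundary_point_def)
qed

lemma orbit_fun_le:
  assumes "boundary_point q m" "f \<in> bfun (carrier G)" "g \<in> carrier G"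
  shows "orbit_fun m f g \<le> q f"
proof -
  have "orbit_fun m f g \<le> q (\<lambda>x. f (g \<otimes> x))"
    using assms bfun_shift[OF assms(2,3)] by (auto simp: boundary_point_def face_def le_on_def orbit_fun_def)
  also have "\<dots> \<le> q f" using assms by (auto simp: boundary_point_def inv_sublin_def)
  finally show ?thesis .
qed

section \<open>Concentration at an extreme point\<close>

text \<open>Giving \<open>\<theta>\<close> the density \<open>k / \<theta> k\<close> and taking the
  barycentre of the orbit stays inside the set below \<open>q\<close>. Such reweighted barycentres
  are the competitors against which extremality of \<open>m\<close> is tested.\<close>

lemma mean_weighted_orbit:
  assumes b: "boundary_point q m" and \<theta>: "mean (carrier G) \<theta>"
    and k: "k \<in> bfun (carrier G)" "\<And>g. g \<in> carrier G \<Longrightarrow> 0 \<le> k g" "\<theta> k > 0"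
  defines "n \<equiv> (\<lambda>f. \<theta> (\<lambda>g. k g * orbit_fun m f g) / \<theta> k)"
  shows "mean (carrier G) n" "le_on (carrier G) n q"
proof -
  have m: "mean (carrier G) m" using b by (simp add: boundary_point_def)
  note orb = bfun_orbit_fun[OF m]
  have bound: "n f \<le> B" if f: "f \<in> bfun (carrier G)" and B: "\<And>g. g \<in> carrier G \<Longrightarrow> orbit_fun m f g \<le> B" for f B
  proof -
    have "\<theta> (\<lambda>g. k g * orbit_fun m f g) \<le> \<theta> (\<lambda>g. B * k g)"
      by (rule sublin_mono[OF mean_sublin[OF \<theta>]])
        (use orb[OF f] k mult_left_mono[OF B k(2)] in \<open>auto simp: mult.commute\<close>)
    also have "\<dots> = B * \<theta> k" by (rule mean_scale[OF \<theta> k(1)])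
    finally show ?thesis using k(3) by (simp add: n_def divide_le_eq)
  qed
  show "mean (carrier G) n"
  proof (rule meanI)
    fix f g assume fg: "f \<in> bfun (carrier G)" "g \<in> bfun (carrier G)"
    have "\<theta> (\<lambda>x. k x * orbit_fun m (\<lambda>y. f y + g y) x) = \<theta> (\<lambda>x. k x * orbit_fun m f x + k x * orbit_fun m g x)"
      by (rule sublin_cong[OF mean_sublin[OF \<theta>]])
        (use fg orb k mean_add[OF mean_orbit_fun[OF m]] in \<open>auto simp: distrib_left\<close>)
    also have "\<dots> = \<theta> (\<lambda>x. k x * orbit_fun m f x) + \<theta> (\<lambda>x. k x * orbit_fun m g x)"
      by (rule mean_add[OF \<theta>]) (use fg orb k in auto)
    finally show "n (\<lambda>x. f x + g x) = n f + n g" by (simp add: n_def add_divide_distrib)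
  next
    fix f and c :: real assume f: "f \<in> bfun (carrier G)"
    have "\<theta> (\<lambda>x. k x * orbit_fun m (\<lambda>y. c * f y) x) = \<theta> (\<lambda>x. c * (k x * orbit_fun m f x))"
      by (rule sublin_cong[OF mean_sublin[OF \<theta>]])
        (use f orb k mean_scale[OF mean_orbit_fun[OF m]] in auto)
    also have "\<dots> = c * \<theta> (\<lambda>x. k x * orbit_fun m f x)"
      by (rule mean_scale[OF \<theta>]) (use f orb k in auto)
    finally show "n (\<lambda>x. c * f x) = c * n f" by (simp add: n_def)
  next
    fix f B assume f: "f \<in> bfun (carrier G)" "\<And>x. x \<in> carrier G \<Longrightarrow> f x \<le> B"
    show "n f \<le> B" using sublin_le[OF mean_sublin[OF mean_orbit_fun[OF m]] f(1), of _ B] f(2)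
      by (intro bound[OF f(1)]) blast
  qed
  show "le_on (carrier G) n q"
    unfolding le_on_def using bound orbit_fun_le[OF b] by blast
qed

text \<open>A mean on the orbit of an extreme point with barycentre that point is concentrated there.\<close>

lemma orbit_variance_zero:
  assumes b: "boundary_point q m" and \<theta>: "mean (carrier G) \<theta>"
    and bary: "\<And>f. f \<in> bfun (carrier G) \<Longrightarrow> \<theta> (orbit_fun m f) = m f"
    and f: "f \<in> bfun (carrier G)"
  shows "\<theta> (\<lambda>g. (orbit_fun m f g - m f)\<^sup>2) = 0"
proof -
  have m: "mean (carrier G) m" and fc: "face (carrier G) q m" using b by (simp_all add: boundary_point_def)
  define F where "F = orbit_fun m f"
  have orb: "orbit_fun m \<phi> \<in> bfun (carrier G)" if "\<phi> \<in> bfun (carrier G)" for \<phi>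
    by (rule bfun_orbit_fun[OF m that])
  have F: "F \<in> bfun (carrier G)" and \<theta>F: "\<theta> F = m f" using orb f bary by (auto simp: F_def)
  obtain B where B: "B > 0" "\<And>g. g \<in> carrier G \<Longrightarrow> \<bar>F g\<bar> \<le> B" using bfunE[OF F] by blast
  \<comment> \<open>The scaling keeps \<open>h\<close> between 1/4 and 3/4, so \<open>h\<close> and
    \<open>1 - h\<close> both have positive mass. That \<open>h\<close> is affine in
    \<open>F\<close> will make the second moment of \<open>F\<close> appear.\<close>
  define h where "h = (\<lambda>g. 1/2 + 1 / (4*B) * F g)"
  have h: "h \<in> bfun (carrier G)" unfolding h_def by (intro bfun_add bfun_mult bfun_const F)
  have h_bounds: "1/4 \<le> h g" "h g \<le> 3/4" if "g \<in> carrier G" for g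
    using B(1) B(2)[OF that] by (auto simp: h_def field_simps)
  define c where "c = \<theta> h"
  have c: "1/4 \<le> c" "c \<le> 3/4"
    unfolding c_def using sublin_ge[OF mean_sublin[OF \<theta>] h h_bounds(1)] sublin_le[OF mean_sublin[OF \<theta>] h h_bounds(2)]
    by auto
  have h': "(\<lambda>g. 1 - h g) \<in> bfun (carrier G)" using h by auto
  have c': "\<theta> (\<lambda>g. 1 - h g) = 1 - c"
    using mean_diff[OF \<theta> bfun_const h, of 1] mean_const[OF \<theta>] by (simp add: c_def)
  define n1 where "n1 = (\<lambda>\<phi>. \<theta> (\<lambda>g. h g * orbit_fun m \<phi> g) / \<theta> h)"
  define n2 where "n2 = (\<lambda>\<phi>. \<theta> (\<lambda>g. (1 - h g) * orbit_fun m \<phi> g) / \<theta> (\<lambda>g. 1 - h g))"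
  have n1: "mean (carrier G) n1" "le_on (carrier G) n1 q"
    unfolding n1_def by (rule mean_weighted_orbit[OF b \<theta> h]; use h_bounds c c_def in force)+
  have n2: "mean (carrier G) n2" "le_on (carrier G) n2 q"
    unfolding n2_def by (rule mean_weighted_orbit[OF b \<theta> h']; use h_bounds c c' in force)+
  \<comment> \<open>The densities \<open>h\<close> and \<open>1 - h\<close> split the barycentre
    \<open>m\<close> into a convex combination of \<open>n1\<close> and \<open>n2\<close>;
    extremality then forces \<open>n1\<close> to agree with \<open>m\<close>.\<close>
  have "le_on (carrier G) (\<lambda>\<phi>. c * n1 \<phi> + (1 - c) * n2 \<phi>) m"
    unfolding le_on_def
  proof
    fix \<phi> assume \<phi>: "\<phi> \<in> bfun (carrier G)"
    have "c * n1 \<phi> + (1 - c) * n2 \<phi> = \<theta> (\<lambda>g. h g * orbit_fun m \<phi> g) + \<theta> (\<lambda>g. (1 - h g) * orbit_fun m \<phi> g)"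
      using c c' by (simp add: n1_def n2_def c_def)
    also have "\<dots> = \<theta> (\<lambda>g. h g * orbit_fun m \<phi> g + (1 - h g) * orbit_fun m \<phi> g)"
      using mean_add[OF \<theta> bfun_mult[OF h orb[OF \<phi>]] bfun_mult[OF h' orb[OF \<phi>]]] by simp
    also have "\<dots> = m \<phi>" using bary[OF \<phi>] by (simp add: algebra_simps)
    finally show "c * n1 \<phi> + (1 - c) * n2 \<phi> \<le> m \<phi>" by simp
  qed
  moreover have "0 < c" "c < 1" using c by auto
  ultimately have "le_on (carrier G) n1 m" using fc n1 n2 unfolding face_def by blast
  then have "n1 f = m f" by (rule mean_le_eq[OF n1(1) m _ f])
  \<comment> \<open>Thus \<open>h\<close> and \<open>F\<close> are uncorrelated under
    \<open>\<theta>\<close>. As \<open>h\<close> is affine in \<open>F\<close> with nonzero slope,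
    the variance of \<open>F\<close> is zero; the remaining lines compute this.\<close>
  then have hF: "\<theta> (\<lambda>g. h g * F g) = c * m f" using \<open>0 < c\<close>
    by (simp add: n1_def F_def c_def nonzero_divide_eq_eq mult.commute)
  have F2: "(\<lambda>g. (F g)\<^sup>2) \<in> bfun (carrier G)" using F by auto
  have "\<theta> (\<lambda>g. h g * F g) = \<theta> (\<lambda>g. 1/2 * F g + 1/(4*B) * (F g)\<^sup>2)"
    by (simp add: h_def algebra_simps power2_eq_square)
  also have "\<dots> = 1/2 * m f + 1/(4*B) * \<theta> (\<lambda>g. (F g)\<^sup>2)"
    using mean_add[OF \<theta> bfun_mult[OF bfun_const F, of "1/2"] bfun_mult[OF bfun_const F2, of "1/(4*B)"]]
      mean_scale[OF \<theta> F, of "1/2"] mean_scale[OF \<theta> F2, of "1/(4*B)"] \<theta>F by simp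
  finally have 1: "c * m f = 1/2 * m f + 1/(4*B) * \<theta> (\<lambda>g. (F g)\<^sup>2)" using hF by simp
  have "c = 1/2 + 1/(4*B) * m f"
    using mean_add[OF \<theta> bfun_const bfun_mult[OF bfun_const F], of "1/2" "1/(4*B)"]
      mean_scale[OF \<theta> F, of "1/(4*B)"] mean_const[OF \<theta>] \<theta>F by (simp add: c_def h_def)
  then have 2: "4 * B * c = m f + 2 * B" using B(1) by (simp add: field_simps)
  have "\<theta> (\<lambda>g. (F g)\<^sup>2) = (4 * B * c) * m f - 2 * B * m f" using 1 B(1) by (simp add: field_simps)
  then have sq: "\<theta> (\<lambda>g. (F g)\<^sup>2) = (m f)\<^sup>2" unfolding 2 by (simp add: algebra_simps power2_eq_square)
  have "\<theta> (\<lambda>g. (F g - m f)\<^sup>2) = \<theta> (\<lambda>g. (F g)\<^sup>2 + ((- 2 * m f) * F g + (m f)\<^sup>2))"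
    by (simp add: power2_eq_square algebra_simps)
  also have "\<dots> = \<theta> (\<lambda>g. (F g)\<^sup>2) + \<theta> (\<lambda>g. (- 2 * m f) * F g + (m f)\<^sup>2)"
    by (rule mean_add[OF \<theta> F2]) (use F in auto)
  also have "\<theta> (\<lambda>g. (- 2 * m f) * F g + (m f)\<^sup>2) = \<theta> (\<lambda>g. (- 2 * m f) * F g) + \<theta> (\<lambda>g. (m f)\<^sup>2)"
    by (rule mean_add[OF \<theta>]) (use F in auto)
  also have "\<theta> (\<lambda>g. (- 2 * m f) * F g) = (- 2 * m f) * m f"
    using mean_scale[OF \<theta> F, of "- 2 * m f"] \<theta>F by simp
  finally show ?thesis unfolding F_def[symmetric] mean_const[OF \<theta>] sq by (simp add: power2_eq_square)
qed

text \<open>Minimality of \<^term>\<open>q\<close> enters by comparing it with the invariant functional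
  \<^term>\<open>\<lambda>f. cone_sup Y W (E (orbit_fun m f))\<close>.\<close>

lemma orbit_concentration:
  assumes b: "boundary_point q m" and W: "cone_on Y W"
    and E: "\<And>y. y \<in> Y \<Longrightarrow> mean (carrier G) (\<lambda>f. E f y)"
    and inv: "\<And>s w. s \<in> carrier G \<Longrightarrow> w \<in> W \<Longrightarrow> \<exists>w'\<in>W. \<forall>f\<in>bfun (carrier G). \<forall>B.
        (\<forall>y\<in>Y. E f y + w y \<le> B) \<longrightarrow> (\<forall>y\<in>Y. E (\<lambda>x. f (s \<otimes> x)) y + w' y \<le> B)"
  obtains \<psi> where "mean Y \<psi>" "\<And>w. w \<in> W \<Longrightarrow> 0 \<le> \<psi> w"
    "\<And>f. f \<in> bfun (carrier G) \<Longrightarrow> \<psi> (E (\<lambda>g. (orbit_fun m f g - m f)\<^sup>2)) = 0"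
proof -
  have m: "mean (carrier G) m" using b by (simp add: boundary_point_def)
  note orb = bfun_orbit_fun[OF m]
  \<comment> \<open>\<open>D f y\<close> is the value at \<open>f\<close> of the barycentre of the
    orbit of \<open>m\<close>, averaged with the mean attached to \<open>y\<close>.\<close>
  define D where "D = (\<lambda>f. E (orbit_fun m f))"
  have D: "mean (carrier G) (\<lambda>f. D f y)" if "y \<in> Y" for y
    unfolding D_def by (rule mean_compose[OF E[OF that] mean_orbit_fun[OF m]])
  have DY: "D f \<in> bfun Y" if "f \<in> bfun (carrier G)" for f
    using bfun_compose[of Y "carrier G" D f, OF mean_sublin[OF D] that] .
  define r where "r = (\<lambda>f. cone_sup Y W (D f))"
  have r_sublin: "sublin (carrier G) r"
    unfolding r_def by (rule sublin_compose[OF cone_sup_sublin[OF W] D])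
  have "r (\<lambda>x. f (s \<otimes> x)) \<le> r f" if s: "s \<in> carrier G" and f: "f \<in> bfun (carrier G)" for s f
    unfolding r_def
  proof (rule cone_sup_ge[OF W DY[OF f]])
    fix w B assume w: "w \<in> W" "\<And>y. y \<in> Y \<Longrightarrow> D f y + w y \<le> B"
    obtain w' where w': "w' \<in> W" "\<forall>y\<in>Y. E (\<lambda>x. orbit_fun m f (s \<otimes> x)) y + w' y \<le> B"
      using inv[OF s w(1)] orb[OF f] w(2) unfolding D_def by blast
    have "D (\<lambda>x. f (s \<otimes> x)) y = E (\<lambda>x. orbit_fun m f (s \<otimes> x)) y" if "y \<in> Y" for y
      unfolding D_def
      by (rule sublin_cong[OF mean_sublin[OF E[OF that]]])
        (use orb bfun_shift[OF f s] orbit_fun_shift[OF m f s] in auto)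
    then show "cone_sup Y W (D (\<lambda>x. f (s \<otimes> x))) \<le> B"
      by (intro cone_sup_le[OF W DY[OF bfun_shift[OF f s]] w'(1)]) (use w'(2) in auto)
  qed
  then have r_inv: "inv_sublin r" using r_sublin by (simp add: inv_sublin_def)
  have "r f \<le> q f" if f: "f \<in> bfun (carrier G)" for f
  proof -
    have "D f y \<le> q f" if "y \<in> Y" for y
      unfolding D_def by (rule sublin_le[OF mean_sublin[OF E[OF that]] orb[OF f]]) (rule orbit_fun_le[OF b f])
    then show ?thesis unfolding r_def using sublin_le[OF cone_sup_sublin[OF W] DY[OF f]] by blast
  qed
  then have "le_on (carrier G) q r" using b r_inv unfolding boundary_point_def le_on_def by blast
  then have m_le_r: "m f \<le> r f" if "f \<in> bfun (carrier G)" for f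
    using b that unfolding boundary_point_def face_def le_on_def by (meson order_trans)
  \<comment> \<open>Enlarging \<open>W\<close> by the differences \<open>D f - m f\<close> turns the
    search for a mean with barycentre \<open>m\<close> into another instance of
    \<open>cone_mean\<close>.\<close>
  define V where "V = {v \<in> bfun Y. \<exists>w\<in>W. \<exists>f\<in>bfun (carrier G). \<forall>y\<in>Y. v y = w y + (D f y - m f)}"
  note W' = W[unfolded cone_on_def]
  have VI: "v \<in> V" if "w \<in> W" "f \<in> bfun (carrier G)" "\<And>y. y \<in> Y \<Longrightarrow> v y = w y + (D f y - m f)" for v w f
  proof -
    have "(\<lambda>y. w y + (D f y - m f)) \<in> bfun Y" using that W' DY by auto
    then have "v \<in> bfun Y" using that(3) by (simp add: bfun_def cong: image_cong)
    then show ?thesis using that by (auto simp: V_def)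
  qed
  have "cone_on Y V" unfolding cone_on_def
  proof (intro conjI ballI allI impI)
    show "V \<subseteq> bfun Y" by (auto simp: V_def)
    show "(\<lambda>_. 0) \<in> V"
      by (rule VI[of "\<lambda>_. 0" "\<lambda>_. 0"]) (use W' mean_const[OF D] mean_const[OF m] in auto)
  next
    fix v1 v2 assume "v1 \<in> V" "v2 \<in> V"
    then obtain w1 f1 w2 f2 where *: "w1 \<in> W" "f1 \<in> bfun (carrier G)" "\<forall>y\<in>Y. v1 y = w1 y + (D f1 y - m f1)"
      "w2 \<in> W" "f2 \<in> bfun (carrier G)" "\<forall>y\<in>Y. v2 y = w2 y + (D f2 y - m f2)"
      by (auto simp: V_def)
    show "(\<lambda>y. v1 y + v2 y) \<in> V"
    proof (rule VI[of "\<lambda>y. w1 y + w2 y" "\<lambda>x. f1 x + f2 x"])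
      show "(\<lambda>y. w1 y + w2 y) \<in> W" using W' * by blast
      show "v1 y + v2 y = w1 y + w2 y + (D (\<lambda>x. f1 x + f2 x) y - m (\<lambda>x. f1 x + f2 x))" if "y \<in> Y" for y
        using that * mean_add[OF D[OF that] *(2,5)] mean_add[OF m *(2,5)] by simp
    qed (use * in auto)
  next
    fix c :: real and v assume "0 < c" "v \<in> V"
    then obtain w f where *: "w \<in> W" "f \<in> bfun (carrier G)" "\<forall>y\<in>Y. v y = w y + (D f y - m f)"
      by (auto simp: V_def)
    show "(\<lambda>y. c * v y) \<in> V"
    proof (rule VI[of "\<lambda>y. c * w y" "\<lambda>x. c * f x"])
      show "(\<lambda>y. c * w y) \<in> W" using W' * \<open>0 < c\<close> by blast
      show "c * v y = c * w y + (D (\<lambda>x. c * f x) y - m (\<lambda>x. c * f x))" if "y \<in> Y" for y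
      proof -
        have "v y = w y + (D f y - m f)" using * that by blast
        then show ?thesis
          using mean_scale[OF D[OF that] *(2)] mean_scale[OF m *(2)]
          by (simp add: distrib_left right_diff_distrib)
      qed
    qed (use * in auto)
  next
    fix v B assume "v \<in> V" "\<forall>y\<in>Y. v y \<le> B"
    then obtain w f where *: "w \<in> W" "f \<in> bfun (carrier G)" "\<forall>y\<in>Y. w y + (D f y - m f) \<le> B"
      by (auto simp: V_def)
    \<comment> \<open>The inequality \<open>m f \<le> r f\<close>, obtained from minimality of
      \<open>q\<close>, is exactly what keeps the enlarged cone free of uniformly negative
      functions.\<close>
    have "r f \<le> B + m f"
      unfolding r_def by (rule cone_sup_le[OF W DY[OF *(2)] *(1)]) (use *(3) in force)
    then show "0 \<le> B" using m_le_r[OF *(2)] by simp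
  qed
  then obtain \<psi> where \<psi>: "mean Y \<psi>" "\<And>v. v \<in> V \<Longrightarrow> 0 \<le> \<psi> v" by (rule cone_mean) blast
  have D\<psi>_ge: "m f \<le> \<psi> (D f)" if f: "f \<in> bfun (carrier G)" for f
  proof -
    have "(\<lambda>y. D f y - m f) \<in> V" by (rule VI[of "\<lambda>_. 0" f]) (use W' f in auto)
    then have "0 \<le> \<psi> (\<lambda>y. D f y - m f)" by (rule \<psi>(2))
    then show ?thesis using mean_diff[OF \<psi>(1) DY[OF f] bfun_const] mean_const[OF \<psi>(1)] by simp
  qed
  \<comment> \<open>The one-sided bound holds for every bounded function, so applying it to
    \<open>- f\<close> upgrades it to equality.\<close>
  have D\<psi>: "\<psi> (D f) = m f" if f: "f \<in> bfun (carrier G)" for f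
  proof -
    have "\<psi> (D (\<lambda>x. - f x)) = \<psi> (\<lambda>y. - D f y)"
      by (rule sublin_cong[OF mean_sublin[OF \<psi>(1)]]) (use f DY mean_uminus[OF D] in auto)
    then have "\<psi> (D (\<lambda>x. - f x)) = - \<psi> (D f)" using mean_uminus[OF \<psi>(1) DY[OF f]] by simp
    moreover have "m (\<lambda>x. - f x) \<le> \<psi> (D (\<lambda>x. - f x))" by (rule D\<psi>_ge) (use f in auto)
    ultimately show ?thesis using D\<psi>_ge[OF f] mean_uminus[OF m f] by simp
  qed
  show ?thesis
  proof (rule that[OF \<psi>(1)])
    fix w assume "w \<in> W"
    then have "w \<in> V" by (intro VI[of w "\<lambda>_. 0"]) (use mean_const[OF D] mean_const[OF m] in auto)
    then show "0 \<le> \<psi> w" by (rule \<psi>(2))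
  next
    fix f assume f: "f \<in> bfun (carrier G)"
    have "mean (carrier G) (\<lambda>f. \<psi> (E f))" by (rule mean_compose[OF \<psi>(1) E])
    from orbit_variance_zero[OF b this D\<psi>[unfolded D_def] f]
    show "\<psi> (E (\<lambda>g. (orbit_fun m f g - m f)\<^sup>2)) = 0" .
  qed
qed

section \<open>The stabiliser and its conjugates\<close>

definition mean_stab :: "(('a \<Rightarrow> real) \<Rightarrow> real) \<Rightarrow> 'a set" where
  "mean_stab m = {s \<in> carrier G. \<forall>f\<in>bfun (carrier G). m (\<lambda>x. f (s \<otimes> x)) = m f}"

lemma mean_stabD: "s \<in> mean_stab m \<Longrightarrow> f \<in> bfun (carrier G) \<Longrightarrow> m (\<lambda>x. f (s \<otimes> x)) = m f"
  unfolding mean_stab_def by blast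

lemma subgroup_mean_stab:
  assumes m: "mean (carrier G) m"
  shows "subgroup (mean_stab m) G"
proof
  show "mean_stab m \<subseteq> carrier G" by (auto simp: mean_stab_def)
  have one: "m (\<lambda>x. f (\<one> \<otimes> x)) = m f" if "f \<in> bfun (carrier G)" for f
    by (rule sublin_cong[OF mean_sublin[OF m]]) (use that bfun_shift in auto)
  then show "\<one> \<in> mean_stab m" by (simp add: mean_stab_def)
  have mult: "m (\<lambda>x. f ((s \<otimes> t) \<otimes> x)) = m (\<lambda>x. f (s \<otimes> (t \<otimes> x)))"
    if "f \<in> bfun (carrier G)" "s \<in> carrier G" "t \<in> carrier G" for f s t
    by (rule sublin_cong[OF mean_sublin[OF m]]) (use that bfun_shift[of f "s \<otimes> t"] in \<open>auto simp: m_assoc\<close>)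
  fix s assume s: "s \<in> mean_stab m"
  then have sG: "s \<in> carrier G" and s': "\<And>f. f \<in> bfun (carrier G) \<Longrightarrow> m (\<lambda>x. f (s \<otimes> x)) = m f"
    by (auto simp: mean_stab_def)
  show "s \<otimes> t \<in> mean_stab m" if t: "t \<in> mean_stab m" for t
  proof -
    have tG: "t \<in> carrier G" and t': "\<And>f. f \<in> bfun (carrier G) \<Longrightarrow> m (\<lambda>x. f (t \<otimes> x)) = m f"
      using t by (auto simp: mean_stab_def)
    have "m (\<lambda>x. f ((s \<otimes> t) \<otimes> x)) = m f" if f: "f \<in> bfun (carrier G)" for f
      using mult[OF f sG tG] t'[OF bfun_shift[OF f sG]] s'[OF f] by simp
    then show ?thesis using sG tG by (simp add: mean_stab_def)
  qed
  show "inv s \<in> mean_stab m"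
  proof -
    have "m (\<lambda>x. f (inv s \<otimes> x)) = m f" if f: "f \<in> bfun (carrier G)" for f
      using mult[OF f inv_closed[OF sG] sG] s'[OF bfun_shift[OF f inv_closed[OF sG]]] one[OF f] sG by simp
    then show ?thesis using sG by (simp add: mean_stab_def)
  qed
qed

text \<open>A mean on \<^term>\<open>H\<close> is obtained by extending functions to the whole group along
  representatives of the right cosets of \<^term>\<open>H\<close>.\<close>

lemma amenable_mean_stab:
  assumes m: "mean (carrier G) m"
  shows "amenable_subgroup G (mean_stab m)"
proof -
  define H where "H = mean_stab m"
  interpret H: subgroup H G unfolding H_def by (rule subgroup_mean_stab[OF m])
  define rep where "rep g = (SOME x. x \<in> H #> g)" for g
  \<comment> \<open>The map sending \<open>g\<close> to \<open>g \<otimes> inv (rep g)\<close> goes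
    from \<open>G\<close> to \<open>H\<close>. It commutes with left multiplication by
    \<open>H\<close>, because \<open>rep\<close> depends only on the right coset. So pulling back
    along it preserves invariance.\<close>
  define E where "E f g = f (g \<otimes> inv (rep g))" for f :: "'a \<Rightarrow> real" and g
  have rep: "rep g \<in> H #> g" if "g \<in> carrier G" for g
    unfolding rep_def by (rule someI[of _ g]) (rule rcos_self[OF that H.subgroup_axioms])
  have in_H: "g \<otimes> inv (rep g) \<in> H" if g: "g \<in> carrier G" for g
  proof -
    obtain h where h: "h \<in> H" "rep g = h \<otimes> g" using rep[OF g] by (auto simp: r_coset_def)
    then have "g \<otimes> inv (rep g) = inv h"
      using g by (simp add: inv_mult_group m_assoc[symmetric])
    then show ?thesis using h by simp
  qed
  have rep_shift: "rep (h \<otimes> g) = rep g" if "h \<in> H" "g \<in> carrier G" for h g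
  proof -
    have "H #> (h \<otimes> g) = H #> g"
      using that coset_mult_assoc[of H h g] coset_join2[of h H] H.subset H.subgroup_axioms by auto
    then show ?thesis by (simp add: rep_def)
  qed
  have E: "mean H (\<lambda>f. E f g)" if "g \<in> carrier G" for g
    unfolding E_def by (rule mean_eval[OF in_H[OF that]])
  define n where "n f = m (E f)" for f
  have n: "mean H n" unfolding n_def by (rule mean_compose[OF m E])
  have bfun_iff: "f \<in> bfun H \<longleftrightarrow> bounded (f ` H)" for f :: "'a \<Rightarrow> real" by (simp add: bfun_def)
  have "n (\<lambda>x. f (inv h \<otimes> x)) = n f" if f: "f \<in> bfun H" and h: "h \<in> H" for f h
  proof -
    have Ef: "E f \<in> bfun (carrier G)" by (rule bfun_compose[OF mean_sublin[OF E] f])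
    have ih: "inv h \<in> H" using h by simp
    have ihG: "inv h \<in> carrier G" using ih by (rule H.mem_carrier)
    have "m (E (\<lambda>x. f (inv h \<otimes> x))) = m (\<lambda>x. E f (inv h \<otimes> x))"
    proof (rule sublin_cong[OF mean_sublin[OF m], symmetric])
      show "(\<lambda>x. E f (inv h \<otimes> x)) \<in> bfun (carrier G)" by (rule bfun_shift[OF Ef ihG])
      fix x assume x: "x \<in> carrier G"
      then have "rep x \<in> carrier G" using rep[OF x] r_coset_subset_G[OF H.subset x] by auto
      then show "E f (inv h \<otimes> x) = E (\<lambda>x. f (inv h \<otimes> x)) x"
        using x ihG rep_shift[OF ih x] by (simp add: E_def m_assoc)
    qed
    also have "\<dots> = m (E f)" using mean_stabD[OF ih[unfolded H_def] Ef] .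
    finally show ?thesis by (simp add: n_def)
  qed
  then have "\<forall>f. \<forall>h\<in>H. bounded (f ` H) \<longrightarrow> n (\<lambda>x. f (inv h \<otimes> x)) = n f"
    by (simp add: bfun_iff)
  moreover have "\<forall>f. bounded (f ` H) \<longrightarrow> (\<forall>x\<in>H. f x \<ge> 0) \<longrightarrow> n f \<ge> 0"
    using sublin_ge[OF mean_sublin[OF n], of _ 0] by (simp add: bfun_iff)
  moreover have "\<forall>f g. bounded (f ` H) \<longrightarrow> bounded (g ` H) \<longrightarrow> n (\<lambda>x. f x + g x) = n f + n g"
    using mean_add[OF n] by (simp add: bfun_iff)
  moreover have "\<forall>f c. bounded (f ` H) \<longrightarrow> n (\<lambda>x. c * f x) = c * n f"
    using mean_scale[OF n] by (simp add: bfun_iff)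
  moreover have "n (\<lambda>_. 1) = 1" by (rule mean_const[OF n])
  ultimately show ?thesis unfolding amenable_subgroup_def H_def[symmetric] by blast
qed

lemma inv_cancel: "x \<in> carrier G \<Longrightarrow> y \<in> carrier G \<Longrightarrow> x \<otimes> (inv x \<otimes> y) = y"
  and inv_cancel': "x \<in> carrier G \<Longrightarrow> y \<in> carrier G \<Longrightarrow> inv x \<otimes> (x \<otimes> y) = y"
  by (simp_all add: m_assoc[symmetric])

lemma mem_conjugate_iff:
  assumes "t \<in> carrier G" "H \<subseteq> carrier G" "x \<in> carrier G"
  shows "x \<in> conjugate G t H \<longleftrightarrow> inv t \<otimes> x \<otimes> t \<in> H"
proof
  assume "x \<in> conjugate G t H"
  then obtain h where h: "h \<in> H" "x = t \<otimes> h \<otimes> inv t" by (auto simp: conjugate_def)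
  then have "h \<in> carrier G" using assms by auto
  then have "inv t \<otimes> x \<otimes> t = h" using assms h by (simp add: m_assoc inv_cancel')
  then show "inv t \<otimes> x \<otimes> t \<in> H" using h by simp
next
  assume *: "inv t \<otimes> x \<otimes> t \<in> H"
  have "x = t \<otimes> (inv t \<otimes> x \<otimes> t) \<otimes> inv t" using assms by (simp add: m_assoc inv_cancel)
  then show "x \<in> conjugate G t H" using * unfolding conjugate_def by blast
qed

lemma conjugate_subset: "t \<in> carrier G \<Longrightarrow> H \<subseteq> carrier G \<Longrightarrow> conjugate G t H \<subseteq> carrier G"
  by (auto simp: conjugate_def)

text \<open>A finite intersection of conjugates of minimal cardinality is normal.\<close>

lemma trivial_core_of_not_normalish:
  assumes no_fin: "\<And>N. N \<lhd> G \<Longrightarrow> finite N \<Longrightarrow> N = {\<one>}"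
    and H: "subgroup H G" and "\<not> normalish G H"
  obtains T where "finite T" "T \<noteq> {}" "T \<subseteq> carrier G" "(\<Inter>t\<in>T. conjugate G t H) = {\<one>}"
proof -
  define K where "K T = (\<Inter>t\<in>T. conjugate G t H)" for T
  define good where "good T \<longleftrightarrow> finite T \<and> T \<noteq> {} \<and> T \<subseteq> carrier G \<and> finite (K T)" for T
  have HG: "H \<subseteq> carrier G" using H by (rule subgroup.subset)
  obtain n :: nat and t where "n \<ge> 1" "t ` {..<n} \<subseteq> carrier G" "finite (\<Inter>i<n. conjugate G (t i) H)"
    using assms(2,3) by (auto simp: normalish_def)
  then have "good (t ` {..<n})" by (auto simp: good_def K_def lessThan_empty_iff)
  then obtain T where T: "good T" and min: "\<And>T'. good T' \<Longrightarrow> card (K T) \<le> card (K T')"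
    using ex_has_least_nat[of good "t ` {..<n}" "\<lambda>T. card (K T)"] by blast
  have TG: "T \<subseteq> carrier G" "finite T" "T \<noteq> {}" "finite (K T)" using T by (auto simp: good_def)
  have KG: "K T \<subseteq> carrier G" using TG conjugate_subset[OF _ HG] by (auto simp: K_def)
  have mem_K: "x \<in> K T' \<longleftrightarrow> (\<forall>t\<in>T'. inv t \<otimes> x \<otimes> t \<in> H)" if "T' \<subseteq> carrier G" "x \<in> carrier G" for T' x
    using that mem_conjugate_iff[OF _ HG] by (auto simp: K_def)
  have "subgroup (K T) G"
  proof
    show "K T \<subseteq> carrier G" by (rule KG)
    show "\<one> \<in> K T" unfolding mem_K[OF TG(1) one_closed]
      using TG(1) subgroup.one_closed[OF H] by auto
    fix x assume x: "x \<in> K T"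
    then have xG: "x \<in> carrier G" using KG by auto
    show "inv x \<in> K T" unfolding mem_K[OF TG(1) inv_closed[OF xG]]
    proof
      fix t assume t: "t \<in> T"
      then have tG: "t \<in> carrier G" using TG by auto
      have "inv (inv t \<otimes> x \<otimes> t) \<in> H" using x t mem_K[OF TG(1) xG] subgroup.m_inv_closed[OF H] by auto
      then show "inv t \<otimes> inv x \<otimes> t \<in> H" using tG xG by (simp add: inv_mult_group m_assoc)
    qed
    fix y assume y: "y \<in> K T"
    then have yG: "y \<in> carrier G" using KG by auto
    show "x \<otimes> y \<in> K T" unfolding mem_K[OF TG(1) m_closed[OF xG yG]]
    proof
      fix t assume t: "t \<in> T"
      then have tG: "t \<in> carrier G" using TG by auto
      have "(inv t \<otimes> x \<otimes> t) \<otimes> (inv t \<otimes> y \<otimes> t) \<in> H"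
        using x y t mem_K[OF TG(1)] xG yG subgroup.m_closed[OF H] by auto
      moreover have "(inv t \<otimes> x \<otimes> t) \<otimes> (inv t \<otimes> y \<otimes> t) = inv t \<otimes> (x \<otimes> y) \<otimes> t"
        using tG xG yG inv_cancel by (simp add: m_assoc)
      ultimately show "inv t \<otimes> (x \<otimes> y) \<otimes> t \<in> H" by simp
    qed
  qed
  moreover have "g \<otimes> x \<otimes> inv g \<in> K T" if g: "g \<in> carrier G" and x: "x \<in> K T" for g x
  proof -
    \<comment> \<open>\<open>K ?gT\<close> is the conjugate of \<open>K T\<close> by
      \<open>inv g\<close>. Adjoining \<open>?gT\<close> to \<open>T\<close> cannot shrink the
      minimal intersection, so \<open>K T\<close> is contained in that conjugate.\<close>
    let ?gT = "(\<lambda>t. inv g \<otimes> t) ` T"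
    have gTG: "?gT \<subseteq> carrier G" using g TG by auto
    have "K (T \<union> ?gT) \<subseteq> K T" by (auto simp: K_def)
    moreover have "good (T \<union> ?gT)"
      using TG gTG finite_subset[OF calculation] by (auto simp: good_def)
    ultimately have "K (T \<union> ?gT) = K T" using min TG(4) by (intro card_seteq) auto
    then have "x \<in> K ?gT" using x by (auto simp: K_def)
    moreover have xG: "x \<in> carrier G" using x KG by auto
    ultimately have *: "\<forall>t\<in>T. inv (inv g \<otimes> t) \<otimes> x \<otimes> (inv g \<otimes> t) \<in> H"
      using mem_K[OF gTG xG] by auto
    have "inv t \<otimes> (g \<otimes> x \<otimes> inv g) \<otimes> t \<in> H" if t: "t \<in> T" for t
      using * t TG g xG by (force simp: inv_mult_group m_assoc)
    then show ?thesis using mem_K[OF TG(1)] g xG by auto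
  qed
  ultimately have "K T \<lhd> G" using normal_inv_iff by blast
  then have "K T = {\<one>}" using no_fin TG(4) by blast
  then show ?thesis using that[of T] TG by (simp add: K_def)
qed

text \<open>The condition on \<open>g\<close> says that every \<open>s\<close> in \<open>S\<close>
  moves the point \<open>g m\<close>. To add \<open>s0\<close>, concentration provides
  \<open>y\<close> with all points \<open>y t m\<close>, for \<open>t\<close> in \<open>T\<close>,
  close to \<open>m\<close>. Each \<open>g y t m\<close> is then still moved by \<open>S\<close>. If
  \<open>s0\<close> fixed all of them, a conjugate of \<open>s0\<close> would fix every
  \<open>t m\<close> and so lie in the trivial intersection.\<close>

lemma avoid_mean_stab:
  assumes b: "boundary_point q m"
    and T: "finite T" "T \<noteq> {}" "T \<subseteq> carrier G" "(\<Inter>t\<in>T. conjugate G t (mean_stab m)) = {\<one>}"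
    and S: "finite S" "S \<subseteq> carrier G" "\<one> \<notin> S"
  shows "\<exists>g\<in>carrier G. \<forall>s\<in>S. inv g \<otimes> s \<otimes> g \<notin> mean_stab m"
  using S
proof (induction S)
  case empty
  then show ?case by auto
next
  case (insert s0 S)
  have m: "mean (carrier G) m" using b by (simp add: boundary_point_def)
  have HG: "mean_stab m \<subseteq> carrier G" by (auto simp: mean_stab_def)
  obtain g where g: "g \<in> carrier G" "\<And>s. s \<in> S \<Longrightarrow> inv g \<otimes> s \<otimes> g \<notin> mean_stab m"
    using insert by auto
  define c where "c s = inv g \<otimes> s \<otimes> g" for s
  have c: "c s \<in> carrier G" if "s \<in> S" for s using that g(1) insert.prems by (auto simp: c_def)
  have "\<exists>f\<in>bfun (carrier G). m (\<lambda>x. f (c s \<otimes> x)) \<noteq> m f" if "s \<in> S" for s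
    using g(2)[OF that] c[OF that] by (auto simp: mean_stab_def c_def)
  then obtain f where f: "\<And>s. s \<in> S \<Longrightarrow> f s \<in> bfun (carrier G)"
    and f_ne: "\<And>s. s \<in> S \<Longrightarrow> m (\<lambda>x. f s (c s \<otimes> x)) \<noteq> m (f s)" by metis
  define a where "a s = 1 / (m (\<lambda>x. f s (c s \<otimes> x)) - m (f s))" for s
  \<comment> \<open>A witness that \<open>c s\<close> moves a mean: it vanishes on every mean fixed
    by \<open>c s\<close>, while the factor \<open>a s\<close> gives it the value 1 at
    \<open>m\<close>. The property of being moved thus persists while the value stays near
    1.\<close>
  define d where "d s = (\<lambda>x. a s * (f s (c s \<otimes> x) - f s x))" for s
  have d: "d s \<in> bfun (carrier G)" if "s \<in> S" for s
    unfolding d_def using f[OF that] bfun_shift[OF f[OF that] c[OF that]] by auto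
  have md: "m (d s) = 1" if "s \<in> S" for s
  proof -
    have "m (d s) = a s * (m (\<lambda>x. f s (c s \<otimes> x)) - m (f s))"
      unfolding d_def using mean_scale[OF m bfun_diff[OF bfun_shift[OF f[OF that] c[OF that]] f[OF that]]]
        mean_diff[OF m bfun_shift[OF f[OF that] c[OF that]] f[OF that]] by simp
    then show ?thesis using f_ne[OF that] by (simp add: a_def)
  qed
  \<comment> \<open>Right multiplication by \<open>T\<close> commutes with left translation, which
    makes this kernel equivariant. The average is uniform, so a value below
    \<open>1 / card T\<close> controls all terms at once.\<close>
  define E where "E h y = (1 / card T) * (\<Sum>t\<in>T. h (y \<otimes> t))" for h :: "'a \<Rightarrow> real" and y
  have cT: "card T > 0" using T by (simp add: card_gt_0_iff)
  have E: "mean (carrier G) (\<lambda>h. E h y)" if y: "y \<in> carrier G" for y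
  proof (rule meanI)
    fix h B assume "h \<in> bfun (carrier G)" "\<And>x. x \<in> carrier G \<Longrightarrow> h x \<le> B"
    then have "(\<Sum>t\<in>T. h (y \<otimes> t)) \<le> (\<Sum>t\<in>T. B)" using T y by (intro sum_mono) auto
    then show "E h y \<le> B" using cT by (simp add: E_def field_simps)
  qed (simp_all add: E_def sum.distrib sum_distrib_left algebra_simps)
  obtain \<psi> where \<psi>: "mean (carrier G) \<psi>"
    "\<And>f. f \<in> bfun (carrier G) \<Longrightarrow> \<psi> (E (\<lambda>g. (orbit_fun m f g - m f)\<^sup>2)) = 0"
  proof (rule orbit_concentration[OF b cone_on_zero E])
    fix s w assume s: "s \<in> carrier G" and "w \<in> {\<lambda>_::'a. 0::real}"
    have "E (\<lambda>x. f (s \<otimes> x)) y = E f (s \<otimes> y)" if "y \<in> carrier G" for f y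
      unfolding E_def using T s that by (intro arg_cong2[where f="(*)"] refl sum.cong) (auto simp: m_assoc)
    then show "\<exists>w'\<in>{\<lambda>_. 0}. \<forall>f\<in>bfun (carrier G). \<forall>B. (\<forall>y\<in>carrier G. E f y + w y \<le> B) \<longrightarrow>
        (\<forall>y\<in>carrier G. E (\<lambda>x. f (s \<otimes> x)) y + w' y \<le> B)"
      using s \<open>w \<in> _\<close> by auto
  next
    fix \<psi> assume "mean (carrier G) \<psi>"
      "\<And>f. f \<in> bfun (carrier G) \<Longrightarrow> \<psi> (E (\<lambda>g. (orbit_fun m f g - m f)\<^sup>2)) = 0"
    then show thesis by (rule that)
  qed
  define \<theta> where "\<theta> h = \<psi> (E h)" for h
  have \<theta>: "mean (carrier G) \<theta>" unfolding \<theta>_def by (rule mean_compose[OF \<psi>(1) E])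
  define k where "k y = (\<Sum>s\<in>S. (orbit_fun m (d s) y - 1)\<^sup>2)" for y
  have kb: "(\<lambda>y. (orbit_fun m (d s) y - 1)\<^sup>2) \<in> bfun (carrier G)" if "s \<in> S" for s
    using bfun_orbit_fun[OF m d[OF that]] by auto
  have "\<theta> k = (\<Sum>s\<in>S. \<theta> (\<lambda>y. (orbit_fun m (d s) y - 1)\<^sup>2))"
    unfolding k_def by (rule mean_sum[OF \<theta>]) (rule kb)
  also have "\<dots> = 0" using \<psi>(2)[OF d] md by (simp add: \<theta>_def)
  finally have "\<psi> (E k) = 0" by (simp add: \<theta>_def)
  moreover have "E k \<in> bfun (carrier G)"
    unfolding k_def by (intro bfun_compose[OF mean_sublin[OF E]] bfun_sum kb)
  ultimately obtain y where y: "y \<in> carrier G" "E k y < 1 / card T"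
    using sublin_ge[OF mean_sublin[OF \<psi>(1)], of "E k" "1 / card T"] cT by (force simp: not_le)
  then have sumk: "(\<Sum>t\<in>T. k (y \<otimes> t)) < 1" using cT by (simp add: E_def field_simps)
  have k0: "0 \<le> k x" for x by (simp add: k_def sum_nonneg)
  have "\<exists>t\<in>T. inv (g \<otimes> y \<otimes> t) \<otimes> s0 \<otimes> (g \<otimes> y \<otimes> t) \<notin> mean_stab m"
  proof (rule ccontr)
    assume neg: "\<not> ?thesis"
    let ?z = "inv (g \<otimes> y) \<otimes> s0 \<otimes> (g \<otimes> y)"
    have s0G: "s0 \<in> carrier G" using insert by auto
    have "inv t \<otimes> ?z \<otimes> t \<in> mean_stab m" if t: "t \<in> T" for t
    proof -
      have tG: "t \<in> carrier G" using t T by auto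
      have "inv (g \<otimes> y \<otimes> t) \<otimes> s0 \<otimes> (g \<otimes> y \<otimes> t) \<in> mean_stab m" using neg t by blast
      moreover have "inv (g \<otimes> y \<otimes> t) \<otimes> s0 \<otimes> (g \<otimes> y \<otimes> t) = inv t \<otimes> ?z \<otimes> t"
        using tG g(1) y(1) s0G by (simp add: inv_mult_group m_assoc)
      ultimately show ?thesis by simp
    qed
    then have "?z \<in> (\<Inter>t\<in>T. conjugate G t (mean_stab m))"
      using mem_conjugate_iff[OF _ HG, of _ ?z] T(3) g(1) y(1) s0G by auto
    then have z: "?z = \<one>" using T(4) by simp
    have "s0 = (g \<otimes> y) \<otimes> ?z \<otimes> inv (g \<otimes> y)"
      using g(1) y(1) s0G using inv_cancel[of "g \<otimes> y"] by (simp add: m_assoc inv_mult_group inv_cancel)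
    then have "s0 = \<one>" unfolding z using g(1) y(1) by simp
    then show False using insert by auto
  qed
  then obtain t where t: "t \<in> T" "inv (g \<otimes> y \<otimes> t) \<otimes> s0 \<otimes> (g \<otimes> y \<otimes> t) \<notin> mean_stab m" by blast
  define u where "u = y \<otimes> t"
  have uG: "u \<in> carrier G" and tG: "t \<in> carrier G" using t T y by (auto simp: u_def)
  have "k u \<le> (\<Sum>t\<in>T. k (y \<otimes> t))" unfolding u_def by (rule member_le_sum[OF t(1)]) (use k0 T in auto)
  \<comment> \<open>Each squared deviation at \<open>u\<close> is now below 1, so the value of the
    translated mean at \<open>d s\<close> cannot be 0.\<close>
  then have ku: "k u < 1" using sumk by simp
  have "inv (g \<otimes> u) \<otimes> s \<otimes> (g \<otimes> u) \<notin> mean_stab m" if s: "s \<in> S" for s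
  proof
    assume H: "inv (g \<otimes> u) \<otimes> s \<otimes> (g \<otimes> u) \<in> mean_stab m"
    have sG: "s \<in> carrier G" using s insert by auto
    have "(orbit_fun m (d s) u - 1)\<^sup>2 \<le> k u"
      unfolding k_def by (rule member_le_sum[OF s]) (use insert in auto)
    then have ne: "orbit_fun m (d s) u \<noteq> 0" using ku by auto
    define p where "p = (\<lambda>x. f s (u \<otimes> x))"
    have p: "p \<in> bfun (carrier G)" unfolding p_def by (rule bfun_shift[OF f[OF s] uG])
    define v where "v = inv (g \<otimes> u) \<otimes> s \<otimes> (g \<otimes> u)"
    have vG: "v \<in> carrier G" using sG g(1) uG by (simp add: v_def)
    have uv: "u \<otimes> v = c s \<otimes> u"
      using sG g(1) uG by (simp add: v_def c_def inv_mult_group m_assoc inv_cancel)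
    have mp: "m (\<lambda>x. p (v \<otimes> x)) = m p" by (rule mean_stabD[OF H[folded v_def] p])
    have "orbit_fun m (d s) u = m (\<lambda>x. a s * (p (v \<otimes> x) - p x))"
      unfolding orbit_fun_def
    proof (rule sublin_cong[OF mean_sublin[OF m]])
      show "(\<lambda>x. d s (u \<otimes> x)) \<in> bfun (carrier G)" by (rule bfun_shift[OF d[OF s] uG])
      fix x assume x: "x \<in> carrier G"
      have "c s \<otimes> (u \<otimes> x) = u \<otimes> (v \<otimes> x)"
        using uv x uG vG c[OF s] by (simp add: m_assoc[symmetric])
      then show "d s (u \<otimes> x) = a s * (p (v \<otimes> x) - p x)" by (simp add: d_def p_def)
    qed
    also have "\<dots> = a s * (m (\<lambda>x. p (v \<otimes> x)) - m p)"
      using mean_scale[OF m bfun_diff[OF bfun_shift[OF p vG] p]] mean_diff[OF m bfun_shift[OF p vG] p] by simp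
    also have "\<dots> = 0" using mp by simp
    finally show False using ne by simp
  qed
  moreover have "inv (g \<otimes> u) \<otimes> s0 \<otimes> (g \<otimes> u) \<notin> mean_stab m"
    using t(2) g(1) y(1) tG by (simp add: u_def m_assoc)
  ultimately show ?case using g(1) uG by (intro bexI[of _ "g \<otimes> u"]) auto
qed

end

section \<open>Square-summable functions\<close>

definition sqnorm :: "('a, 'b) monoid_scheme \<Rightarrow> ('a \<Rightarrow> complex) \<Rightarrow> real" where
  "sqnorm G f = infsum (\<lambda>x. (cmod (f x))\<^sup>2) (carrier G)"

definition iprod :: "('a, 'b) monoid_scheme \<Rightarrow> ('a \<Rightarrow> complex) \<Rightarrow> ('a \<Rightarrow> complex) \<Rightarrow> complex" where
  "iprod G f h = infsum (\<lambda>x. f x * cnj (h x)) (carrier G)"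

lemma l2norm_sqnorm: "l2norm G f = sqrt (sqnorm G f)"
  by (simp add: l2norm_def sqnorm_def)

lemma sqnorm_nonneg [simp]: "0 \<le> sqnorm G f"
  by (simp add: sqnorm_def infsum_nonneg)

lemma l2norm_power2: "(l2norm G f)\<^sup>2 = sqnorm G f"
  by (simp add: l2norm_sqnorm)

lemma l2_summable: "f \<in> l2 G \<Longrightarrow> (\<lambda>x. (cmod (f x))\<^sup>2) summable_on carrier G"
  by (simp add: l2_def)

lemma l2_outside: "f \<in> l2 G \<Longrightarrow> x \<notin> carrier G \<Longrightarrow> f x = 0"
  by (simp add: l2_def)

lemma l2I_bound:
  assumes "\<And>x. x \<notin> carrier G \<Longrightarrow> f x = 0" "g summable_on carrier G"
    and "\<And>x. x \<in> carrier G \<Longrightarrow> (cmod (f x))\<^sup>2 \<le> g x"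
  shows "f \<in> l2 G"
proof -
  have "(\<lambda>x. norm ((cmod (f x))\<^sup>2)) summable_on carrier G"
    by (rule Infinite_Sum.abs_summable_on_comparison_test'[OF assms(2)]) (use assms(3) in auto)
  then show ?thesis using assms(1) by (simp add: l2_def)
qed

lemma cmod_add_sq_le: "(cmod (a + b))\<^sup>2 \<le> 2 * (cmod a)\<^sup>2 + 2 * (cmod b)\<^sup>2"
proof -
  have "(cmod (a + b))\<^sup>2 \<le> (cmod a + cmod b)\<^sup>2" by (intro power_mono norm_triangle_ineq) simp
  also have "\<dots> \<le> 2 * (cmod a)\<^sup>2 + 2 * (cmod b)\<^sup>2"
    using sum_squares_bound[of "cmod a" "cmod b"] by (simp add: power2_sum)
  finally show ?thesis .
qed

lemma l2_zero [simp]: "(\<lambda>_. 0) \<in> l2 G"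
  by (simp add: l2_def)

lemma l2_add: "f \<in> l2 G \<Longrightarrow> h \<in> l2 G \<Longrightarrow> (\<lambda>x. f x + h x) \<in> l2 G"
  by (rule l2I_bound[where g = "\<lambda>x. 2 * (cmod (f x))\<^sup>2 + 2 * (cmod (h x))\<^sup>2"])
    (auto intro!: summable_on_add summable_on_cmult_right cmod_add_sq_le simp: l2_summable l2_outside)

lemma l2_bfun_mult:
  assumes f: "f \<in> l2 G" and k: "k \<in> bfun (carrier G)"
  shows "(\<lambda>x. of_real (k x) * f x) \<in> l2 G"
proof -
  obtain B where B: "\<And>x. x \<in> carrier G \<Longrightarrow> \<bar>k x\<bar> \<le> B" using bfunE[OF k] by blast
  show ?thesis
  proof (rule l2I_bound[where g = "\<lambda>x. B\<^sup>2 * (cmod (f x))\<^sup>2"])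
    fix x assume "x \<in> carrier G"
    then have "\<bar>k x\<bar>\<^sup>2 \<le> B\<^sup>2" using B by (intro power_mono) auto
    then show "(cmod (of_real (k x) * f x))\<^sup>2 \<le> B\<^sup>2 * (cmod (f x))\<^sup>2"
      by (simp add: norm_mult power_mult_distrib mult_right_mono)
  qed (use f in \<open>auto intro!: summable_on_cmult_right simp: l2_summable l2_outside\<close>)
qed

lemma l2_scale: "f \<in> l2 G \<Longrightarrow> (\<lambda>x. c * f x) \<in> l2 G"
  by (rule l2I_bound[where g = "\<lambda>x. (cmod c)\<^sup>2 * (cmod (f x))\<^sup>2"])
    (auto intro!: summable_on_cmult_right simp: l2_summable l2_outside norm_mult power_mult_distrib)

lemma l2_diff: "f \<in> l2 G \<Longrightarrow> h \<in> l2 G \<Longrightarrow> (\<lambda>x. f x - h x) \<in> l2 G"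
  using l2_add[of f G "\<lambda>x. (-1) * h x"] l2_scale[of h G "-1"] by simp

lemma l2_sum: "(\<And>i. i \<in> A \<Longrightarrow> u i \<in> l2 G) \<Longrightarrow> (\<lambda>x. \<Sum>i\<in>A. u i x) \<in> l2 G"
  by (induction A rule: infinite_finite_induct) (auto intro: l2_add)

lemma weighted_am_gm: "\<delta> > 0 \<Longrightarrow> (a::real) * b \<le> (\<delta> * a\<^sup>2 + b\<^sup>2 / \<delta>) / 2"
proof -
  assume d: "\<delta> > 0"
  have "0 \<le> (\<delta> * a - b)\<^sup>2" by simp
  then have "2 * \<delta> * (a * b) \<le> \<delta> * (\<delta> * a\<^sup>2) + b\<^sup>2" by (simp add: power2_eq_square algebra_simps)
  then show ?thesis using d by (simp add: field_simps power2_eq_square)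
qed

text \<open>Pointwise weighted AM-GM instead of Cauchy-Schwarz: the right-hand side is linear in the
  squared norms, so a mean can be applied to it, and \<open>\<delta>\<close> is chosen
  afterwards.\<close>

lemma
  assumes f: "f \<in> l2 G" and h: "h \<in> l2 G"
  shows iprod_abs_summable: "(\<lambda>x. norm (f x * cnj (h x))) summable_on carrier G"
    and iprod_bound: "\<delta> > 0 \<Longrightarrow> cmod (iprod G f h) \<le> (\<delta> * sqnorm G f + sqnorm G h / \<delta>) / 2"
proof -
  have s: "(\<lambda>x. (\<delta> / 2) * (cmod (f x))\<^sup>2 + (1 / (2 * \<delta>)) * (cmod (h x))\<^sup>2) summable_on carrier G" for \<delta> :: real
    by (intro summable_on_add summable_on_cmult_right l2_summable f h)
  have le: "norm (f x * cnj (h x)) \<le> (\<delta> / 2) * (cmod (f x))\<^sup>2 + (1 / (2 * \<delta>)) * (cmod (h x))\<^sup>2"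
    if "\<delta> > 0" for x and \<delta> :: real
    using weighted_am_gm[OF that, of "cmod (f x)" "cmod (h x)"] by (simp add: norm_mult add_divide_distrib)
  show sm: "(\<lambda>x. norm (f x * cnj (h x))) summable_on carrier G"
    by (rule Infinite_Sum.abs_summable_on_comparison_test'[OF s[of 1]]) (rule le, simp)
  assume d: "\<delta> > 0"
  have "cmod (iprod G f h) \<le> infsum (\<lambda>x. norm (f x * cnj (h x))) (carrier G)"
    unfolding iprod_def by (rule norm_infsum_bound[OF sm])
  also have "\<dots> \<le> infsum (\<lambda>x. (\<delta> / 2) * (cmod (f x))\<^sup>2 + (1 / (2 * \<delta>)) * (cmod (h x))\<^sup>2) (carrier G)"
    by (rule infsum_mono[OF sm s le[OF d]])
  also have "\<dots> = (\<delta> / 2) * sqnorm G f + (1 / (2 * \<delta>)) * sqnorm G h"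
    unfolding sqnorm_def infsum_cmult_right'[symmetric]
    by (intro infsum_add summable_on_cmult_right l2_summable f h)
  finally show "cmod (iprod G f h) \<le> (\<delta> * sqnorm G f + sqnorm G h / \<delta>) / 2"
    by (simp add: add_divide_distrib)
qed

lemma iprod_summable: "f \<in> l2 G \<Longrightarrow> h \<in> l2 G \<Longrightarrow> (\<lambda>x. f x * cnj (h x)) summable_on carrier G"
  by (rule abs_summable_summable[OF iprod_abs_summable])

lemma iprod_add_left:
  "f \<in> l2 G \<Longrightarrow> g \<in> l2 G \<Longrightarrow> h \<in> l2 G \<Longrightarrow> iprod G (\<lambda>x. f x + g x) h = iprod G f h + iprod G g h"
  unfolding iprod_def by (simp add: distrib_right infsum_add iprod_summable)

lemma iprod_add_right:
  "f \<in> l2 G \<Longrightarrow> g \<in> l2 G \<Longrightarrow> h \<in> l2 G \<Longrightarrow> iprod G f (\<lambda>x. g x + h x) = iprod G f g + iprod G f h"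
  unfolding iprod_def by (simp add: distrib_left infsum_add iprod_summable)

lemma iprod_scale_left: "iprod G (\<lambda>x. c * f x) h = c * iprod G f h"
  unfolding iprod_def by (simp add: mult.assoc infsum_cmult_right')

lemma iprod_scale_right: "iprod G f (\<lambda>x. c * h x) = cnj c * iprod G f h"
  unfolding iprod_def by (simp add: mult.left_commute infsum_cmult_right')

lemma iprod_zero [simp]: "iprod G (\<lambda>_. 0) h = 0" "iprod G f (\<lambda>_. 0) = 0"
  by (simp_all add: iprod_def)

lemma iprod_sum_left:
  "(\<And>i. i \<in> A \<Longrightarrow> u i \<in> l2 G) \<Longrightarrow> h \<in> l2 G \<Longrightarrow> iprod G (\<lambda>x. \<Sum>i\<in>A. u i x) h = (\<Sum>i\<in>A. iprod G (u i) h)"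
  by (induction A rule: infinite_finite_induct) (auto simp: iprod_add_left l2_sum)

lemma iprod_sum_right:
  "f \<in> l2 G \<Longrightarrow> (\<And>i. i \<in> A \<Longrightarrow> u i \<in> l2 G) \<Longrightarrow> iprod G f (\<lambda>x. \<Sum>i\<in>A. u i x) = (\<Sum>i\<in>A. iprod G f (u i))"
  by (induction A rule: infinite_finite_induct) (auto simp: iprod_add_right l2_sum)

lemma iprod_self: "f \<in> l2 G \<Longrightarrow> iprod G f f = of_real (sqnorm G f)"
  unfolding iprod_def sqnorm_def complex_norm_square[symmetric] of_real_power[symmetric]
  by (intro infsumI has_sum_of_real has_sum_infsum l2_summable)

lemma sqnorm_add:
  assumes "f \<in> l2 G" "h \<in> l2 G"
  shows "sqnorm G (\<lambda>x. f x + h x) = sqnorm G f + 2 * Re (iprod G f h) + sqnorm G h"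
proof -
  have "(cmod (a + b))\<^sup>2 = (cmod a)\<^sup>2 + 2 * Re (a * cnj b) + (cmod b)\<^sup>2" for a b :: complex
    by (simp add: cmod_power2) (simp add: power2_eq_square algebra_simps)
  then have "sqnorm G (\<lambda>x. f x + h x) =
      infsum (\<lambda>x. ((cmod (f x))\<^sup>2 + 2 * Re (f x * cnj (h x))) + (cmod (h x))\<^sup>2) (carrier G)"
    by (simp only: sqnorm_def)
  also have "\<dots> = infsum (\<lambda>x. (cmod (f x))\<^sup>2 + 2 * Re (f x * cnj (h x))) (carrier G) + sqnorm G h"
    unfolding sqnorm_def
    by (intro infsum_add summable_on_add summable_on_cmult_right summable_on_Re iprod_summable l2_summable assms)
  also have "infsum (\<lambda>x. (cmod (f x))\<^sup>2 + 2 * Re (f x * cnj (h x))) (carrier G) =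
      sqnorm G f + infsum (\<lambda>x. 2 * Re (f x * cnj (h x))) (carrier G)"
    unfolding sqnorm_def
    by (intro infsum_add summable_on_cmult_right summable_on_Re iprod_summable l2_summable assms)
  also have "infsum (\<lambda>x. 2 * Re (f x * cnj (h x))) (carrier G) = 2 * Re (iprod G f h)"
    using infsum_Re[OF iprod_summable[OF assms]] by (simp only: infsum_cmult_right' iprod_def)
  finally show ?thesis .
qed

lemma sqnorm_scale: "sqnorm G (\<lambda>x. c * f x) = (cmod c)\<^sup>2 * sqnorm G f"
  unfolding sqnorm_def by (simp add: norm_mult power_mult_distrib infsum_cmult_right')

lemma sqnorm_add_le:
  assumes "f \<in> l2 G" "h \<in> l2 G"
  shows "sqnorm G (\<lambda>x. f x + h x) \<le> 2 * sqnorm G f + 2 * sqnorm G h"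
  using sqnorm_add[OF assms] iprod_bound[OF assms, of 1] complex_Re_le_cmod[of "iprod G f h"] by simp

lemma sqnorm_diff_le:
  assumes "f \<in> l2 G" "h \<in> l2 G"
  shows "sqnorm G (\<lambda>x. f x - h x) \<le> 2 * sqnorm G f + 2 * sqnorm G h"
  using sqnorm_add_le[OF assms(1) l2_scale[OF assms(2), of "-1"]] sqnorm_scale[of G "-1" h] by simp

lemma sqnorm_eq_0:
  assumes "f \<in> l2 G" "sqnorm G f \<le> 0"
  shows "f = (\<lambda>_. 0)"
proof
  fix x show "f x = 0"
  proof (cases "x \<in> carrier G")
    case True
    then have "(cmod (f x))\<^sup>2 = 0"
      using nonneg_infsum_le_0D[of "\<lambda>x. (cmod (f x))\<^sup>2" "carrier G" x] assms l2_summable[OF assms(1)]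
      by (simp add: sqnorm_def)
    then show ?thesis by simp
  qed (simp add: l2_outside[OF assms(1)])
qed

section \<open>Bounded operators and their norm\<close>

lemma
  assumes "bdd_op G T"
  shows bdd_op_l2: "f \<in> l2 G \<Longrightarrow> T f \<in> l2 G"
    and bdd_op_outside: "f \<notin> l2 G \<Longrightarrow> T f = (\<lambda>_. 0)"
    and bdd_op_add: "f \<in> l2 G \<Longrightarrow> h \<in> l2 G \<Longrightarrow> T (\<lambda>x. f x + h x) = (\<lambda>x. T f x + T h x)"
    and bdd_op_scale: "f \<in> l2 G \<Longrightarrow> T (\<lambda>x. c * f x) = (\<lambda>x. c * T f x)"
  using assms by (auto simp: bdd_op_def)

lemma bdd_op_zero: "bdd_op G T \<Longrightarrow> T (\<lambda>_. 0) = (\<lambda>_. 0)"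
  using bdd_op_scale[of G T "\<lambda>_. 0" 0] by simp

lemma bdd_op_bound:
  assumes "bdd_op G T"
  obtains C where "C > 0" "\<And>f. f \<in> l2 G \<Longrightarrow> sqnorm G (T f) \<le> C * sqnorm G f"
proof -
  obtain C where C: "\<forall>f\<in>l2 G. l2norm G (T f) \<le> C * l2norm G f" using assms by (auto simp: bdd_op_def)
  \<comment> \<open>The given \<open>C\<close> may be zero or negative; \<open>C\<^sup>2 + 1\<close>
    is strictly positive, so that one may divide by it later.\<close>
  show ?thesis
  proof (rule that[of "C\<^sup>2 + 1"])
    show "0 < C\<^sup>2 + 1" by (simp add: add_nonneg_pos)
    fix f assume "f \<in> l2 G"
    then have "(l2norm G (T f))\<^sup>2 \<le> (C * l2norm G f)\<^sup>2"
      using C by (intro power_mono) (auto simp: l2norm_sqnorm)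
    then have "sqnorm G (T f) \<le> C\<^sup>2 * sqnorm G f" by (simp add: power_mult_distrib l2norm_power2)
    also have "\<dots> \<le> (C\<^sup>2 + 1) * sqnorm G f" by (intro mult_right_mono) auto
    finally show "sqnorm G (T f) \<le> (C\<^sup>2 + 1) * sqnorm G f" .
  qed
qed

lemma opnorm_le:
  assumes "\<And>f. f \<in> l2 G \<Longrightarrow> sqnorm G f \<le> 1 \<Longrightarrow> l2norm G (D f) \<le> M"
  shows "opnorm G D \<le> M"
  unfolding opnorm_def
proof (rule cSup_least)
  have "l2norm G (\<lambda>_. 0) \<le> 1" by (simp add: l2norm_sqnorm sqnorm_def)
  then show "{l2norm G (D f) |f. f \<in> l2 G \<and> l2norm G f \<le> 1} \<noteq> {}" using l2_zero by blast
  fix y assume "y \<in> {l2norm G (D f) |f. f \<in> l2 G \<and> l2norm G f \<le> 1}"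
  then show "y \<le> M" using assms by (auto simp: l2norm_sqnorm)
qed

text \<open>\<open>opnorm\<close> is a real supremum and bounds its set only if that set is bounded
  above. The constant \<open>K\<close> ensures this.\<close>

lemma l2norm_le_opnorm:
  assumes "\<And>f. f \<in> l2 G \<Longrightarrow> sqnorm G (D f) \<le> K * sqnorm G f" and f: "f \<in> l2 G" "sqnorm G f \<le> 1"
  shows "l2norm G (D f) \<le> opnorm G D"
proof -
  have "bdd_above {l2norm G (D f) |f. f \<in> l2 G \<and> l2norm G f \<le> 1}"
  proof (rule bdd_aboveI[of _ "sqrt (max K 0)"], clarify)
    fix f assume "f \<in> l2 G" "l2norm G f \<le> 1"
    then have "sqnorm G (D f) \<le> K * sqnorm G f" "sqnorm G f \<le> 1" using assms(1) by (auto simp: l2norm_sqnorm)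
    moreover have "K * sqnorm G f \<le> max K 0 * 1"
      using \<open>sqnorm G f \<le> 1\<close> by (intro mult_mono) auto
    ultimately show "l2norm G (D f) \<le> sqrt (max K 0)" by (simp add: l2norm_sqnorm)
  qed
  then show ?thesis
    unfolding opnorm_def by (rule cSup_upper[rotated]) (use f in \<open>auto simp: l2norm_sqnorm\<close>)
qed

section \<open>Unit vectors as probability densities\<close>

definition l2sphere :: "('a, 'b) monoid_scheme \<Rightarrow> ('a \<Rightarrow> complex) set" where
  "l2sphere G = {f \<in> l2 G. sqnorm G f = 1}"

text \<open>The vector state of \<open>\<xi>\<close> at the multiplication operator by
  \<open>h\<close>, that is, for unit \<open>\<xi>\<close>, the expectation of \<open>h\<close>
  under the density |xi|^2. It is the kernel from the sphere to means on the group.\<close>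

definition sq_mean :: "('a, 'b) monoid_scheme \<Rightarrow> ('a \<Rightarrow> real) \<Rightarrow> ('a \<Rightarrow> complex) \<Rightarrow> real" where
  "sq_mean G h \<xi> = infsum (\<lambda>x. h x * (cmod (\<xi> x))\<^sup>2) (carrier G)"

lemma sq_mean_summable:
  assumes "h \<in> bfun (carrier G)" "\<xi> \<in> l2 G"
  shows "(\<lambda>x. h x * (cmod (\<xi> x))\<^sup>2) summable_on carrier G"
proof -
  obtain B where "\<And>x. x \<in> carrier G \<Longrightarrow> \<bar>h x\<bar> \<le> B" using bfunE[OF assms(1)] by blast
  then have "(\<lambda>x. norm (h x * (cmod (\<xi> x))\<^sup>2)) summable_on carrier G"
    by (intro Infinite_Sum.abs_summable_on_comparison_test'[OF summable_on_cmult_right[OF l2_summable[OF assms(2)], of B]])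
      (simp add: abs_mult mult_right_mono)
  then show ?thesis by (rule abs_summable_summable)
qed

lemma mean_sq_mean:
  assumes "\<xi> \<in> l2sphere G"
  shows "mean (carrier G) (\<lambda>h. sq_mean G h \<xi>)"
proof (rule meanI)
  have \<xi>: "\<xi> \<in> l2 G" "sqnorm G \<xi> = 1" using assms by (auto simp: l2sphere_def)
  note s = sq_mean_summable[OF _ \<xi>(1)]
  show "sq_mean G (\<lambda>x. f x + g x) \<xi> = sq_mean G f \<xi> + sq_mean G g \<xi>"
    if "f \<in> bfun (carrier G)" "g \<in> bfun (carrier G)" for f g
    unfolding sq_mean_def using infsum_add[OF s[OF that(1)] s[OF that(2)]] by (simp add: distrib_right)
  show "sq_mean G (\<lambda>x. c * f x) \<xi> = c * sq_mean G f \<xi>" for f c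
    unfolding sq_mean_def by (simp add: mult.assoc infsum_cmult_right')
  fix f B assume f: "f \<in> bfun (carrier G)" "\<And>x. x \<in> carrier G \<Longrightarrow> f x \<le> B"
  have "sq_mean G f \<xi> \<le> infsum (\<lambda>x. B * (cmod (\<xi> x))\<^sup>2) (carrier G)"
    unfolding sq_mean_def
    by (intro infsum_mono s f summable_on_cmult_right l2_summable \<xi> mult_right_mono) auto
  also have "\<dots> = B" using \<xi>(2) by (simp add: infsum_cmult_right' sqnorm_def)
  finally show "sq_mean G f \<xi> \<le> B" .
qed

lemma sq_mean_power2: "sq_mean G (\<lambda>x. (k x)\<^sup>2) \<xi> = sqnorm G (\<lambda>x. of_real (k x) * \<xi> x)"
  unfolding sq_mean_def sqnorm_def by (simp add: norm_mult power_mult_distrib)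

context group
begin

section \<open>The left regular representation\<close>

abbreviation lr :: "'a \<Rightarrow> ('a \<Rightarrow> complex) \<Rightarrow> 'a \<Rightarrow> complex" where
  "lr \<equiv> left_reg G"

lemma bij_lmult: "g \<in> carrier G \<Longrightarrow> bij_betw (\<lambda>x. g \<otimes> x) (carrier G) (carrier G)"
  by (rule bij_betw_byWitness[where f' = "\<lambda>x. inv g \<otimes> x"]) (auto simp: inv_cancel inv_cancel')

lemma lr_apply: "f \<in> l2 G \<Longrightarrow> x \<in> carrier G \<Longrightarrow> lr g f x = f (inv g \<otimes> x)"
  by (simp add: left_reg_def)

lemma lr_outside: "x \<notin> carrier G \<Longrightarrow> lr g f x = 0"
  by (simp add: left_reg_def)

lemma lr_l2:
  assumes g: "g \<in> carrier G" and f: "f \<in> l2 G"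
  shows "lr g f \<in> l2 G" "sqnorm G (lr g f) = sqnorm G f"
proof -
  note b = bij_lmult[OF inv_closed[OF g]]
  have "(\<lambda>x. (cmod (lr g f x))\<^sup>2) summable_on carrier G \<longleftrightarrow> (\<lambda>x. (cmod (f (inv g \<otimes> x)))\<^sup>2) summable_on carrier G"
    by (rule summable_on_cong) (simp add: lr_apply f)
  also have "\<dots>" using summable_on_reindex_bij_betw[OF b, of "\<lambda>x. (cmod (f x))\<^sup>2"] l2_summable[OF f] by simp
  finally show "lr g f \<in> l2 G" by (simp add: l2_def lr_outside)
  have "sqnorm G (lr g f) = infsum (\<lambda>x. (cmod (f (inv g \<otimes> x)))\<^sup>2) (carrier G)"
    unfolding sqnorm_def by (rule infsum_cong) (simp add: lr_apply f)
  also have "\<dots> = sqnorm G f"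
    unfolding sqnorm_def using infsum_reindex_bij_betw[OF b, of "\<lambda>x. (cmod (f x))\<^sup>2"] .
  finally show "sqnorm G (lr g f) = sqnorm G f" .
qed

lemma lr_sphere: "g \<in> carrier G \<Longrightarrow> f \<in> l2sphere G \<Longrightarrow> lr g f \<in> l2sphere G"
  by (simp add: l2sphere_def lr_l2)

lemma iprod_lr:
  assumes g: "g \<in> carrier G" and f: "f \<in> l2 G" and h: "h \<in> l2 G"
  shows "iprod G (lr g f) (lr g h) = iprod G f h"
proof -
  have "iprod G (lr g f) (lr g h) = infsum (\<lambda>x. f (inv g \<otimes> x) * cnj (h (inv g \<otimes> x))) (carrier G)"
    unfolding iprod_def by (rule infsum_cong) (simp add: lr_apply f h)
  also have "\<dots> = iprod G f h"
    unfolding iprod_def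
    using infsum_reindex_bij_betw[OF bij_lmult[OF inv_closed[OF g]], of "\<lambda>x. f x * cnj (h x)"] .
  finally show ?thesis .
qed

lemma lr_mult:
  assumes "g \<in> carrier G" "h \<in> carrier G" "f \<in> l2 G"
  shows "lr g (lr h f) = lr (g \<otimes> h) f"
proof
  fix x show "lr g (lr h f) x = lr (g \<otimes> h) f x"
    using assms by (cases "x \<in> carrier G") (simp_all add: lr_apply lr_l2 lr_outside inv_mult_group m_assoc)
qed

lemma lr_one:
  assumes "f \<in> l2 G"
  shows "lr \<one> f = f"
proof
  fix x show "lr \<one> f x = f x"
    using assms by (cases "x \<in> carrier G") (simp_all add: lr_apply lr_outside l2_outside)
qed

lemma iprod_lr_inv:
  assumes "g \<in> carrier G" "f \<in> l2 G" "h \<in> l2 G"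
  shows "iprod G (lr (inv g) f) h = iprod G f (lr g h)"
  using iprod_lr[OF assms(1), of "lr (inv g) f" h] assms by (simp add: lr_l2 lr_mult lr_one)

text \<open>Covariance of multiplication operators under translations, which makes the kernel
  \<open>sq_mean\<close> equivariant.\<close>

lemma sq_mean_shift:
  assumes "s \<in> carrier G" "\<xi> \<in> l2 G"
  shows "sq_mean G (\<lambda>x. h (s \<otimes> x)) \<xi> = sq_mean G h (lr s \<xi>)"
proof -
  have "sq_mean G (\<lambda>x. h (s \<otimes> x)) \<xi> = infsum (\<lambda>x. h (s \<otimes> x) * (cmod (lr s \<xi> (s \<otimes> x)))\<^sup>2) (carrier G)"
    unfolding sq_mean_def by (rule infsum_cong) (simp add: lr_apply assms inv_cancel')
  also have "\<dots> = sq_mean G h (lr s \<xi>)"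
    unfolding sq_mean_def
    using infsum_reindex_bij_betw[OF bij_lmult[OF assms(1)], of "\<lambda>x. h x * (cmod (lr s \<xi> x))\<^sup>2"] .
  finally show ?thesis .
qed

lemma bdd_op_lr:
  assumes g: "g \<in> carrier G"
  shows "bdd_op G (lr g)"
  unfolding bdd_op_def
proof (intro conjI ballI allI impI)
  show "lr g f = (\<lambda>_. 0)" if "f \<notin> l2 G" for f using that by (simp add: left_reg_def)
  show "lr g f \<in> l2 G" if "f \<in> l2 G" for f by (rule lr_l2[OF g that])
  show "lr g (\<lambda>x. f x + h x) = (\<lambda>x. lr g f x + lr g h x)" if "f \<in> l2 G" "h \<in> l2 G" for f h
    using that by (auto simp: left_reg_def l2_add fun_eq_iff)
  show "lr g (\<lambda>x. c * f x) = (\<lambda>x. c * lr g f x)" if "f \<in> l2 G" for f c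
    using that by (auto simp: left_reg_def l2_scale fun_eq_iff)
  show "\<exists>C. \<forall>f\<in>l2 G. l2norm G (lr g f) \<le> C * l2norm G f"
    by (rule exI[of _ 1]) (simp add: l2norm_sqnorm lr_l2 g)
qed

lemma lr_reduced_Cstar:
  assumes g: "g \<in> carrier G"
  shows "lr g \<in> reduced_Cstar G"
proof -
  have "(\<lambda>f x. \<Sum>g\<in>{g}. 1 * lr g f x) \<in> group_algebra_ops G"
    unfolding group_algebra_ops_def using g by (intro CollectI exI[of _ "{g}"] exI[of _ "\<lambda>_. 1"]) simp
  then have "lr g \<in> group_algebra_ops G" by simp
  moreover have "opnorm G (op_diff (lr g) (lr g)) \<le> 0"
    by (rule opnorm_le) (simp add: op_diff_def l2norm_sqnorm sqnorm_def)
  ultimately show ?thesis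
    unfolding reduced_Cstar_def using bdd_op_lr[OF g] by (auto intro!: bexI[of _ "lr g"])
qed

section \<open>Elements of the group algebra\<close>

definition comb :: "'a set \<Rightarrow> ('a \<Rightarrow> complex) \<Rightarrow> ('a \<Rightarrow> complex) \<Rightarrow> 'a \<Rightarrow> complex" where
  "comb A c f = (\<lambda>x. \<Sum>g\<in>A. c g * lr g f x)"

lemma comb_l2: "A \<subseteq> carrier G \<Longrightarrow> f \<in> l2 G \<Longrightarrow> comb A c f \<in> l2 G"
  unfolding comb_def by (intro l2_sum l2_scale lr_l2) auto

lemma comb_bound:
  assumes "finite A" "A \<subseteq> carrier G"
  shows "\<exists>K. \<forall>f\<in>l2 G. sqnorm G (comb A c f) \<le> K * sqnorm G f"
  using assms
proof (induction A)
  case empty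
  show ?case by (intro exI[of _ 0]) (simp add: comb_def sqnorm_def)
next
  case (insert g A)
  then obtain K where K: "\<forall>f\<in>l2 G. sqnorm G (comb A c f) \<le> K * sqnorm G f" by auto
  have "sqnorm G (comb (insert g A) c f) \<le> (2 * (cmod (c g))\<^sup>2 + 2 * K) * sqnorm G f" if f: "f \<in> l2 G" for f
  proof -
    have "comb (insert g A) c f = (\<lambda>x. c g * lr g f x + comb A c f x)"
      using insert by (simp add: comb_def)
    moreover have "sqnorm G (\<lambda>x. c g * lr g f x + comb A c f x) \<le>
        2 * sqnorm G (\<lambda>x. c g * lr g f x) + 2 * sqnorm G (comb A c f)"
      using insert f by (intro sqnorm_add_le l2_scale lr_l2 comb_l2) auto
    ultimately show ?thesis
      using bspec[OF K f] insert f by (simp add: sqnorm_scale lr_l2 algebra_simps)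
  qed
  then show ?case by blast
qed

lemma bfun_lr_form:
  assumes k: "k \<in> carrier G"
  shows "(\<lambda>\<xi>. Re (d * iprod G (lr k \<xi>) \<xi>)) \<in> bfun (l2sphere G)"
proof (rule bfunI)
  fix \<xi> assume "\<xi> \<in> l2sphere G"
  then have \<xi>: "\<xi> \<in> l2 G" "sqnorm G \<xi> = 1" by (auto simp: l2sphere_def)
  have "\<bar>Re (d * iprod G (lr k \<xi>) \<xi>)\<bar> \<le> cmod d * cmod (iprod G (lr k \<xi>) \<xi>)"
    using abs_Re_le_cmod[of "d * iprod G (lr k \<xi>) \<xi>"] by (simp add: norm_mult)
  also have "\<dots> \<le> cmod d * 1"
    using iprod_bound[OF lr_l2(1)[OF k \<xi>(1)] \<xi>(1), of 1] lr_l2(2)[OF k \<xi>(1)] \<xi>(2) by (intro mult_left_mono) auto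
  finally show "\<bar>Re (d * iprod G (lr k \<xi>) \<xi>)\<bar> \<le> cmod d * 1" .
qed

text \<open>Expanding the square gives coefficients of the translations by
  \<open>inv h \<otimes> g\<close>, and the mean kills all off-diagonal ones. It is used for the
  states built from an ideal and for evaluation at the point mass at 1, so that the two can be
  compared.\<close>

lemma mean_sqnorm_comb:
  assumes A: "finite A" "A \<subseteq> carrier G"
    and \<psi>: "mean (l2sphere G) \<psi>"
    and zero: "\<And>g h c. g \<in> A \<Longrightarrow> h \<in> A \<Longrightarrow> g \<noteq> h \<Longrightarrow> \<psi> (\<lambda>\<xi>. Re (c * iprod G (lr (inv h \<otimes> g) \<xi>) \<xi>)) = 0"
  shows "\<psi> (\<lambda>\<xi>. sqnorm G (comb A c \<xi>)) = (\<Sum>g\<in>A. (cmod (c g))\<^sup>2)"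
proof -
  define Q where "Q g h \<xi> = Re ((c g * cnj (c h)) * iprod G (lr (inv h \<otimes> g) \<xi>) \<xi>)" for g h \<xi>
  have Qb: "Q g h \<in> bfun (l2sphere G)" if "g \<in> A" "h \<in> A" for g h
    unfolding Q_def by (rule bfun_lr_form) (use that A in auto)
  have expand: "sqnorm G (comb A c \<xi>) = (\<Sum>g\<in>A. \<Sum>h\<in>A. Q g h \<xi>)" if "\<xi> \<in> l2sphere G" for \<xi>
  proof -
    have \<xi>: "\<xi> \<in> l2 G" using that by (simp add: l2sphere_def)
    have l: "lr g \<xi> \<in> l2 G" if "g \<in> A" for g using that A \<xi> by (auto intro: lr_l2)
    have "complex_of_real (sqnorm G (comb A c \<xi>)) = iprod G (comb A c \<xi>) (comb A c \<xi>)"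
      by (simp add: iprod_self comb_l2 A \<xi>)
    also have "\<dots> = (\<Sum>g\<in>A. iprod G (\<lambda>x. c g * lr g \<xi> x) (comb A c \<xi>))"
      unfolding comb_def[of A c \<xi>, THEN fun_cong, abs_def]
      by (intro iprod_sum_left l2_sum l2_scale l)
    also have "\<dots> = (\<Sum>g\<in>A. \<Sum>h\<in>A. (c g * cnj (c h)) * iprod G (lr g \<xi>) (lr h \<xi>))"
    proof (rule sum.cong[OF refl])
      fix g assume g: "g \<in> A"
      have "iprod G (\<lambda>x. c g * lr g \<xi> x) (comb A c \<xi>) = (\<Sum>h\<in>A. iprod G (\<lambda>x. c g * lr g \<xi> x) (\<lambda>x. c h * lr h \<xi> x))"
        unfolding comb_def by (intro iprod_sum_right l2_scale l g)
      then show "iprod G (\<lambda>x. c g * lr g \<xi> x) (comb A c \<xi>) = (\<Sum>h\<in>A. (c g * cnj (c h)) * iprod G (lr g \<xi>) (lr h \<xi>))"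
        by (simp add: iprod_scale_left iprod_scale_right mult.assoc)
    qed
    also have "\<dots> = (\<Sum>g\<in>A. \<Sum>h\<in>A. (c g * cnj (c h)) * iprod G (lr (inv h \<otimes> g) \<xi>) \<xi>)"
    proof (intro sum.cong refl arg_cong2[where f = "(*)"])
      fix g h assume gh: "g \<in> A" "h \<in> A"
      then have "g \<in> carrier G" "h \<in> carrier G" using A by auto
      then show "iprod G (lr g \<xi>) (lr h \<xi>) = iprod G (lr (inv h \<otimes> g) \<xi>) \<xi>"
        using iprod_lr_inv[of h "lr g \<xi>" \<xi>] l[OF gh(1)] \<xi> by (simp add: lr_mult)
    qed
    finally have "sqnorm G (comb A c \<xi>) = Re (\<Sum>g\<in>A. \<Sum>h\<in>A. (c g * cnj (c h)) * iprod G (lr (inv h \<otimes> g) \<xi>) \<xi>)"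
      by (metis Re_complex_of_real)
    then show ?thesis by (simp only: Re_sum Q_def)
  qed
  have \<psi>Q: "\<psi> (Q g h) = (if g = h then (cmod (c g))\<^sup>2 else 0)" if "g \<in> A" "h \<in> A" for g h
  proof (cases "g = h")
    case True
    have "g \<in> carrier G" using that A by auto
    then have "(cmod (c g))\<^sup>2 = Q g g \<xi>" if "\<xi> \<in> l2sphere G" for \<xi>
      using that by (simp add: Q_def l2sphere_def lr_one iprod_self complex_norm_square[symmetric] del: of_real_power)
    then have "\<psi> (\<lambda>_. (cmod (c g))\<^sup>2) = \<psi> (Q g g)"
      by (intro sublin_cong[OF mean_sublin[OF \<psi>] bfun_const])
    then show ?thesis using True mean_const[OF \<psi>] by simp
  next
    case False
    have "\<psi> (Q g h) = 0" unfolding Q_def by (rule zero[OF that False])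
    then show ?thesis using False by simp
  qed
  have "\<psi> (\<lambda>\<xi>. sqnorm G (comb A c \<xi>)) = \<psi> (\<lambda>\<xi>. \<Sum>g\<in>A. \<Sum>h\<in>A. Q g h \<xi>)"
    by (rule sublin_cong[OF mean_sublin[OF \<psi>], symmetric]) (use Qb expand in auto)
  also have "\<dots> = (\<Sum>g\<in>A. \<psi> (\<lambda>\<xi>. \<Sum>h\<in>A. Q g h \<xi>))"
    by (intro mean_sum[OF \<psi>] bfun_sum Qb)
  also have "\<dots> = (\<Sum>g\<in>A. \<Sum>h\<in>A. \<psi> (Q g h))"
    by (intro sum.cong refl mean_sum[OF \<psi>] Qb)
  also have "\<dots> = (\<Sum>g\<in>A. \<Sum>h\<in>A. if g = h then (cmod (c g))\<^sup>2 else 0)"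
    by (intro sum.cong refl \<psi>Q)
  also have "\<dots> = (\<Sum>g\<in>A. (cmod (c g))\<^sup>2)" using A by simp
  finally show ?thesis .
qed

end

section \<open>Ideals of the reduced C*-algebra\<close>

lemma
  assumes "closed_ideal_Cr G I" "T \<in> I"
  shows ideal_bdd: "bdd_op G T"
    and ideal_scale: "op_scale c T \<in> I"
    and ideal_add: "S \<in> I \<Longrightarrow> op_add S T \<in> I"
    and ideal_mult: "A \<in> reduced_Cstar G \<Longrightarrow> A \<circ> T \<in> I" "A \<in> reduced_Cstar G \<Longrightarrow> T \<circ> A \<in> I"
  using assms by (auto simp: closed_ideal_Cr_def reduced_Cstar_def)

lemma ideal_in_reduced: "closed_ideal_Cr G I \<Longrightarrow> T \<in> I \<Longrightarrow> T \<in> reduced_Cstar G"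
  by (auto simp: closed_ideal_Cr_def)

context group
begin

text \<open>For small \<open>e > 0\<close> the operator \<open>1 + e T\<close> is a strict contraction, so its powers, which are
  congruent to 1 modulo the ideal, tend to 0.\<close>

lemma ideal_contains_one:
  assumes I: "closed_ideal_Cr G I" and T: "T \<in> I"
    and le: "\<And>\<xi>. \<xi> \<in> l2sphere G \<Longrightarrow> Re (iprod G (T \<xi>) \<xi>) \<le> B" and B: "B < 0"
  shows "lr \<one> \<in> I"
proof -
  have Tb: "bdd_op G T" by (rule ideal_bdd[OF I T])
  obtain C0 where C0: "C0 > 0" "\<And>f. f \<in> l2 G \<Longrightarrow> sqnorm G (T f) \<le> C0 * sqnorm G f"
    using bdd_op_bound[OF Tb] by blast
  \<comment> \<open>Adding \<open>B\<^sup>2\<close> to the bound guarantees that the contraction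
    factor \<open>\<kappa>\<close> below is nonnegative.\<close>
  define C where "C = C0 + B\<^sup>2"
  have C: "C > 0" "B\<^sup>2 \<le> C" using C0(1) by (auto simp: C_def add_pos_nonneg)
  have TC: "sqnorm G (T f) \<le> C * sqnorm G f" if "f \<in> l2 G" for f
    using C0(2)[OF that] mult_right_mono[of C0 C "sqnorm G f"] by (simp add: C_def)
  \<comment> \<open>This \<open>e\<close> minimises \<open>e\<^sup>2 * C + 2 * e * B + 1\<close>,
    the bound for the squared norm of 1 + e T; the minimum is \<open>\<kappa>\<close>.\<close>
  define e where "e = - B / C"
  define \<kappa> where "\<kappa> = 1 - B\<^sup>2 / C"
  have e: "e > 0" using B C by (simp add: e_def divide_neg_pos)
  have \<kappa>: "0 \<le> \<kappa>" "\<kappa> < 1" using B C by (auto simp: \<kappa>_def)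
  define U where "U = op_scale (of_real e) T"
  have U: "U \<in> I" unfolding U_def by (rule ideal_scale[OF I T])
  have Ub: "bdd_op G U" by (rule ideal_bdd[OF I U])
  have TB: "Re (iprod G (T f) f) \<le> B * sqnorm G f" if f: "f \<in> l2 G" for f
  proof (cases "sqnorm G f = 0")
    case True
    then have "f = (\<lambda>_. 0)" using sqnorm_eq_0[OF f] by simp
    then show ?thesis using True by simp
  next
    case False
    define r where "r = sqrt (sqnorm G f)"
    have pos: "sqnorm G f > 0" using False sqnorm_nonneg[of G f] by linarith
    then have r: "r > 0" "r\<^sup>2 = sqnorm G f" by (auto simp: r_def)
    define \<xi> where "\<xi> = (\<lambda>x. of_real (1 / r) * f x)"
    have "sqnorm G \<xi> = (1 / r)\<^sup>2 * sqnorm G f" unfolding \<xi>_def sqnorm_scale using r by (simp add: norm_divide)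
    then have "sqnorm G \<xi> = 1" unfolding r(2)[symmetric] using r(1) by (simp add: power_divide)
    moreover have "\<xi> \<in> l2 G" unfolding \<xi>_def by (rule l2_scale[OF f])
    ultimately have "\<xi> \<in> l2sphere G" by (simp add: l2sphere_def)
    then have "Re (iprod G (T \<xi>) \<xi>) \<le> B" by (rule le)
    moreover have "iprod G (T \<xi>) \<xi> = of_real ((1 / r)\<^sup>2) * iprod G (T f) f"
      unfolding \<xi>_def bdd_op_scale[OF Tb f] iprod_scale_left iprod_scale_right
      by (simp add: power2_eq_square)
    ultimately have "Re (iprod G (T f) f) / r\<^sup>2 \<le> B" by (simp add: power_divide)
    then show ?thesis unfolding r(2) using pos by (simp add: divide_le_eq)
  qed
  have contract: "sqnorm G (\<lambda>x. U f x + f x) \<le> \<kappa> * sqnorm G f" if f: "f \<in> l2 G" for f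
  proof -
    have Uf: "U f = (\<lambda>x. of_real e * T f x)" by (simp add: U_def op_scale_def)
    have "sqnorm G (\<lambda>x. U f x + f x) = e\<^sup>2 * sqnorm G (T f) + 2 * (e * Re (iprod G (T f) f)) + sqnorm G f"
      using sqnorm_add[OF bdd_op_l2[OF Ub f] f] e
      unfolding Uf sqnorm_scale iprod_scale_left by simp
    also have "\<dots> \<le> e\<^sup>2 * (C * sqnorm G f) + 2 * (e * (B * sqnorm G f)) + sqnorm G f"
      using e by (intro add_mono mult_left_mono TC TB f) auto
    also have "\<dots> = (e\<^sup>2 * C + 2 * e * B + 1) * sqnorm G f" by (simp add: algebra_simps)
    also have "e\<^sup>2 * C + 2 * e * B + 1 = \<kappa>"
      using C by (simp add: e_def \<kappa>_def power2_eq_square field_simps)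
    finally show ?thesis .
  qed
  \<comment> \<open>The recursion is chosen so that 1 - J n = (1 + U)^n. Every summand contains
    \<open>U\<close>, so \<open>J n\<close> stays in the ideal.\<close>
  define J where "J = rec_nat op_zero (\<lambda>_ V. op_add (op_add V (op_scale (-1) U)) (U \<circ> V))"
  have J0: "J 0 = op_zero" and JS: "\<And>n. J (Suc n) = op_add (op_add (J n) (op_scale (-1) U)) (U \<circ> J n)"
    by (simp_all add: J_def)
  have J: "J n \<in> I" for n
  proof (induction n)
    case 0
    then show ?case using I by (simp add: J0 closed_ideal_Cr_def)
  next
    case (Suc n)
    then show ?case unfolding JS
      by (intro ideal_add[OF I] ideal_scale[OF I U] ideal_mult(1)[OF I] ideal_in_reduced[OF I U])
  qed
  have power: "sqnorm G (\<lambda>x. f x - J n f x) \<le> \<kappa> ^ n * sqnorm G f" if f: "f \<in> l2 G" for f n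
  proof (induction n)
    case 0
    then show ?case by (simp add: J0 op_zero_def)
  next
    case (Suc n)
    have Jf: "J n f \<in> l2 G" by (rule bdd_op_l2[OF ideal_bdd[OF I J] f])
    let ?R = "\<lambda>x. f x - J n f x"
    have R: "?R \<in> l2 G" by (rule l2_diff[OF f Jf])
    have "U (\<lambda>x. ?R x + J n f x) = (\<lambda>x. U ?R x + U (J n f) x)" by (rule bdd_op_add[OF Ub R Jf])
    then have "U f x = U ?R x + U (J n f) x" for x by (simp add: fun_eq_iff)
    then have "(\<lambda>x. f x - J (Suc n) f x) = (\<lambda>x. U ?R x + ?R x)"
      by (simp add: JS op_add_def op_scale_def fun_eq_iff)
    then have "sqnorm G (\<lambda>x. f x - J (Suc n) f x) \<le> \<kappa> * sqnorm G ?R" using contract[OF R] by simp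
    also have "\<dots> \<le> \<kappa> * (\<kappa> ^ n * sqnorm G f)" by (intro mult_left_mono Suc \<kappa>)
    finally show ?case by simp
  qed
  have "\<exists>S\<in>I. opnorm G (op_diff (lr \<one>) S) < \<epsilon>" if \<epsilon>: "\<epsilon> > 0" for \<epsilon>
  proof -
    obtain n where n: "\<kappa> ^ n < \<epsilon>\<^sup>2" using real_arch_pow_inv[of "\<epsilon>\<^sup>2" \<kappa>] \<epsilon> \<kappa> by auto
    have "opnorm G (op_diff (lr \<one>) (J n)) \<le> sqrt (\<kappa> ^ n)"
    proof (rule opnorm_le)
      fix f assume f: "f \<in> l2 G" "sqnorm G f \<le> 1"
      have "op_diff (lr \<one>) (J n) f = (\<lambda>x. f x - J n f x)" using f by (simp add: op_diff_def lr_one)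
      moreover have "\<kappa> ^ n * sqnorm G f \<le> \<kappa> ^ n" using f \<kappa> by (simp add: mult_left_le)
      ultimately show "l2norm G (op_diff (lr \<one>) (J n) f) \<le> sqrt (\<kappa> ^ n)"
        using power[OF f(1), of n] by (simp add: l2norm_sqnorm)
    qed
    also have "\<dots> < \<epsilon>" using n \<epsilon> by (simp add: real_less_rsqrt real_sqrt_less_iff real_less_lsqrt)
    finally show ?thesis using J by blast
  qed
  then show ?thesis using I lr_reduced_Cstar[OF one_closed] by (auto simp: closed_ideal_Cr_def)
qed

section \<open>States vanishing on a proper ideal\<close>

text \<open>The ideal is closed under negation, so a mean that is nonnegative on these forms
  vanishes on them.\<close>

definition ideal_forms :: "(('a \<Rightarrow> complex) \<Rightarrow> ('a \<Rightarrow> complex)) set \<Rightarrow> (('a \<Rightarrow> complex) \<Rightarrow> real) set" where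
  "ideal_forms I = (\<lambda>T \<xi>. Re (iprod G (T \<xi>) \<xi>)) ` I"

lemma bfun_form:
  assumes "bdd_op G T"
  shows "(\<lambda>\<xi>. Re (iprod G (T \<xi>) \<xi>)) \<in> bfun (l2sphere G)"
proof -
  obtain C where C: "C > 0" "\<And>f. f \<in> l2 G \<Longrightarrow> sqnorm G (T f) \<le> C * sqnorm G f"
    using bdd_op_bound[OF assms] by blast
  show ?thesis
  proof (rule bfunI)
    fix \<xi> assume "\<xi> \<in> l2sphere G"
    then have \<xi>: "\<xi> \<in> l2 G" "sqnorm G \<xi> = 1" by (auto simp: l2sphere_def)
    show "\<bar>Re (iprod G (T \<xi>) \<xi>)\<bar> \<le> (C + 1) / 2"
      using abs_Re_le_cmod[of "iprod G (T \<xi>) \<xi>"] iprod_bound[OF bdd_op_l2[OF assms \<xi>(1)] \<xi>(1), of 1]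
        C(2)[OF \<xi>(1)] \<xi>(2) by simp
  qed
qed

text \<open>Properness supplies the last cone condition: by \<open>ideal_contains_one\<close>, an
  element with uniformly negative form would put the identity into \<open>I\<close>.\<close>

lemma cone_on_ideal_forms:
  assumes I: "closed_ideal_Cr G I" and proper: "lr \<one> \<notin> I"
  shows "cone_on (l2sphere G) (ideal_forms I)"
  unfolding cone_on_def
proof (intro conjI ballI allI impI)
  note b = ideal_bdd[OF I]
  show "ideal_forms I \<subseteq> bfun (l2sphere G)" using bfun_form[OF b] by (auto simp: ideal_forms_def)
  have "op_zero \<in> I" using I by (simp add: closed_ideal_Cr_def)
  then show "(\<lambda>_. 0) \<in> ideal_forms I"
    unfolding ideal_forms_def by (rule rev_image_eqI) (simp add: op_zero_def)
next
  fix v w assume "v \<in> ideal_forms I" "w \<in> ideal_forms I"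
  then obtain S T where ST: "S \<in> I" "T \<in> I"
    and vw: "v = (\<lambda>\<xi>. Re (iprod G (S \<xi>) \<xi>))" "w = (\<lambda>\<xi>. Re (iprod G (T \<xi>) \<xi>))"
    by (auto simp: ideal_forms_def)
  have "v \<xi> + w \<xi> = Re (iprod G (op_add S T \<xi>) \<xi>)" for \<xi>
  proof (cases "\<xi> \<in> l2 G")
    case True
    then show ?thesis
      using iprod_add_left[OF bdd_op_l2[OF ideal_bdd[OF I ST(1)] True] bdd_op_l2[OF ideal_bdd[OF I ST(2)] True] True]
      by (simp add: vw op_add_def)
  next
    case False
    then show ?thesis
      using bdd_op_outside[OF ideal_bdd[OF I ST(1)] False] bdd_op_outside[OF ideal_bdd[OF I ST(2)] False]
      by (simp add: vw op_add_def)
  qed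
  then show "(\<lambda>\<xi>. v \<xi> + w \<xi>) \<in> ideal_forms I"
    unfolding ideal_forms_def using ideal_add[OF I ST(2,1)] by auto
next
  fix c :: real and w assume "w \<in> ideal_forms I"
  then obtain T where T: "T \<in> I" "w = (\<lambda>\<xi>. Re (iprod G (T \<xi>) \<xi>))" by (auto simp: ideal_forms_def)
  have "(\<lambda>\<xi>. c * w \<xi>) = (\<lambda>\<xi>. Re (iprod G (op_scale (of_real c) T \<xi>) \<xi>))"
    by (simp add: T op_scale_def iprod_scale_left)
  then show "(\<lambda>\<xi>. c * w \<xi>) \<in> ideal_forms I"
    unfolding ideal_forms_def using ideal_scale[OF I T(1)] by auto
next
  fix w B assume "w \<in> ideal_forms I" "\<forall>\<xi>\<in>l2sphere G. w \<xi> \<le> B"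
  then show "0 \<le> B" using ideal_contains_one[OF I _ _, of _ B] proper by (force simp: ideal_forms_def not_le)
qed

text \<open>The state constructed here is concentrated, along the orbit map, on a point with stabiliser
  \<^term>\<open>mean_stab m\<close>, and therefore kills the translations moving that point.\<close>

lemma state_vanishing_off_stab:
  assumes b: "boundary_point q m" and I: "closed_ideal_Cr G I" and proper: "lr \<one> \<notin> I"
  obtains \<psi> where "mean (l2sphere G) \<psi>" "\<And>T. T \<in> I \<Longrightarrow> \<psi> (\<lambda>\<xi>. Re (iprod G (T \<xi>) \<xi>)) = 0"
    "\<And>s c. s \<in> carrier G \<Longrightarrow> s \<notin> mean_stab m \<Longrightarrow> \<psi> (\<lambda>\<xi>. Re (c * iprod G (lr s \<xi>) \<xi>)) = 0"
proof -
  have m: "mean (carrier G) m" using b by (simp add: boundary_point_def)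
  obtain \<psi> where \<psi>: "mean (l2sphere G) \<psi>" and \<psi>I: "\<And>w. w \<in> ideal_forms I \<Longrightarrow> 0 \<le> \<psi> w"
    and conc: "\<And>f. f \<in> bfun (carrier G) \<Longrightarrow> \<psi> (sq_mean G (\<lambda>g. (orbit_fun m f g - m f)\<^sup>2)) = 0"
  proof (rule orbit_concentration[OF b cone_on_ideal_forms[OF I proper] mean_sq_mean])
    fix s w assume s: "s \<in> carrier G" and "w \<in> ideal_forms I"
    then obtain T where T: "T \<in> I" "w = (\<lambda>\<xi>. Re (iprod G (T \<xi>) \<xi>))" by (auto simp: ideal_forms_def)
    \<comment> \<open>Conjugation by translations preserves the ideal, and the form of
      \<open>T'\<close> at \<open>\<xi>\<close> is the form of \<open>T\<close> at
      \<open>lr s \<xi>\<close>. This is the invariance of the cone.\<close>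
    define T' where "T' = lr (inv s) \<circ> (T \<circ> lr s)"
    have "T' \<in> I" unfolding T'_def
      by (intro ideal_mult[OF I] T lr_reduced_Cstar inv_closed s)
    moreover have "iprod G (T' \<xi>) \<xi> = iprod G (T (lr s \<xi>)) (lr s \<xi>)" if "\<xi> \<in> l2 G" for \<xi>
      using iprod_lr_inv[OF s bdd_op_l2[OF ideal_bdd[OF I T(1)] lr_l2(1)[OF s that]] that]
      by (simp add: T'_def)
    ultimately show "\<exists>w'\<in>ideal_forms I. \<forall>f\<in>bfun (carrier G). \<forall>B.
        (\<forall>y\<in>l2sphere G. sq_mean G f y + w y \<le> B) \<longrightarrow>
        (\<forall>y\<in>l2sphere G. sq_mean G (\<lambda>x. f (s \<otimes> x)) y + w' y \<le> B)"
      unfolding T(2) ideal_forms_def using lr_sphere[OF s]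
      by (intro bexI[OF _ imageI]) (auto simp: sq_mean_shift[OF s] l2sphere_def)
  next
    fix \<psi> assume "mean (l2sphere G) \<psi>" "\<And>w. w \<in> ideal_forms I \<Longrightarrow> 0 \<le> \<psi> w"
      "\<And>f. f \<in> bfun (carrier G) \<Longrightarrow> \<psi> (sq_mean G (\<lambda>g. (orbit_fun m f g - m f)\<^sup>2)) = 0"
    then show thesis by (rule that)
  qed
  have zero_I: "\<psi> (\<lambda>\<xi>. Re (iprod G (T \<xi>) \<xi>)) = 0" if T: "T \<in> I" for T
  proof (rule antisym)
    have ge: "0 \<le> \<psi> (\<lambda>\<xi>. Re (iprod G (S \<xi>) \<xi>))" if "S \<in> I" for S
      using that by (intro \<psi>I) (auto simp: ideal_forms_def)
    show "0 \<le> \<psi> (\<lambda>\<xi>. Re (iprod G (T \<xi>) \<xi>))" by (rule ge[OF T])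
    have "(\<lambda>\<xi>. Re (iprod G (op_scale (-1) T \<xi>) \<xi>)) = (\<lambda>\<xi>. - Re (iprod G (T \<xi>) \<xi>))"
      using iprod_scale_left[of G "-1"] by (simp add: op_scale_def)
    then show "\<psi> (\<lambda>\<xi>. Re (iprod G (T \<xi>) \<xi>)) \<le> 0"
      using ge[OF ideal_scale[OF I T, of "-1"]] mean_uminus[OF \<psi> bfun_form[OF ideal_bdd[OF I T]]] by simp
  qed
  \<comment> \<open>An upper bound for all \<open>c\<close> suffices, since replacing
    \<open>c\<close> by \<open>-c\<close> gives the lower one.\<close>
  have zero_s: "\<psi> (\<lambda>\<xi>. Re (c * iprod G (lr s \<xi>) \<xi>)) \<le> 0"
    if s: "s \<in> carrier G" and "s \<notin> mean_stab m" for s c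
  proof -
    have "\<exists>f\<in>bfun (carrier G). m (\<lambda>x. f (s \<otimes> x)) \<noteq> m f"
      using that by (auto simp: mean_stab_def)
    then obtain f where "f \<in> bfun (carrier G) \<and> m (\<lambda>x. f (s \<otimes> x)) \<noteq> m f"
      unfolding Bex_def ..
    then have f: "f \<in> bfun (carrier G)" and ne: "m (\<lambda>x. f (s \<otimes> x)) \<noteq> m f" by simp_all
    define f' where "f' = (\<lambda>x. f (s \<otimes> x))"
    have f': "f' \<in> bfun (carrier G)" unfolding f'_def by (rule bfun_shift[OF f s])
    define k where "k x = orbit_fun m f x - m f" for x
    define k' where "k' x = orbit_fun m f' x - m f'" for x
    have kb: "k \<in> bfun (carrier G)" "k' \<in> bfun (carrier G)"
      unfolding k_def k'_def by (intro bfun_diff bfun_const bfun_orbit_fun[OF m] f f')+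
    define V where "V = sq_mean G (\<lambda>x. (k x)\<^sup>2)"
    define V' where "V' = sq_mean G (\<lambda>x. (k' x)\<^sup>2)"
    have V0: "\<psi> V = 0" "\<psi> V' = 0" unfolding V_def V'_def k_def k'_def by (rule conc[OF f], rule conc[OF f'])
    have Vb: "V \<in> bfun (l2sphere G)" "V' \<in> bfun (l2sphere G)"
      unfolding V_def V'_def
      by (rule bfun_compose[OF mean_sublin[OF mean_sq_mean] bfun_power2[OF kb(1)]],
          assumption, rule bfun_compose[OF mean_sublin[OF mean_sq_mean] bfun_power2[OF kb(2)]])
    define a where "a = m f' - m f"
    have a: "a \<noteq> 0" using ne by (simp add: a_def f'_def)
    \<comment> \<open>The orbit function of \<open>f\<close> is nearly \<open>m f\<close> on
      \<open>\<xi>\<close> and nearly \<open>m f'\<close> on \<open>lr s \<xi>\<close>, with squared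
      errors \<open>V \<xi>\<close> and \<open>V' \<xi>\<close>. Moving it across the inner product
      makes the two vectors nearly orthogonal, as the values differ by \<open>a\<close>.\<close>
    have bound: "\<bar>a\<bar> * cmod (iprod G (lr s \<xi>) \<xi>) \<le> \<delta> + 1 / (2 * \<delta>) * (V \<xi> + V' \<xi>)"
      if \<delta>: "\<delta> > 0" and \<xi>S: "\<xi> \<in> l2sphere G" for \<delta> \<xi>
    proof -
      have \<xi>: "\<xi> \<in> l2 G" "sqnorm G \<xi> = 1" using \<xi>S by (auto simp: l2sphere_def)
      note l\<xi> = lr_l2[OF s \<xi>(1)]
      define u where "u = (\<lambda>x. of_real (k x) * \<xi> x)"
      define k'' where "k'' x = orbit_fun m f x - m f'" for x
      have k''b: "k'' \<in> bfun (carrier G)"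
        unfolding k''_def by (intro bfun_diff bfun_const bfun_orbit_fun[OF m] f)
      define v where "v = (\<lambda>x. of_real (k'' x) * lr s \<xi> x)"
      have uv: "u \<in> l2 G" "v \<in> l2 G"
        unfolding u_def v_def using l2_bfun_mult[OF \<xi>(1) kb(1)] l2_bfun_mult[OF l\<xi>(1) k''b] .
      have "sqnorm G v = sq_mean G (\<lambda>x. (k'' x)\<^sup>2) (lr s \<xi>)"
        unfolding v_def by (rule sq_mean_power2[symmetric])
      also have "\<dots> = sq_mean G (\<lambda>x. (k'' (s \<otimes> x))\<^sup>2) \<xi>" by (rule sq_mean_shift[OF s \<xi>(1), symmetric])
      also have "\<dots> = V' \<xi>"
        unfolding V'_def sq_mean_def k'_def k''_def f'_def
        by (rule infsum_cong) (simp add: orbit_fun_shift[OF m f s])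
      finally have v: "sqnorm G v = V' \<xi>" .
      have u: "sqnorm G u = V \<xi>" unfolding u_def V_def by (rule sq_mean_power2[symmetric])
      have "of_real a * iprod G (lr s \<xi>) \<xi> = iprod G (lr s \<xi>) u - iprod G v \<xi>"
      proof -
        have "iprod G v \<xi> = infsum (\<lambda>x. lr s \<xi> x * cnj (u x) + (- of_real a) * (lr s \<xi> x * cnj (\<xi> x))) (carrier G)"
          unfolding iprod_def
          by (rule infsum_cong) (simp add: u_def v_def k_def k''_def a_def algebra_simps)
        also have "\<dots> = iprod G (lr s \<xi>) u + (- of_real a) * iprod G (lr s \<xi>) \<xi>"
          unfolding iprod_def infsum_cmult_right'[symmetric]
          by (intro infsum_add summable_on_cmult_right iprod_summable l\<xi> \<xi> uv)
        finally show ?thesis by simp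
      qed
      then have "\<bar>a\<bar> * cmod (iprod G (lr s \<xi>) \<xi>) = cmod (iprod G (lr s \<xi>) u - iprod G v \<xi>)"
        by (metis norm_mult norm_of_real real_norm_def)
      also have "\<dots> \<le> cmod (iprod G (lr s \<xi>) u) + cmod (iprod G v \<xi>)" by (rule norm_triangle_ineq4)
      also have "\<dots> \<le> (\<delta> * sqnorm G (lr s \<xi>) + sqnorm G u / \<delta>) / 2 + (1 / \<delta> * sqnorm G v + sqnorm G \<xi> / (1 / \<delta>)) / 2"
        using \<delta> by (intro add_mono iprod_bound uv l\<xi> \<xi>) auto
      also have "\<dots> = \<delta> + 1 / (2 * \<delta>) * (V \<xi> + V' \<xi>)"
        using \<delta> by (simp add: l\<xi> \<xi> u v field_simps)
      finally show ?thesis .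
    qed
    define w where "w \<xi> = Re (c * iprod G (lr s \<xi>) \<xi>)" for \<xi>
    have wb: "w \<in> bfun (l2sphere G)" unfolding w_def by (rule bfun_lr_form[OF s])
    have le: "\<bar>a\<bar> * \<psi> w \<le> cmod c * \<delta>" if \<delta>: "\<delta> > 0" for \<delta>
    proof -
      let ?d = "cmod c * (1 / (2 * \<delta>))"
      have VV: "(\<lambda>\<xi>. V \<xi> + V' \<xi>) \<in> bfun (l2sphere G)" by (intro bfun_add Vb)
      have "\<bar>a\<bar> * \<psi> w = \<psi> (\<lambda>\<xi>. \<bar>a\<bar> * w \<xi>)" by (rule mean_scale[OF \<psi> wb, symmetric])
      also have "\<dots> \<le> \<psi> (\<lambda>\<xi>. cmod c * \<delta> + ?d * (V \<xi> + V' \<xi>))"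
      proof (rule sublin_mono[OF mean_sublin[OF \<psi>]])
        fix \<xi> assume "\<xi> \<in> l2sphere G"
        have "w \<xi> \<le> cmod c * cmod (iprod G (lr s \<xi>) \<xi>)"
          unfolding w_def using complex_Re_le_cmod[of "c * iprod G (lr s \<xi>) \<xi>"] by (simp only: norm_mult)
        then have "\<bar>a\<bar> * w \<xi> \<le> cmod c * (\<bar>a\<bar> * cmod (iprod G (lr s \<xi>) \<xi>))"
          using mult_left_mono[of "w \<xi>" _ "\<bar>a\<bar>"] by (simp only: mult.left_commute abs_ge_zero)
        also have "\<dots> \<le> cmod c * (\<delta> + 1 / (2 * \<delta>) * (V \<xi> + V' \<xi>))"
          by (rule mult_left_mono[OF bound[OF \<delta> \<open>\<xi> \<in> _\<close>]]) simp
        finally show "\<bar>a\<bar> * w \<xi> \<le> cmod c * \<delta> + ?d * (V \<xi> + V' \<xi>)"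
          by (simp only: distrib_left mult.assoc)
      qed (intro bfun_add bfun_mult bfun_const wb VV)+
      also have "\<dots> = cmod c * \<delta> + ?d * \<psi> (\<lambda>\<xi>. V \<xi> + V' \<xi>)"
        using mean_add[OF \<psi> bfun_const bfun_mult[OF bfun_const VV], of "cmod c * \<delta>" ?d]
          mean_scale[OF \<psi> VV, of ?d] mean_const[OF \<psi>] by simp
      also have "\<psi> (\<lambda>\<xi>. V \<xi> + V' \<xi>) = 0" using mean_add[OF \<psi> Vb] V0 by simp
      finally show ?thesis by simp
    qed
    have "\<bar>a\<bar> * \<psi> w \<le> 0"
    proof (rule field_le_epsilon)
      fix e :: real assume e: "0 < e"
      \<comment> \<open>The denominator \<open>cmod c + 1\<close> covers
        \<open>c = 0\<close>.\<close>
      have "\<bar>a\<bar> * \<psi> w \<le> cmod c * (e / (cmod c + 1))"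
        by (rule le) (use e in \<open>simp add: add_nonneg_pos\<close>)
      also have "\<dots> \<le> e"
      proof -
        have "cmod c + 1 > 0" by (simp add: add_nonneg_pos)
        then show ?thesis using e by (simp add: divide_le_eq distrib_left mult.commute)
      qed
      finally show "\<bar>a\<bar> * \<psi> w \<le> 0 + e" by simp
    qed
    then have "\<psi> w \<le> 0" using a by (simp add: mult_le_0_iff)
    then show ?thesis unfolding w_def .
  qed
  show ?thesis
  proof (rule that[OF \<psi> zero_I])
    fix s c assume s: "s \<in> carrier G" "s \<notin> mean_stab m"
    define w where "w \<xi> = Re (c * iprod G (lr s \<xi>) \<xi>)" for \<xi>
    have "\<psi> w \<le> 0" unfolding w_def by (rule zero_s[OF s])
    moreover have "\<psi> (\<lambda>\<xi>. - w \<xi>) \<le> 0" using zero_s[OF s, of "-c"] by (simp add: w_def)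
    moreover have "w \<in> bfun (l2sphere G)" unfolding w_def by (rule bfun_lr_form[OF s(1)])
    ultimately show "\<psi> (\<lambda>\<xi>. Re (c * iprod G (lr s \<xi>) \<xi>)) = 0"
      using mean_uminus[OF \<psi>, of w] unfolding w_def[symmetric] by simp
  qed
qed

text \<open>Translating vectors by \<open>g\<close> conjugates the state: its value at the
  translation by \<open>s\<close> becomes the old value at that by
  \<open>inv g \<otimes> s \<otimes> g\<close>. The ideal is unaffected, and the stabiliser is
  replaced by its conjugate by \<open>g\<close>.\<close>

lemma state_avoiding:
  assumes b: "boundary_point q m" and I: "closed_ideal_Cr G I" and proper: "lr \<one> \<notin> I"
    and g: "g \<in> carrier G" and S: "S \<subseteq> carrier G" "\<And>s. s \<in> S \<Longrightarrow> inv g \<otimes> s \<otimes> g \<notin> mean_stab m"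
  obtains \<psi> where "mean (l2sphere G) \<psi>" "\<And>T. T \<in> I \<Longrightarrow> \<psi> (\<lambda>\<xi>. Re (iprod G (T \<xi>) \<xi>)) = 0"
    "\<And>s c. s \<in> S \<Longrightarrow> \<psi> (\<lambda>\<xi>. Re (c * iprod G (lr s \<xi>) \<xi>)) = 0"
proof -
  obtain \<psi> where \<psi>: "mean (l2sphere G) \<psi>" and zI: "\<And>T. T \<in> I \<Longrightarrow> \<psi> (\<lambda>\<xi>. Re (iprod G (T \<xi>) \<xi>)) = 0"
    and zs: "\<And>s c. s \<in> carrier G \<Longrightarrow> s \<notin> mean_stab m \<Longrightarrow> \<psi> (\<lambda>\<xi>. Re (c * iprod G (lr s \<xi>) \<xi>)) = 0"
  proof (rule state_vanishing_off_stab[OF b I proper])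
    fix \<psi> assume "mean (l2sphere G) \<psi>" "\<And>T. T \<in> I \<Longrightarrow> \<psi> (\<lambda>\<xi>. Re (iprod G (T \<xi>) \<xi>)) = 0"
      "\<And>s c. s \<in> carrier G \<Longrightarrow> s \<notin> mean_stab m \<Longrightarrow> \<psi> (\<lambda>\<xi>. Re (c * iprod G (lr s \<xi>) \<xi>)) = 0"
    then show thesis by (rule that)
  qed
  have conj: "iprod G (lr (inv g) (T (lr g \<xi>))) \<xi> = iprod G (T (lr g \<xi>)) (lr g \<xi>)"
    if "bdd_op G T" "\<xi> \<in> l2sphere G" for T \<xi>
  proof -
    have \<xi>: "\<xi> \<in> l2 G" using that by (simp add: l2sphere_def)
    show ?thesis by (rule iprod_lr_inv[OF g bdd_op_l2[OF that(1) lr_l2(1)[OF g \<xi>]] \<xi>])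
  qed
  show ?thesis
  proof (rule that)
    show "mean (l2sphere G) (\<lambda>k. \<psi> (\<lambda>\<xi>. k (lr g \<xi>)))"
      by (rule mean_compose[OF \<psi>]) (rule mean_eval[OF lr_sphere[OF g]])
  next
    fix T assume T: "T \<in> I"
    have T': "lr (inv g) \<circ> (T \<circ> lr g) \<in> I"
      by (intro ideal_mult[OF I] T lr_reduced_Cstar inv_closed g)
    have "\<psi> (\<lambda>\<xi>. Re (iprod G ((lr (inv g) \<circ> (T \<circ> lr g)) \<xi>) \<xi>)) = \<psi> (\<lambda>\<xi>. Re (iprod G (T (lr g \<xi>)) (lr g \<xi>)))"
      by (rule sublin_cong[OF mean_sublin[OF \<psi>] bfun_form[OF ideal_bdd[OF I T']]])
        (simp add: conj[OF ideal_bdd[OF I T]])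
    then show "\<psi> (\<lambda>\<xi>. Re (iprod G (T (lr g \<xi>)) (lr g \<xi>))) = 0" using zI[OF T'] by simp
  next
    fix s c assume s: "s \<in> S"
    then have sG: "s \<in> carrier G" using S by auto
    have tG: "inv g \<otimes> s \<otimes> g \<in> carrier G" using sG g by simp
    have "\<psi> (\<lambda>\<xi>. Re (c * iprod G (lr (inv g \<otimes> s \<otimes> g) \<xi>) \<xi>)) = \<psi> (\<lambda>\<xi>. Re (c * iprod G (lr s (lr g \<xi>)) (lr g \<xi>)))"
    proof (rule sublin_cong[OF mean_sublin[OF \<psi>] bfun_lr_form[OF tG]])
      fix \<xi> assume \<xi>: "\<xi> \<in> l2sphere G"
      then have "\<xi> \<in> l2 G" by (simp add: l2sphere_def)
      then have "lr (inv g \<otimes> s \<otimes> g) \<xi> = lr (inv g) (lr s (lr g \<xi>))"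
        using g sG by (simp add: lr_mult lr_l2 m_assoc)
      then show "Re (c * iprod G (lr (inv g \<otimes> s \<otimes> g) \<xi>) \<xi>) = Re (c * iprod G (lr s (lr g \<xi>)) (lr g \<xi>))"
        using conj[OF bdd_op_lr[OF sG] \<xi>] by simp
    qed
    then show "\<psi> (\<lambda>\<xi>. Re (c * iprod G (lr s (lr g \<xi>)) (lr g \<xi>))) = 0"
      using zs[OF tG S(2)[OF s], of c] by simp
  qed
qed

section \<open>Faithfulness of the trace\<close>

definition delta :: "'a \<Rightarrow> 'a \<Rightarrow> complex" where
  "delta g = (\<lambda>x. if x = g then 1 else 0)"

lemma delta_sphere:
  assumes "g \<in> carrier G"
  shows "delta g \<in> l2sphere G"
proof -
  have "((\<lambda>x. (cmod (delta g x))\<^sup>2) has_sum 1) (carrier G)"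
    by (rule has_sum_finite_neutralI[of "{g}"]) (use assms in \<open>auto simp: delta_def\<close>)
  then show ?thesis using assms by (auto simp: l2sphere_def l2_def sqnorm_def delta_def has_sum_iff)
qed

lemma delta_l2: "g \<in> carrier G \<Longrightarrow> delta g \<in> l2 G"
  using delta_sphere by (simp add: l2sphere_def)

lemma lr_delta:
  assumes "g \<in> carrier G"
  shows "lr g (delta \<one>) = delta g"
proof
  fix x
  have "inv g \<otimes> x = \<one> \<longleftrightarrow> x = g" if "x \<in> carrier G"
    using assms that inv_solve_left'[of \<one> g x] by auto
  then show "lr g (delta \<one>) x = delta g x"
    using assms lr_apply[OF delta_l2[OF one_closed], of x g]
    by (cases "x \<in> carrier G") (auto simp: lr_outside delta_def[of g] delta_def[of \<one>, THEN fun_cong])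
qed

lemma iprod_delta: "g \<noteq> h \<Longrightarrow> iprod G (delta g) (delta h) = 0"
  unfolding iprod_def by (rule infsum_0) (auto simp: delta_def)

text \<open>Evaluation at \<open>delta \<one>\<close> is itself a mean on the sphere, and it
  vanishes at every nontrivial translation.\<close>

lemma sqnorm_comb_delta:
  assumes A: "finite A" "A \<subseteq> carrier G"
  shows "sqnorm G (comb A c (delta \<one>)) = (\<Sum>g\<in>A. (cmod (c g))\<^sup>2)"
proof (rule mean_sqnorm_comb[OF A mean_eval[OF delta_sphere[OF one_closed]]])
  fix g h and d :: complex assume gh: "g \<in> A" "h \<in> A" "g \<noteq> h"
  then have G: "g \<in> carrier G" "h \<in> carrier G" using A by auto
  have "inv h \<otimes> g \<noteq> \<one>" using G gh(3) inv_cancel[of h g] by auto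
  then show "Re (d * iprod G (lr (inv h \<otimes> g) (delta \<one>)) (delta \<one>)) = 0"
    using G by (simp add: lr_delta iprod_delta)
qed

text \<open>Approximate \<open>T\<close> by \<open>S\<close> in the group algebra and choose a state
  that vanishes on \<open>I\<close> and on the off-diagonal part of S* S. It takes the value of the
  trace at S* S and 0 at S* T, which lies in \<open>I\<close>. Since \<open>T\<close> and
  \<open>S\<close> are close, the trace of S* S is small.\<close>

lemma ideal_kills_delta_one:
  assumes b: "boundary_point q m" and I: "closed_ideal_Cr G I" and proper: "lr \<one> \<notin> I"
    and avoid: "\<And>S. finite S \<Longrightarrow> S \<subseteq> carrier G \<Longrightarrow> \<one> \<notin> S \<Longrightarrow>
      \<exists>g\<in>carrier G. \<forall>s\<in>S. inv g \<otimes> s \<otimes> g \<notin> mean_stab m"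
    and T: "T \<in> I"
  shows "T (delta \<one>) = (\<lambda>_. 0)"
proof -
  have Tb: "bdd_op G T" by (rule ideal_bdd[OF I T])
  obtain C where C: "\<And>f. f \<in> l2 G \<Longrightarrow> sqnorm G (T f) \<le> C * sqnorm G f"
    using bdd_op_bound[OF Tb] by blast
  \<comment> \<open>The bound comes from 2 * eps^2 + 2 * eps, where eps <= 1.\<close>
  have small: "sqnorm G (T (delta \<one>)) \<le> 4 * \<epsilon>" if \<epsilon>: "0 < \<epsilon>" "\<epsilon> \<le> 1" for \<epsilon>
  proof -
    obtain S where S: "S \<in> group_algebra_ops G" "opnorm G (op_diff T S) < \<epsilon>"
      using ideal_in_reduced[OF I T] \<epsilon> by (auto simp: reduced_Cstar_def)
    then obtain A c where A: "finite A" "A \<subseteq> carrier G" and SA: "S = (\<lambda>f x. \<Sum>g\<in>A. c g * lr g f x)"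
      by (auto simp: group_algebra_ops_def)
    have Sc: "S f = comb A c f" for f by (simp add: SA comb_def)
    have Sl: "S f \<in> l2 G" if "f \<in> l2 G" for f using comb_l2[OF A(2) that] by (simp add: Sc)
    obtain K where K: "\<And>f. f \<in> l2 G \<Longrightarrow> sqnorm G (S f) \<le> K * sqnorm G f"
      using comb_bound[OF A, of c] by (auto simp: Sc)
    have dist: "sqnorm G (op_diff T S \<xi>) \<le> \<epsilon>\<^sup>2" if \<xi>: "\<xi> \<in> l2sphere G" for \<xi>
    proof -
      have "sqnorm G (op_diff T S f) \<le> (2 * C + 2 * K) * sqnorm G f" if f: "f \<in> l2 G" for f
        unfolding op_diff_def using sqnorm_diff_le[OF bdd_op_l2[OF Tb f] Sl[OF f]] C[OF f] K[OF f]
        by (simp add: algebra_simps)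
      then have "l2norm G (op_diff T S \<xi>) \<le> opnorm G (op_diff T S)"
        by (rule l2norm_le_opnorm) (use \<xi> in \<open>auto simp: l2sphere_def\<close>)
      then have "(l2norm G (op_diff T S \<xi>))\<^sup>2 \<le> \<epsilon>\<^sup>2" using S(2) by (intro power_mono) (auto simp: l2norm_sqnorm)
      then show ?thesis by (simp add: l2norm_power2)
    qed
    \<comment> \<open>The nontrivial group elements occurring in S* S.\<close>
    define F where "F = (\<lambda>(g, h). inv h \<otimes> g) ` {(g, h). g \<in> A \<and> h \<in> A \<and> g \<noteq> h}"
    have "finite F" unfolding F_def
      by (rule finite_imageI, rule finite_subset[of _ "A \<times> A"]) (use A in auto)
    moreover have FG: "F \<subseteq> carrier G" using A by (auto simp: F_def)
    moreover have "\<one> \<notin> F"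
    proof
      assume "\<one> \<in> F"
      then obtain g h where gh: "g \<in> A" "h \<in> A" "g \<noteq> h" "\<one> = inv h \<otimes> g" by (auto simp: F_def)
      then have G: "g \<in> carrier G" "h \<in> carrier G" using A by auto
      show False using inv_cancel[OF G(2,1)] gh(3) gh(4)[symmetric] G by simp
    qed
    ultimately obtain g0 where g0: "g0 \<in> carrier G" "\<And>s. s \<in> F \<Longrightarrow> inv g0 \<otimes> s \<otimes> g0 \<notin> mean_stab m"
      using avoid[of F] by blast
    obtain \<psi> where \<psi>: "mean (l2sphere G) \<psi>" and zI: "\<And>T. T \<in> I \<Longrightarrow> \<psi> (\<lambda>\<xi>. Re (iprod G (T \<xi>) \<xi>)) = 0"
      and zF: "\<And>s c. s \<in> F \<Longrightarrow> \<psi> (\<lambda>\<xi>. Re (c * iprod G (lr s \<xi>) \<xi>)) = 0"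
    proof (rule state_avoiding[OF b I proper g0(1) FG g0(2)])
      fix \<psi> assume "mean (l2sphere G) \<psi>" "\<And>T. T \<in> I \<Longrightarrow> \<psi> (\<lambda>\<xi>. Re (iprod G (T \<xi>) \<xi>)) = 0"
        "\<And>s c. s \<in> F \<Longrightarrow> \<psi> (\<lambda>\<xi>. Re (c * iprod G (lr s \<xi>) \<xi>)) = 0"
      then show thesis by (rule that)
    qed
    have tr: "\<psi> (\<lambda>\<xi>. sqnorm G (S \<xi>)) = (\<Sum>g\<in>A. (cmod (c g))\<^sup>2)"
      unfolding Sc by (rule mean_sqnorm_comb[OF A \<psi>]) (rule zF, auto simp: F_def)
    \<comment> \<open>The summands of S* T, each of which lies in the ideal.\<close>
    define R where "R h = op_scale (cnj (c h)) (lr (inv h) \<circ> T)" for h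
    have R: "R h \<in> I" if "h \<in> A" for h
      unfolding R_def using that A by (intro ideal_scale[OF I] ideal_mult[OF I T] lr_reduced_Cstar inv_closed) auto
    have Rb: "(\<lambda>\<xi>. Re (iprod G (R h \<xi>) \<xi>)) \<in> bfun (l2sphere G)" if "h \<in> A" for h
      by (rule bfun_form[OF ideal_bdd[OF I R[OF that]]])
    have RT: "(\<Sum>h\<in>A. Re (iprod G (R h \<xi>) \<xi>)) = Re (iprod G (T \<xi>) (S \<xi>))" if "\<xi> \<in> l2 G" for \<xi>
    proof -
      have T\<xi>: "T \<xi> \<in> l2 G" by (rule bdd_op_l2[OF Tb that])
      have "iprod G (T \<xi>) (S \<xi>) = (\<Sum>h\<in>A. iprod G (T \<xi>) (\<lambda>x. c h * lr h \<xi> x))"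
        unfolding SA using that A by (intro iprod_sum_right T\<xi> l2_scale lr_l2) auto
      also have "\<dots> = (\<Sum>h\<in>A. iprod G (R h \<xi>) \<xi>)"
      proof (rule sum.cong[OF refl])
        fix h assume "h \<in> A"
        then have "h \<in> carrier G" using A by auto
        then show "iprod G (T \<xi>) (\<lambda>x. c h * lr h \<xi> x) = iprod G (R h \<xi>) \<xi>"
          using iprod_lr_inv[OF _ T\<xi> that] by (simp add: R_def op_scale_def iprod_scale_left iprod_scale_right)
      qed
      finally show ?thesis by (simp add: Re_sum)
    qed
    have "\<psi> (\<lambda>\<xi>. sqnorm G (S \<xi>)) \<le> \<psi> (\<lambda>\<xi>. 2 * (\<Sum>h\<in>A. Re (iprod G (R h \<xi>) \<xi>)) + \<epsilon>)"
    proof (rule sublin_mono[OF mean_sublin[OF \<psi>]])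
      show "(\<lambda>\<xi>. sqnorm G (S \<xi>)) \<in> bfun (l2sphere G)"
        by (rule bfunI[of _ _ K]) (use K in \<open>force simp: l2sphere_def\<close>)
      show "(\<lambda>\<xi>. 2 * (\<Sum>h\<in>A. Re (iprod G (R h \<xi>) \<xi>)) + \<epsilon>) \<in> bfun (l2sphere G)"
        by (intro bfun_add bfun_mult bfun_const bfun_sum Rb)
      fix \<xi> assume \<xi>S: "\<xi> \<in> l2sphere G"
      then have \<xi>: "\<xi> \<in> l2 G" "sqnorm G \<xi> = 1" by (auto simp: l2sphere_def)
      define u where "u = op_diff T S \<xi>"
      have u: "u \<in> l2 G" unfolding u_def op_diff_def by (rule l2_diff[OF bdd_op_l2[OF Tb \<xi>(1)] Sl[OF \<xi>(1)]])
      have "T \<xi> = (\<lambda>x. u x + S \<xi> x)" by (simp add: u_def op_diff_def)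
      then have "iprod G (T \<xi>) (S \<xi>) = iprod G u (S \<xi>) + of_real (sqnorm G (S \<xi>))"
        using iprod_add_left[OF u Sl[OF \<xi>(1)] Sl[OF \<xi>(1)]] iprod_self[OF Sl[OF \<xi>(1)]] by simp
      then have 1: "Re (iprod G (T \<xi>) (S \<xi>)) = Re (iprod G u (S \<xi>)) + sqnorm G (S \<xi>)" by simp
      \<comment> \<open>The weight \<open>1 / \<epsilon>\<close> balances the estimate:
        \<open>u\<close> contributes at most half of \<open>\<epsilon>\<close>, and half of the
        squared norm of \<open>S \<xi>\<close> can be absorbed on the left.\<close>
      have "cmod (iprod G u (S \<xi>)) \<le> (1 / \<epsilon> * sqnorm G u + sqnorm G (S \<xi>) / (1 / \<epsilon>)) / 2"
        by (rule iprod_bound[OF u Sl[OF \<xi>(1)]]) (use \<epsilon> in simp)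
      also have "\<dots> \<le> (1 / \<epsilon> * \<epsilon>\<^sup>2 + sqnorm G (S \<xi>) / (1 / \<epsilon>)) / 2"
        using dist[OF \<xi>S] \<epsilon> by (intro divide_right_mono add_right_mono mult_left_mono) (auto simp: u_def)
      also have "\<dots> = (\<epsilon> + \<epsilon> * sqnorm G (S \<xi>)) / 2" using \<epsilon> by (simp add: power2_eq_square)
      also have "\<dots> \<le> (\<epsilon> + 1 * sqnorm G (S \<xi>)) / 2"
        using \<epsilon> by (intro divide_right_mono add_left_mono mult_right_mono) auto
      finally have "- Re (iprod G u (S \<xi>)) \<le> (\<epsilon> + sqnorm G (S \<xi>)) / 2"
        using abs_Re_le_cmod[of "iprod G u (S \<xi>)"] by simp
      then have "sqnorm G (S \<xi>) \<le> 2 * Re (iprod G (T \<xi>) (S \<xi>)) + \<epsilon>"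
        unfolding 1 by (simp add: field_simps)
      then show "sqnorm G (S \<xi>) \<le> 2 * (\<Sum>h\<in>A. Re (iprod G (R h \<xi>) \<xi>)) + \<epsilon>"
        by (simp only: RT[OF \<xi>(1)])
    qed
    also have "\<dots> = 2 * \<psi> (\<lambda>\<xi>. \<Sum>h\<in>A. Re (iprod G (R h \<xi>) \<xi>)) + \<epsilon>"
      using mean_add[OF \<psi> bfun_mult[OF bfun_const bfun_sum[OF Rb]] bfun_const, of A "\<lambda>h. h" "2" \<epsilon>]
        mean_scale[OF \<psi> bfun_sum[OF Rb], of A "\<lambda>h. h" "2"] mean_const[OF \<psi>] by simp
    also have "\<psi> (\<lambda>\<xi>. \<Sum>h\<in>A. Re (iprod G (R h \<xi>) \<xi>)) = 0"
      using mean_sum[OF \<psi> Rb, of A "\<lambda>h. h"] zI[OF R] by simp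
    finally have "sqnorm G (S (delta \<one>)) \<le> \<epsilon>"
      unfolding tr using sqnorm_comb_delta[OF A, of c] by (simp add: Sc)
    moreover have "sqnorm G (op_diff T S (delta \<one>)) \<le> \<epsilon>\<^sup>2" by (rule dist[OF delta_sphere[OF one_closed]])
    moreover have "sqnorm G (T (delta \<one>)) \<le> 2 * sqnorm G (op_diff T S (delta \<one>)) + 2 * sqnorm G (S (delta \<one>))"
    proof -
      have d: "delta \<one> \<in> l2 G" by (rule delta_l2[OF one_closed])
      have "op_diff T S (delta \<one>) \<in> l2 G"
        unfolding op_diff_def by (rule l2_diff[OF bdd_op_l2[OF Tb d] Sl[OF d]])
      from sqnorm_add_le[OF this Sl[OF d]] show ?thesis by (simp add: op_diff_def)
    qed
    moreover have "\<epsilon>\<^sup>2 \<le> \<epsilon>" using \<epsilon> by (simp add: power2_eq_square mult_left_le)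
    ultimately show ?thesis by simp
  qed
  have "sqnorm G (T (delta \<one>)) \<le> 0"
  proof (rule field_le_epsilon)
    fix e :: real assume e: "0 < e"
    show "sqnorm G (T (delta \<one>)) \<le> 0 + e" using small[of "min 1 (e / 4)"] e by simp
  qed
  then show ?thesis by (rule sqnorm_eq_0[OF bdd_op_l2[OF Tb delta_l2[OF one_closed]]])
qed

lemma bdd_op_sum:
  assumes T: "bdd_op G T" and "\<And>i. i \<in> A \<Longrightarrow> u i \<in> l2 G"
  shows "T (\<lambda>x. \<Sum>i\<in>A. u i x) = (\<lambda>x. \<Sum>i\<in>A. T (u i) x)"
  using assms(2)
  by (induction A rule: infinite_finite_induct)
    (simp_all add: bdd_op_zero[OF T] bdd_op_add[OF T] l2_sum)

lemma l2_finite_approx: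
  assumes f: "f \<in> l2 G" and e: "e > 0"
  obtains F where "finite F" "F \<subseteq> carrier G" "sqnorm G (\<lambda>x. f x - (\<Sum>g\<in>F. f g * delta g x)) \<le> e"
proof -
  obtain F where F: "finite F" "F \<subseteq> carrier G" and
    d: "dist (\<Sum>x\<in>F. (cmod (f x))\<^sup>2) (infsum (\<lambda>x. (cmod (f x))\<^sup>2) (carrier G)) \<le> e"
    using infsum_finite_approximation[OF l2_summable[OF f] e] by blast
  define h where "h x = (\<Sum>g\<in>F. f g * delta g x)" for x
  have h: "h x = (if x \<in> F then f x else 0)" for x
    using F by (simp add: h_def delta_def sum.delta if_distrib[of "\<lambda>t. _ * t"] cong: if_cong)
  have hs: "((\<lambda>x. (cmod (h x))\<^sup>2) has_sum (\<Sum>x\<in>F. (cmod (f x))\<^sup>2)) (carrier G)"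
    by (rule has_sum_finite_neutralI[OF F(1)]) (use F in \<open>auto simp: h\<close>)
  have hl: "h \<in> l2 G" using hs F by (auto simp: l2_def has_sum_iff h)
  \<comment> \<open>The truncation and the remainder have disjoint supports, so the squares add
    pointwise.\<close>
  have "sqnorm G f = infsum (\<lambda>x. (cmod (f x - h x))\<^sup>2 + (cmod (h x))\<^sup>2) (carrier G)"
    unfolding sqnorm_def by (rule infsum_cong) (simp add: h)
  also have "\<dots> = sqnorm G (\<lambda>x. f x - h x) + sqnorm G h"
    unfolding sqnorm_def by (intro infsum_add l2_summable l2_diff f hl)
  finally have "sqnorm G (\<lambda>x. f x - h x) \<le> e"
    using d hs by (simp add: dist_real_def sqnorm_def has_sum_iff)
  then show ?thesis using that[OF F] by (simp add: h_def)
qed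

text \<open>\<open>T\<close> at \<open>delta g\<close> equals \<open>T \<circ> lr g\<close> at
  \<open>delta \<one>\<close>, and \<open>T \<circ> lr g\<close> is again in the ideal. So
  \<open>T\<close> kills all point masses, hence everything by boundedness and density of their
  span.\<close>

lemma ideal_trivial:
  assumes b: "boundary_point q m" and I: "closed_ideal_Cr G I" and proper: "lr \<one> \<notin> I"
    and avoid: "\<And>S. finite S \<Longrightarrow> S \<subseteq> carrier G \<Longrightarrow> \<one> \<notin> S \<Longrightarrow>
      \<exists>g\<in>carrier G. \<forall>s\<in>S. inv g \<otimes> s \<otimes> g \<notin> mean_stab m"
    and T: "T \<in> I"
  shows "T = op_zero"
proof
  fix f
  have Tb: "bdd_op G T" by (rule ideal_bdd[OF I T])
  have Td: "T (delta g) = (\<lambda>_. 0)" if g: "g \<in> carrier G" for g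
    using ideal_kills_delta_one[OF b I proper avoid ideal_mult(2)[OF I T lr_reduced_Cstar[OF g]]]
    by (simp add: lr_delta[OF g])
  show "T f = op_zero f"
  proof (cases "f \<in> l2 G")
    case f: True
    obtain C where C: "C > 0" "\<And>f. f \<in> l2 G \<Longrightarrow> sqnorm G (T f) \<le> C * sqnorm G f"
      using bdd_op_bound[OF Tb] by blast
    have "sqnorm G (T f) \<le> 0"
    proof (rule field_le_epsilon)
      fix e :: real assume e: "0 < e"
      obtain F where F: "finite F" "F \<subseteq> carrier G"
        and d: "sqnorm G (\<lambda>x. f x - (\<Sum>g\<in>F. f g * delta g x)) \<le> e / C"
        using l2_finite_approx[OF f, of "e / C"] e C by auto
      define h where "h = (\<lambda>x. \<Sum>g\<in>F. f g * delta g x)"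
      have h: "h \<in> l2 G" unfolding h_def using F by (intro l2_sum l2_scale delta_l2) auto
      have "T h = (\<lambda>x. \<Sum>g\<in>F. T (\<lambda>x. f g * delta g x) x)"
        unfolding h_def using F by (intro bdd_op_sum[OF Tb] l2_scale delta_l2) auto
      also have "\<dots> = (\<lambda>_. 0)"
        using F by (intro ext sum.neutral ballI) (auto simp: bdd_op_scale[OF Tb delta_l2] Td)
      finally have "T h = (\<lambda>_. 0)" .
      then have "T f = T (\<lambda>x. f x - h x)"
        using bdd_op_add[OF Tb l2_diff[OF f h] h] by simp
      then have "sqnorm G (T f) \<le> C * sqnorm G (\<lambda>x. f x - h x)" using C(2)[OF l2_diff[OF f h]] by simp
      also have "\<dots> \<le> C * (e / C)" using d C by (intro mult_left_mono) (auto simp: h_def)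
      finally show "sqnorm G (T f) \<le> 0 + e" using C by simp
    qed
    then show ?thesis using sqnorm_eq_0[OF bdd_op_l2[OF Tb f]] by (simp add: op_zero_def)
  qed (simp add: bdd_op_outside[OF Tb] op_zero_def)
qed

text \<open>\<open>lr \<one>\<close> is the identity on \<open>l2 G\<close> and 0 elsewhere, hence
  the unit for operators that vanish outside \<open>l2 G\<close>.\<close>

lemma ideal_with_one:
  assumes I: "closed_ideal_Cr G I" and one: "lr \<one> \<in> I"
  shows "I = reduced_Cstar G"
proof
  show "I \<subseteq> reduced_Cstar G" using I by (simp add: closed_ideal_Cr_def)
  show "reduced_Cstar G \<subseteq> I"
  proof
    fix A assume A: "A \<in> reduced_Cstar G"
    then have Ab: "bdd_op G A" by (simp add: reduced_Cstar_def)
    have "(A \<circ> lr \<one>) f = A f" for f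
      by (cases "f \<in> l2 G")
        (simp_all add: lr_one bdd_op_outside[OF Ab] bdd_op_outside[OF bdd_op_lr[OF one_closed]] bdd_op_zero[OF Ab])
    then have "A \<circ> lr \<one> = A" by (rule ext)
    then show "A \<in> I" using ideal_mult(1)[OF I one A] by simp
  qed
qed

end

theorem theorem2p13:
  fixes G :: "('a, 'b) monoid_scheme"
  assumes "group G"
    and "\<And>N. N \<lhd> G \<Longrightarrow> finite N \<Longrightarrow> N = {\<one>\<^bsub>G\<^esub>}"
    and "\<And>H. normalish G H \<Longrightarrow> \<not> amenable_subgroup G H"
  shows "C_star_simple G"
proof -
  interpret group G by (rule assms(1))
  obtain q m where b: "boundary_point q m" by (rule boundary_point_exists)
  then have m: "mean (carrier G) m" by (simp add: boundary_point_def)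
  have "\<not> normalish G (mean_stab m)" using assms(3) amenable_mean_stab[OF m] by blast
  then obtain T where T: "finite T" "T \<noteq> {}" "T \<subseteq> carrier G"
    "(\<Inter>t\<in>T. conjugate G t (mean_stab m)) = {\<one>\<^bsub>G\<^esub>}"
    using trivial_core_of_not_normalish[OF assms(2) subgroup_mean_stab[OF m]] by blast
  show ?thesis unfolding C_star_simple_def
  proof (intro allI impI)
    fix I assume I: "closed_ideal_Cr G I"
    show "I = {op_zero} \<or> I = reduced_Cstar G"
    proof (cases "left_reg G \<one>\<^bsub>G\<^esub> \<in> I")
      case True
      then show ?thesis using ideal_with_one[OF I] by blast
    next
      case False
      have "V = op_zero" if "V \<in> I" for V
        by (rule ideal_trivial[OF b I False avoid_mean_stab[OF b T] that])
      moreover have "op_zero \<in> I" using I by (simp add: closed_ideal_Cr_def)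
      ultimately show ?thesis by blast
    qed
  qed
qed

end
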